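(* Let $s\in\mathbb{R}$. Assume the following three hypotheses: (a) $\partial_x\mathcal{A}\psi_k=i\lambda_k\psi_k$ with $\lambda_k=k\,a(k)$, for all $k\in\mathbb{Z}$; (b) there are $n_0,k_1^*\in\mathbb{N}$ such that $m(k_1)\le n_0$ for all $k_1\in\mathbb{Z}$ with $|k_1|<k_1^*$, and $m(k_1)=2$ for all $k_1\in\mathbb{Z}$ with $|k_1|\ge k_1^*$; (c) $a(-k)=-a(k)$ for all $k\in\mathbb{Z}$ with $|k|\ge k_1^*$. Let $\mathbb{J}\subset\{-k_1^*+1,-k_1^*+2,\ldots\}$ be an index set obtained by counting only distinct eigenvalues, that is, $\mathbb{J}$ contains exactly one index from each class $I(k)$, so that $\lambda_{k_1}\neq\lambda_{k_2}$ for all $k_1\ne k_2$ in $\mathbb{J}$. Suppose $$\tilde\gamma:=\inf_{\substack{k,n\in\mathbb{J}\\ k\ne n}}|\lambda_k-\lambda_n|>0\qquad\text{and}\qquad\tilde\gamma':=\sup_{S\subset\mathbb{J}}\ \inf_{\substack{k,n\in\mathbb{J}\setminus S\\ k\ne n}}|\lambda_k-\lambda_n|>0,$$ where $S$ runs over the finite subsets of $\mathbb{J}$. Then for any $T>\frac{2\pi}{\tilde\gamma'}$ and for each $u_0,u_1\in H^s_p(\mathbb{T})$ with $\widehat{u_0}(0)=\widehat{u_1}(0)$, there exists a function $h\in L^2([0,T];H^s_p(\mathbb{T}))$ such that the unique solution $u$ of the non-homogeneous system $$\begin{cases}u\in C([0,T];H^s_p(\mathbb{T})),\\ \partial_tu(t)=\partial_x\mathcal{A}u(t)+G(h)(t)\in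 H^{s-r}_p(\mathbb{T}),\quad t\in(0,T),\\ u(0)=u_0,\end{cases}$$ satisfies $u(T)=u_1$. Moreover, there exists a positive constant $\nu\equiv\nu(s,g,T)$ such that $$\|h\|_{L^2([0,T];H^s_p(\mathbb{T}))}\le\nu\,\bigl(\|u_0\|_{H^s_p(\mathbb{T})}+\|u_1\|_{H^s_p(\mathbb{T})}\bigr).$$
   Context: Notation. $\mathbb{T}=\mathbb{R}/(2\pi\mathbb{Z})$; $\mathscr{P}=C_p^\infty(\mathbb{T})$ is the space of $2\pi$-periodic $C^\infty$ functions, $\mathscr{P}'$ the space of periodic distributions, $\langle\cdot,\cdot\rangle$ the (bilinear) pairing between $\mathscr{P}'$ and $\mathscr{P}$. For $v\in\mathscr{P}'$, $\widehat v(k)=\frac1{2\pi}\langle v,e^{-ikx}\rangle$, $k\in\mathbb{Z}$. $\psi_k(x)=e^{ikx}/\sqrt{2\pi}$. For $s\in\mathbb{R}$, $H^s_p(\mathbb{T})=\{v\in\mathscr{P}':\|v\|^2_{H^s_p(\mathbb{T})}=2\pi\sum_{k\in\mathbb{Z}}(1+|k|)^{2s}|\widehat v(k)|^2<\infty\}$. The operator $\mathcal{A}$. $\mathcal{A}$ is a linear Fourier multiplier with real symbol $a:\mathbb{Z}\to\mathbb{R}$, i.e. $\widehat{\mathcal{A}u}(k)=a(k)\widehat u(k)$, and there are $r\ge1$, $k_0\ge0$ and $C>0$ with $|a(k)|\le C|k|^{r-1}$ for all $|k|\ge k_0$. Multiplicities. With $\lambda_k=k\,a(k)$, for $k_1\in\mathbb{Z}$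 put $I(k_1)=\{k\in\mathbb{Z}:\lambda_k=\lambda_{k_1}\}$ and $m(k_1)=|I(k_1)|$ (number of elements). The operator $G$. $g\in C_p^\infty(\mathbb{T})$ is a fixed real non-negative function with $2\pi\widehat g(0)=\int_0^{2\pi}g(x)\,dx=1$, supported in $\omega$, where $\omega=\{x\in\mathbb{T}:g(x)>0\}$ is an open interval. $G(\phi)=g\phi-g\,\langle\phi,g\rangle$ for $\phi\in H^s_p(\mathbb{T})$; it is a bounded linear operator on $H^s_p(\mathbb{T})$, applied to $h$ as $G(h)(t)=G(h(\cdot,t))$. The solution of the non-homogeneous system is understood in the mild sense $u(t)=U(t)u_0+\int_0^tU(t-t')G(h)(t')\,dt'$, where $\widehat{U(t)\varphi}(k)=e^{ika(k)t}\widehat\varphi(k)$. If $\tilde\gamma'=+\infty$, $2\pi/\tilde\gamma'$ is read as $0$. *)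

theory Defs
  imports "HOL-Analysis.Analysis"
begin

section \<open>Periodic test functions\<close>

text \<open>Functions on the torus are \<open>2 * pi\<close>-periodic functions on the real line.\<close>

definition vderiv :: "(real \<Rightarrow> complex) \<Rightarrow> real \<Rightarrow> complex" where
  "vderiv f = (\<lambda>x. vector_derivative f (at x))"

definition periodic_test :: "(real \<Rightarrow> complex) set" where
  "periodic_test = {\<phi>. (\<forall>n x. (vderiv ^^ n) \<phi> differentiable (at x)) \<and> (\<forall>x. \<phi> (x + 2 * pi) = \<phi> x)}"

definition test_converges :: "(nat \<Rightarrow> real \<Rightarrow> complex) \<Rightarrow> (real \<Rightarrow> complex) \<Rightarrow> bool" where
  "test_converges \<phi>s \<phi> \<longleftrightarrow>
     (\<forall>j. uniform_limit UNIV (\<lambda>n. (vderiv ^^ j) (\<phi>s n)) ((vderiv ^^ j) \<phi>) sequentially)"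

definition cexpi :: "int \<Rightarrow> real \<Rightarrow> complex" where
  "cexpi k = (\<lambda>x. exp (\<i> * of_int k * of_real x))"

lemma differentiable_vderiv:
  "f differentiable (at x) \<Longrightarrow> (f has_vector_derivative vderiv f x) (at x)"
  by (simp add: vderiv_def vector_derivative_works)

lemma vderivI: "(\<And>x. (f has_vector_derivative f' x) (at x)) \<Longrightarrow> vderiv f = f'"
  by (auto simp: vderiv_def fun_eq_iff vector_derivative_at)

definition differentiable_upto :: "nat \<Rightarrow> (real \<Rightarrow> complex) \<Rightarrow> bool" where
  "differentiable_upto n f \<longleftrightarrow> (\<forall>m<n. \<forall>x. (vderiv ^^ m) f differentiable (at x))"

lemma differentiable_upto_0 [simp]: "differentiable_upto 0 f"
  by (simp add: differentiable_upto_def)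

lemma differentiable_upto_Suc:
  "differentiable_upto (Suc n) f \<longleftrightarrow> (\<forall>x. f differentiable (at x)) \<and> differentiable_upto n (vderiv f)"
proof -
  have "differentiable_upto (Suc n) f \<longleftrightarrow>
      (\<forall>x. f differentiable (at x)) \<and> (\<forall>m<n. \<forall>x. (vderiv ^^ Suc m) f differentiable (at x))"
    unfolding differentiable_upto_def by (auto simp: less_Suc_eq_0_disj)
  then show ?thesis
    by (simp add: differentiable_upto_def funpow_Suc_right del: funpow.simps)
qed

lemma differentiable_upto_mono:
  "differentiable_upto (Suc n) f \<Longrightarrow> differentiable_upto n f"
  by (auto simp: differentiable_upto_def)

lemma vderiv_add:
  assumes "\<And>x. f differentiable (at x)" "\<And>x. g differentiable (at x)"
  shows "vderiv (\<lambda>x. f x + g x) = (\<lambda>x. vderiv f x + vderiv g x)"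
  by (rule vderivI) (intro has_vector_derivative_add differentiable_vderiv assms)

lemma vderiv_mult:
  assumes "\<And>x. f differentiable (at x)" "\<And>x. g differentiable (at x)"
  shows "vderiv (\<lambda>x. f x * g x) = (\<lambda>x. f x * vderiv g x + vderiv f x * g x)"
  by (rule vderivI) (intro has_vector_derivative_mult differentiable_vderiv assms)

lemma vderiv_const [simp]: "vderiv (\<lambda>x. c) = (\<lambda>x. 0)"
  by (rule vderivI) simp

lemma differentiable_upto_const: "differentiable_upto n (\<lambda>x. c)"
  by (induction n arbitrary: c) (simp_all add: differentiable_upto_Suc)

lemma differentiable_upto_add:
  "differentiable_upto n f \<Longrightarrow> differentiable_upto n g \<Longrightarrow> differentiable_upto n (\<lambda>x. f x + g x)"
  by (induction n arbitrary: f g) (auto simp: differentiable_upto_Suc vderiv_add)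

lemma differentiable_upto_mult:
  "differentiable_upto n f \<Longrightarrow> differentiable_upto n g \<Longrightarrow> differentiable_upto n (\<lambda>x. f x * g x)"
proof (induction n arbitrary: f g)
  case (Suc n)
  have "differentiable_upto n (\<lambda>x. f x * vderiv g x + vderiv f x * g x)"
    using Suc.prems
    by (intro differentiable_upto_add Suc.IH) (auto intro: differentiable_upto_mono simp: differentiable_upto_Suc)
  with Suc.prems show ?case
    by (auto simp: differentiable_upto_Suc vderiv_mult)
qed simp

lemma periodic_test_iff:
  "\<phi> \<in> periodic_test \<longleftrightarrow> (\<forall>n. differentiable_upto n \<phi>) \<and> (\<forall>x. \<phi> (x + 2 * pi) = \<phi> x)"
  unfolding periodic_test_def differentiable_upto_def by blast

lemma periodic_test_differentiable: "\<phi> \<in> periodic_test \<Longrightarrow> \<phi> differentiable (at x)"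
  by (auto simp: periodic_test_def dest: spec[of _ 0])

lemma periodic_test_continuous: "\<phi> \<in> periodic_test \<Longrightarrow> continuous_on S \<phi>"
  by (intro continuous_at_imp_continuous_on ballI differentiable_imp_continuous_within periodic_test_differentiable)

lemma periodic_test_const: "(\<lambda>x. c) \<in> periodic_test"
  by (simp add: periodic_test_iff differentiable_upto_const)

lemma periodic_test_add:
  "\<phi> \<in> periodic_test \<Longrightarrow> \<psi> \<in> periodic_test \<Longrightarrow> (\<lambda>x. \<phi> x + \<psi> x) \<in> periodic_test"
  by (simp add: periodic_test_iff differentiable_upto_add)

lemma periodic_test_mult:
  "\<phi> \<in> periodic_test \<Longrightarrow> \<psi> \<in> periodic_test \<Longrightarrow> (\<lambda>x. \<phi> x * \<psi> x) \<in> periodic_test"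
  by (simp add: periodic_test_iff differentiable_upto_mult)

lemma periodic_test_vderiv:
  assumes "\<phi> \<in> periodic_test" shows "vderiv \<phi> \<in> periodic_test"
proof -
  have "vderiv \<phi> (x + 2 * pi) = vderiv \<phi> x" for x
  proof -
    have "(\<phi> has_vector_derivative vderiv \<phi> (x + 2 * pi)) (at (x + 2 * pi))"
      using assms by (intro differentiable_vderiv periodic_test_differentiable)
    moreover have "((\<lambda>x. x + 2 * pi) has_vector_derivative 1) (at x)"
      by (auto intro!: derivative_eq_intros)
    ultimately have "(\<phi> \<circ> (\<lambda>x. x + 2 * pi) has_vector_derivative 1 *\<^sub>R vderiv \<phi> (x + 2 * pi)) (at x)"
      by (intro vector_diff_chain_at) auto
    moreover have "\<phi> \<circ> (\<lambda>x. x + 2 * pi) = \<phi>"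
      using assms by (auto simp: periodic_test_def)
    ultimately show ?thesis
      by (simp add: vderiv_def vector_derivative_at)
  qed
  moreover have "differentiable_upto n (vderiv \<phi>)" for n
    using assms by (auto simp: periodic_test_iff dest!: spec[of _ "Suc n"] simp: differentiable_upto_Suc)
  ultimately show ?thesis by (simp add: periodic_test_iff)
qed

lemma cexpi_deriv: "vderiv (cexpi k) = (\<lambda>x. (\<i> * of_int k) * cexpi k x)"
  and cexpi_differentiable: "cexpi k differentiable (at x)"
proof -
  have *: "(cexpi k has_vector_derivative (\<i> * of_int k) * cexpi k x) (at x)" for x
  proof -
    have 1: "((\<lambda>z. exp (\<i> * of_int k * z)) has_field_derivative (\<i> * of_int k) * cexpi k x) (at (of_real x))"
      unfolding cexpi_def by (auto intro!: derivative_eq_intros)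
    have 2: "(complex_of_real has_vector_derivative 1) (at x)"
      using has_vector_derivative_of_real[OF DERIV_ident] by fastforce
    show ?thesis
      using field_vector_diff_chain_at[OF 2 1] unfolding cexpi_def o_def by simp
  qed
  show "vderiv (cexpi k) = (\<lambda>x. (\<i> * of_int k) * cexpi k x)"
    by (rule vderivI) (rule *)
  show "cexpi k differentiable (at x)"
    using * by (rule differentiableI_vector)
qed

lemma periodic_test_cexpi: "cexpi k \<in> periodic_test"
proof -
  have "cexpi k (x + 2 * pi) = cexpi k x" for x
  proof -
    have "exp (2 * of_int k * of_real pi * \<i>) = 1"
      using exp_integer_2pi[of "of_int k"] by (simp add: mult_ac)
    then show ?thesis
      by (simp add: cexpi_def algebra_simps exp_add)
  qed
  moreover have "differentiable_upto n (\<lambda>x. c * cexpi k x)" for n c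
  proof (induction n arbitrary: c)
    case (Suc n)
    have "vderiv (\<lambda>x. c * cexpi k x) = (\<lambda>x. (c * (\<i> * of_int k)) * cexpi k x)"
      by (subst vderiv_mult) (simp_all add: cexpi_differentiable cexpi_deriv algebra_simps)
    with Suc show ?case
      by (simp add: differentiable_upto_Suc cexpi_differentiable)
  qed simp
  from this[of _ 1] have "differentiable_upto n (cexpi k)" for n by simp
  ultimately show ?thesis by (simp add: periodic_test_iff)
qed

lemma vderiv_add_funpow:
  assumes "\<phi> \<in> periodic_test" "\<psi> \<in> periodic_test"
  shows "(vderiv ^^ j) (\<lambda>x. \<phi> x + \<psi> x) = (\<lambda>x. (vderiv ^^ j) \<phi> x + (vderiv ^^ j) \<psi> x)"
  using assms
proof (induction j arbitrary: \<phi> \<psi>)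
  case (Suc j)
  then show ?case
    by (simp add: funpow_Suc_right vderiv_add periodic_test_differentiable periodic_test_vderiv
        del: funpow.simps)
qed simp

lemma test_converges_vderiv: "test_converges \<phi>s \<phi> \<Longrightarrow> test_converges (\<lambda>n. vderiv (\<phi>s n)) (vderiv \<phi>)"
  unfolding test_converges_def
proof
  fix j
  assume "\<forall>j. uniform_limit UNIV (\<lambda>n. (vderiv ^^ j) (\<phi>s n)) ((vderiv ^^ j) \<phi>) sequentially"
  then have "uniform_limit UNIV (\<lambda>n. (vderiv ^^ Suc j) (\<phi>s n)) ((vderiv ^^ Suc j) \<phi>) sequentially" ..
  then show "uniform_limit UNIV (\<lambda>n. (vderiv ^^ j) (vderiv (\<phi>s n))) ((vderiv ^^ j) (vderiv \<phi>)) sequentially"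
    by (simp only: funpow_Suc_right o_apply)
qed

lemma periodic_test_bounded:
  assumes "\<phi> \<in> periodic_test" shows "bounded (range \<phi>)"
proof -
  have "range \<phi> \<subseteq> \<phi> ` {0..2 * pi}"
  proof clarify
    fix x
    define n where "n = \<lfloor>x / (2 * pi)\<rfloor>"
    define y where "y = x - 2 * pi * of_int n"
    interpret periodic_fun_simple \<phi> "2 * pi"
      by unfold_locales (use assms in \<open>auto simp: periodic_test_def\<close>)
    have "\<phi> (y + of_int n * (2 * pi)) = \<phi> y" by (rule plus_of_int)
    then have "\<phi> x = \<phi> y" by (simp add: y_def algebra_simps)
    moreover have "y \<in> {0..2 * pi}"
    proof -
      have "of_int n \<le> x / (2 * pi)" "x / (2 * pi) \<le> of_int n + 1"
        unfolding n_def by linarith+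
      then show ?thesis by (simp add: y_def field_simps)
    qed
    ultimately show "\<phi> x \<in> \<phi> ` {0..2 * pi}" by blast
  qed
  moreover have "compact (\<phi> ` {0..2 * pi})"
    by (intro compact_continuous_image periodic_test_continuous assms) simp
  ultimately show ?thesis
    using bounded_subset compact_imp_bounded by blast
qed

lemma test_converges_mult:
  assumes "g \<in> periodic_test" "\<And>n. \<phi>s n \<in> periodic_test" "\<phi> \<in> periodic_test" "test_converges \<phi>s \<phi>"
  shows "test_converges (\<lambda>n x. g x * \<phi>s n x) (\<lambda>x. g x * \<phi> x)"
proof -
  have "uniform_limit UNIV (\<lambda>n. (vderiv ^^ j) (\<lambda>x. g x * \<phi>s n x)) ((vderiv ^^ j) (\<lambda>x. g x * \<phi> x)) sequentially" for j
    using assms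
  proof (induction j arbitrary: g \<phi>s \<phi>)
    case 0
    have lim: "uniform_limit UNIV \<phi>s \<phi> sequentially"
      using 0(4)[unfolded test_converges_def, rule_format, of 0] by simp
    have "uniform_limit UNIV (\<lambda>n x. g x * \<phi>s n x) (\<lambda>x. g x * \<phi> x) sequentially"
      by (intro bounded_bilinear.bounded_uniform_limit[OF bounded_bilinear_mult] lim
          uniform_limit_const periodic_test_bounded 0)
    then show ?case by simp
  next
    case (Suc j)
    have eq: "(vderiv ^^ Suc j) (\<lambda>x. g x * \<psi> x) =
        (\<lambda>x. (vderiv ^^ j) (\<lambda>x. g x * vderiv \<psi> x) x + (vderiv ^^ j) (\<lambda>x. vderiv g x * \<psi> x) x)"
      if "\<psi> \<in> periodic_test" for \<psi>
      using that Suc.prems(1)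
      by (simp add: funpow_Suc_right vderiv_mult periodic_test_differentiable del: funpow.simps)
        (intro vderiv_add_funpow periodic_test_mult periodic_test_vderiv)
    show ?case
      unfolding eq[OF Suc.prems(2)] eq[OF Suc.prems(3)]
      by (intro uniform_limit_intros Suc.IH Suc.prems test_converges_vderiv periodic_test_vderiv)
  qed
  then show ?thesis by (simp add: test_converges_def)
qed


section \<open>Periodic distributions\<close>

text \<open>
  The value outside \<^const>\<open>periodic_test\<close> carries no information; fixing it to 0 makes two
  distributions equal as soon as they agree on test functions.
\<close>

definition is_distribution :: "((real \<Rightarrow> complex) \<Rightarrow> complex) \<Rightarrow> bool" where
  "is_distribution v \<longleftrightarrow>
     (\<forall>\<phi>\<in>periodic_test. \<forall>\<psi>\<in>periodic_test. v (\<lambda>x. \<phi> x + \<psi> x) = v \<phi> + v \<psi>) \<and>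
     (\<forall>c. \<forall>\<phi>\<in>periodic_test. v (\<lambda>x. c * \<phi> x) = c * v \<phi>) \<and>
     (\<forall>\<phi>s. \<forall>\<phi>\<in>periodic_test. (\<forall>n. \<phi>s n \<in> periodic_test) \<and> test_converges \<phi>s \<phi> \<longrightarrow>
       (\<lambda>n. v (\<phi>s n)) \<longlonglongrightarrow> v \<phi>) \<and>
     (\<forall>\<phi>. \<phi> \<notin> periodic_test \<longrightarrow> v \<phi> = 0)"

lemma is_distributionI:
  assumes "\<And>\<phi> \<psi>. \<phi> \<in> periodic_test \<Longrightarrow> \<psi> \<in> periodic_test \<Longrightarrow> v (\<lambda>x. \<phi> x + \<psi> x) = v \<phi> + v \<psi>"
    and "\<And>c \<phi>. \<phi> \<in> periodic_test \<Longrightarrow> v (\<lambda>x. c * \<phi> x) = c * v \<phi>"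
    and "\<And>\<phi>s \<phi>. \<phi> \<in> periodic_test \<Longrightarrow> (\<And>n. \<phi>s n \<in> periodic_test) \<Longrightarrow> test_converges \<phi>s \<phi> \<Longrightarrow>
      (\<lambda>n. v (\<phi>s n)) \<longlonglongrightarrow> v \<phi>"
    and "\<And>\<phi>. \<phi> \<notin> periodic_test \<Longrightarrow> v \<phi> = 0"
  shows "is_distribution v"
  using assms unfolding is_distribution_def by blast

lemma is_distributionD:
  assumes "is_distribution v"
  shows "\<And>\<phi> \<psi>. \<phi> \<in> periodic_test \<Longrightarrow> \<psi> \<in> periodic_test \<Longrightarrow> v (\<lambda>x. \<phi> x + \<psi> x) = v \<phi> + v \<psi>"
    and "\<And>c \<phi>. \<phi> \<in> periodic_test \<Longrightarrow> v (\<lambda>x. c * \<phi> x) = c * v \<phi>"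
    and "\<And>\<phi>s \<phi>. \<phi> \<in> periodic_test \<Longrightarrow> (\<And>n. \<phi>s n \<in> periodic_test) \<Longrightarrow> test_converges \<phi>s \<phi> \<Longrightarrow>
      (\<lambda>n. v (\<phi>s n)) \<longlonglongrightarrow> v \<phi>"
    and "\<And>\<phi>. \<phi> \<notin> periodic_test \<Longrightarrow> v \<phi> = 0"
  using assms unfolding is_distribution_def by blast+

typedef pdistr = "{v. is_distribution v}"
  morphisms pairing Abs_pdistr
  by (rule exI[of _ "\<lambda>_. 0"]) (simp add: is_distribution_def)

setup_lifting type_definition_pdistr

instantiation pdistr :: real_vector
begin

lift_definition zero_pdistr :: pdistr is "\<lambda>_. 0"
  by (simp add: is_distribution_def)

lift_definition plus_pdistr :: "pdistr \<Rightarrow> pdistr \<Rightarrow> pdistr" is "\<lambda>v w \<phi>. v \<phi> + w \<phi>"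
  by (rule is_distributionI) (auto simp: is_distributionD algebra_simps intro!: tendsto_add)

lift_definition minus_pdistr :: "pdistr \<Rightarrow> pdistr \<Rightarrow> pdistr" is "\<lambda>v w \<phi>. v \<phi> - w \<phi>"
  by (rule is_distributionI) (auto simp: is_distributionD algebra_simps intro!: tendsto_diff)

lift_definition uminus_pdistr :: "pdistr \<Rightarrow> pdistr" is "\<lambda>v \<phi>. - v \<phi>"
  by (rule is_distributionI) (auto simp: is_distributionD intro!: tendsto_minus)

lift_definition scaleR_pdistr :: "real \<Rightarrow> pdistr \<Rightarrow> pdistr" is "\<lambda>c v \<phi>. c *\<^sub>R v \<phi>"
  by (rule is_distributionI) (auto simp: is_distributionD algebra_simps intro!: tendsto_scaleR)

instance
  by standard (transfer; simp add: fun_eq_iff algebra_simps)+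

end

lift_definition cscale :: "complex \<Rightarrow> pdistr \<Rightarrow> pdistr" is "\<lambda>c v \<phi>. c * v \<phi>"
  by (rule is_distributionI) (auto simp: is_distributionD algebra_simps intro!: tendsto_mult)

lift_definition distr_deriv :: "pdistr \<Rightarrow> pdistr" is
  "\<lambda>v \<phi>. if \<phi> \<in> periodic_test then - v (vderiv \<phi>) else 0"
proof (rule is_distributionI, goal_cases)
  case (1 v \<phi> \<psi>)
  then show ?case
    by (simp add: is_distributionD periodic_test_add vderiv_add periodic_test_differentiable periodic_test_vderiv)
next
  case (2 v c \<phi>)
  then show ?case
    using periodic_test_mult[OF periodic_test_const[of c] 2(2)]
    by (simp add: is_distributionD vderiv_mult periodic_test_differentiable periodic_test_vderiv)
next
  case (3 v \<phi>s \<phi>)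
  then show ?case
    by (simp add: tendsto_minus is_distributionD(3)[of v] periodic_test_vderiv test_converges_vderiv)
qed simp

text \<open>The product of a test function and a distribution; the first argument is meant to lie in
  \<^const>\<open>periodic_test\<close>.\<close>

lift_definition distr_mult :: "(real \<Rightarrow> complex) \<Rightarrow> pdistr \<Rightarrow> pdistr" is
  "\<lambda>g v \<phi>. if g \<in> periodic_test \<and> \<phi> \<in> periodic_test then v (\<lambda>x. g x * \<phi> x) else 0"
proof (rule is_distributionI, goal_cases)
  case (1 g v \<phi> \<psi>)
  have "g \<in> periodic_test \<Longrightarrow> v (\<lambda>x. g x * \<phi> x + g x * \<psi> x) = v (\<lambda>x. g x * \<phi> x) + v (\<lambda>x. g x * \<psi> x)"
    using 1 by (intro is_distributionD periodic_test_mult)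
  with 1 show ?case
    by (simp add: periodic_test_add distrib_left)
next
  case (2 g v c \<phi>)
  have "g \<in> periodic_test \<Longrightarrow> v (\<lambda>x. c * (g x * \<phi> x)) = c * v (\<lambda>x. g x * \<phi> x)"
    using 2 by (intro is_distributionD periodic_test_mult)
  with 2 show ?case
    using periodic_test_mult[OF periodic_test_const[of c] 2(2)]
    by (simp add: mult.left_commute)
next
  case (3 g v \<phi>s \<phi>)
  then show ?case
    by (simp add: is_distributionD(3)[of v] periodic_test_mult test_converges_mult)
qed simp

text \<open>The regular distribution induced by a function in \<^const>\<open>periodic_test\<close>.\<close>

lift_definition distr_of :: "(real \<Rightarrow> complex) \<Rightarrow> pdistr" is
  "\<lambda>f \<phi>. if f \<in> periodic_test \<and> \<phi> \<in> periodic_test then integral {0..2 * pi} (\<lambda>x. f x * \<phi> x) else 0"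
proof (rule is_distributionI, goal_cases)
  case (1 f \<phi> \<psi>)
  have "f \<in> periodic_test \<Longrightarrow> integral {0..2 * pi} (\<lambda>x. f x * \<phi> x + f x * \<psi> x)
      = integral {0..2 * pi} (\<lambda>x. f x * \<phi> x) + integral {0..2 * pi} (\<lambda>x. f x * \<psi> x)"
    using 1 by (intro integral_add integrable_continuous_real continuous_intros periodic_test_continuous)
  with 1 show ?case
    by (simp add: periodic_test_add distrib_left)
next
  case (2 f c \<phi>)
  have "integral {0..2 * pi} (\<lambda>x. c * (f x * \<phi> x)) = c * integral {0..2 * pi} (\<lambda>x. f x * \<phi> x)"
    by simp
  with 2 show ?case
    using periodic_test_mult[OF periodic_test_const[of c] 2(1)]
    by (simp add: mult.left_commute)
next
  case (3 f \<phi>s \<phi>)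
  show ?case
  proof (cases "f \<in> periodic_test")
    case True
    have "test_converges (\<lambda>n x. f x * \<phi>s n x) (\<lambda>x. f x * \<phi> x)"
      using 3 True by (intro test_converges_mult)
    then have "uniform_limit UNIV (\<lambda>n x. f x * \<phi>s n x) (\<lambda>x. f x * \<phi> x) sequentially"
      unfolding test_converges_def by (auto dest: spec[of _ 0])
    then have "uniform_limit {0..2 * pi} (\<lambda>n x. f x * \<phi>s n x) (\<lambda>x. f x * \<phi> x) sequentially"
      by (rule uniform_limit_on_subset) simp
    moreover have "continuous_on {0..2 * pi} (\<lambda>x. f x * \<phi>s n x)" for n
      using 3 True by (simp add: periodic_test_continuous periodic_test_mult)
    ultimately obtain I J where IJ: "\<And>n. ((\<lambda>x. f x * \<phi>s n x) has_integral I n) {0..2 * pi}"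
      "((\<lambda>x. f x * \<phi> x) has_integral J) {0..2 * pi}" "I \<longlonglongrightarrow> J"
      by (rule uniform_limit_integral) auto
    then have "(\<lambda>n. integral {0..2 * pi} (\<lambda>x. f x * \<phi>s n x)) \<longlonglongrightarrow> integral {0..2 * pi} (\<lambda>x. f x * \<phi> x)"
      unfolding integral_unique[OF IJ(1)] integral_unique[OF IJ(2)] by simp
    with True 3 show ?thesis by simp
  qed simp
qed simp

definition fourier_coeff :: "pdistr \<Rightarrow> int \<Rightarrow> complex" where
  "fourier_coeff v k = pairing v (cexpi (- k)) / (2 * pi)"

definition fourier_mode :: "int \<Rightarrow> pdistr" where
  "fourier_mode k = distr_of (\<lambda>x. cexpi k x / sqrt (2 * pi))"


section \<open>Sobolev spaces\<close>

definition sobolev_weight :: "real \<Rightarrow> int \<Rightarrow> real" where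
  "sobolev_weight s k = (1 + \<bar>real_of_int k\<bar>) powr (2 * s)"

definition sobolev :: "real \<Rightarrow> pdistr set" where
  "sobolev s = {v. (\<lambda>k. sobolev_weight s k * (cmod (fourier_coeff v k))\<^sup>2) summable_on UNIV}"

definition sobolev_norm :: "real \<Rightarrow> pdistr \<Rightarrow> real" where
  "sobolev_norm s v = sqrt (2 * pi * (\<Sum>\<^sub>\<infinity>k. sobolev_weight s k * (cmod (fourier_coeff v k))\<^sup>2))"

definition sobolev_continuous_on :: "real \<Rightarrow> real set \<Rightarrow> (real \<Rightarrow> pdistr) \<Rightarrow> bool" where
  "sobolev_continuous_on s X u \<longleftrightarrow>
     (\<forall>t\<in>X. u t \<in> sobolev s \<and> ((\<lambda>t'. sobolev_norm s (u t' - u t)) \<longlongrightarrow> 0) (at t within X))"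


section \<open>Bochner integration in Sobolev spaces\<close>

text \<open>
  The Sobolev spaces are subspaces of one type that depend on a real parameter, so the type-class
  based integral of the library does not apply. The definitions below are those of the library with
  the norm replaced by \<^const>\<open>sobolev_norm\<close>.
\<close>

definition sobolev_simple :: "real \<Rightarrow> 'a measure \<Rightarrow> ('a \<Rightarrow> pdistr) \<Rightarrow> bool" where
  "sobolev_simple s M f \<longleftrightarrow> Bochner_Integration.simple_bochner_integrable M f \<and> (\<forall>x\<in>space M. f x \<in> sobolev s)"

definition sobolev_measurable :: "real \<Rightarrow> 'a measure \<Rightarrow> ('a \<Rightarrow> pdistr) \<Rightarrow> bool" where
  "sobolev_measurable s M f \<longleftrightarrow> (\<forall>x\<in>space M. f x \<in> sobolev s) \<and>
     (\<exists>F. (\<forall>n. sobolev_simple s M (F n)) \<and> (AE x in M. (\<lambda>n. sobolev_norm s (f x - F n x)) \<longlonglongrightarrow> 0))"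

definition has_sobolev_integral :: "real \<Rightarrow> 'a measure \<Rightarrow> ('a \<Rightarrow> pdistr) \<Rightarrow> pdistr \<Rightarrow> bool" where
  "has_sobolev_integral s M f w \<longleftrightarrow> sobolev_measurable s M f \<and> w \<in> sobolev s \<and>
     (\<exists>F. (\<forall>n. sobolev_simple s M (F n)) \<and>
       (\<lambda>n. \<integral>\<^sup>+x. ennreal (sobolev_norm s (f x - F n x)) \<partial>M) \<longlonglongrightarrow> 0 \<and>
       (\<lambda>n. sobolev_norm s (Bochner_Integration.simple_bochner_integral M (F n) - w)) \<longlonglongrightarrow> 0)"

definition L2_sobolev :: "real \<Rightarrow> real \<Rightarrow> (real \<Rightarrow> pdistr) set" where
  "L2_sobolev T s = {h. sobolev_measurable s (lebesgue_on {0..T}) h \<and>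
     integrable (lebesgue_on {0..T}) (\<lambda>t. (sobolev_norm s (h t))\<^sup>2)}"

definition L2_sobolev_norm :: "real \<Rightarrow> real \<Rightarrow> (real \<Rightarrow> pdistr) \<Rightarrow> real" where
  "L2_sobolev_norm T s h = sqrt (LINT t|lebesgue_on {0..T}. (sobolev_norm s (h t))\<^sup>2)"


section \<open>The multiplier, its spectrum and the control operator\<close>

definition fourier_multiplier :: "(pdistr \<Rightarrow> pdistr) \<Rightarrow> (int \<Rightarrow> complex) \<Rightarrow> bool" where
  "fourier_multiplier A m \<longleftrightarrow>
     (\<forall>u v. A (u + v) = A u + A v) \<and> (\<forall>c u. A (cscale c u) = cscale c (A u)) \<and>
     (\<forall>u k. fourier_coeff (A u) k = m k * fourier_coeff u k)"

definition eigval :: "(int \<Rightarrow> real) \<Rightarrow> int \<Rightarrow> real" where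
  "eigval a k = of_int k * a k"

definition eigval_class :: "(int \<Rightarrow> real) \<Rightarrow> int \<Rightarrow> int set" where
  "eigval_class a k\<^sub>1 = {k. eigval a k = eigval a k\<^sub>1}"

definition eigval_mult :: "(int \<Rightarrow> real) \<Rightarrow> int \<Rightarrow> enat" where
  "eigval_mult a k = (if finite (eigval_class a k) then enat (card (eigval_class a k)) else \<infinity>)"

definition spectral_gap :: "(int \<Rightarrow> real) \<Rightarrow> int set \<Rightarrow> ereal" where
  "spectral_gap a K = (INF (k, n)\<in>{(k, n). k \<in> K \<and> n \<in> K \<and> k \<noteq> n}. ereal \<bar>eigval a k - eigval a n\<bar>)"

definition asymptotic_gap :: "(int \<Rightarrow> real) \<Rightarrow> int set \<Rightarrow> ereal" where
  "asymptotic_gap a J = (SUP S\<in>{S. S \<subseteq> J \<and> finite S}. spectral_gap a (J - S))"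

definition propagator :: "(int \<Rightarrow> real) \<Rightarrow> real \<Rightarrow> pdistr \<Rightarrow> pdistr" where
  "propagator a t v =
     (THE w. \<forall>k. fourier_coeff w k = exp (\<i> * of_int k * of_real (a k) * of_real t) * fourier_coeff v k)"

text \<open>A non-empty open arc of the torus, lifted to the line.\<close>

definition periodic_open_interval :: "real set \<Rightarrow> bool" where
  "periodic_open_interval W \<longleftrightarrow>
     (\<exists>\<alpha> \<beta>. \<alpha> < \<beta> \<and> W = (\<Union>n::int. {\<alpha> + 2 * pi * of_int n <..< \<beta> + 2 * pi * of_int n}))"

text \<open>Since \<open>g\<close> is non-negative, being supported in the set where it is positive adds nothing.\<close>

definition control_profile :: "(real \<Rightarrow> real) \<Rightarrow> bool" where
  "control_profile g \<longleftrightarrow> (\<lambda>x. of_real (g x)) \<in> periodic_test \<and> (\<forall>x. 0 \<le> g x) \<and>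
     integral {0..2 * pi} g = 1 \<and> periodic_open_interval {x. 0 < g x}"

text \<open>\<open>\<langle>v, g\<rangle>\<close> pairs \<open>v\<close> with the test function \<open>g\<close>, whereas the factor \<open>g\<close> in front of it is a
  distribution.\<close>

definition control_op :: "(real \<Rightarrow> real) \<Rightarrow> pdistr \<Rightarrow> pdistr" where
  "control_op g v = (let G = (\<lambda>x. complex_of_real (g x)) in
     distr_mult G v - cscale (pairing v G) (distr_of G))"

text \<open>
  Solutions on \<open>[0, T]\<close> of \<open>\<partial>\<^sub>t u = \<partial>\<^sub>x A u + G h\<close>, \<open>u 0 = u0\<close>, where the equation holds in the sense
  of the variation-of-constants formula.
\<close>

definition mild_solution ::
  "(pdistr \<Rightarrow> pdistr) \<Rightarrow> (int \<Rightarrow> real) \<Rightarrow> real \<Rightarrow> (real \<Rightarrow> real) \<Rightarrow> real \<Rightarrow> real \<Rightarrow>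
    pdistr \<Rightarrow> (real \<Rightarrow> pdistr) \<Rightarrow> (real \<Rightarrow> pdistr) \<Rightarrow> bool" where
  "mild_solution A a r g s T u0 h u \<longleftrightarrow>
     sobolev_continuous_on s {0..T} u \<and>
     (\<forall>t\<in>{0<..<T}. distr_deriv (A (u t)) + control_op g (h t) \<in> sobolev (s - r)) \<and>
     u 0 = u0 \<and>
     (\<forall>t\<in>{0..T}. has_sobolev_integral s (lebesgue_on {0..t})
        (\<lambda>t'. propagator a (t - t') (control_op g (h t'))) (u t - propagator a t u0))"

end

theory Submission
  imports Defs
begin

text \<open>
  In the Fourier variable the controllability problem splits into scalar moment problems. A control
  \<open>h t = \<Sum>n. w n * Q n t * exp (\<i> * n * x)\<close> whose temporal profiles \<open>Q n\<close> depend only on the eigenvalue of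
  \<open>n\<close> and form a bounded family biorthogonal to the exponentials \<open>exp (\<i> * \<lambda>\<^sub>k * t)\<close> decouples them into one
  finite linear system per eigenspace.

  The biorthogonal family comes from Ingham's argument: weighted by a half sine wave on an interval of
  length \<open>\<tau> > 2 * pi / gap\<close>, the exponentials have a diagonally dominant Gram matrix, which a Neumann
  series inverts on \<open>l\<^sup>1\<close>, so that no completeness of \<open>L\<^sup>2\<close> is needed. The finitely many frequencies that
  violate the asymptotic gap are removed by combining translates.

  The matrix of an eigenspace is the covariance matrix of the exponentials under the probability
  density \<open>g\<close>. It is injective away from the mode 0, because a trigonometric polynomial that is constant
  on an interval is constant, and it is diagonally dominant for high frequencies.
\<close>

text \<open>\<open>control_op g\<close> couples all modes. Time separates what space mixes: testing
  mode k of the Duhamel integral against its own exponential leaves only the unknowns n with the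
  eigenvalue of k. Hypotheses (b) and (c) make these remainders finite, and systems on {k, -k} with
  finitely many exceptions. Row 0 of the matrix vanishes, since the range of
  \<open>control_op g\<close> has mean zero; the equality of the two means is the resulting
  compatibility condition.

  The profiles must be bounded uniformly in the eigenvalue, because h is then dominated, at all
  times, by a multiple of one sequence w in H^s. Such domination replaces vector-valued analysis:
  continuity in norm, Bochner integrability and the action of \<open>control_op g\<close> reduce to
  scalar series with a summable majorant. It is the l1 bound on the inverse Gram matrix that becomes
  a supremum bound on the profiles. The threshold 2 pi / gap is the window length at which, for
  equally spaced frequencies, the off-diagonal sum equals the diagonal entry.\<close>

no_notation Infinite_Set_Sum.abs_summable_on (infix "abs'_summable'_on" 50)

section \<open>Infinite sums: majorants, termwise integration, a telescoping series\<close>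

lemma summable_on_nonneg_bounded:
  fixes f :: "'a \<Rightarrow> real"
  assumes "\<And>x. x \<in> X \<Longrightarrow> 0 \<le> f x"
    and "\<And>F. finite F \<Longrightarrow> F \<subseteq> X \<Longrightarrow> sum f F \<le> B"
  shows "f summable_on X" and "infsum f X \<le> B"
proof -
  have "bdd_above (sum f ` {F. F \<subseteq> X \<and> finite F})"
    by (rule bdd_aboveI[of _ B]) (use assms(2) in auto)
  then show s: "f summable_on X"
    using assms(1) by (intro nonneg_bdd_above_summable_on) auto
  show "infsum f X \<le> B"
    using s assms(2) by (rule infsum_le_finite_sums) auto
qed

lemma
  fixes f :: "'a \<Rightarrow> 'b \<Rightarrow> 'c::banach"
  assumes "finite A" "\<And>a. a \<in> A \<Longrightarrow> f a summable_on X"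
  shows summable_on_sum: "(\<lambda>x. \<Sum>a\<in>A. f a x) summable_on X"
    and infsum_sum: "(\<Sum>\<^sub>\<infinity>x\<in>X. \<Sum>a\<in>A. f a x) = (\<Sum>a\<in>A. infsum (f a) X)"
proof -
  have "(\<lambda>x. \<Sum>a\<in>A. f a x) summable_on X \<and> (\<Sum>\<^sub>\<infinity>x\<in>X. \<Sum>a\<in>A. f a x) = (\<Sum>a\<in>A. infsum (f a) X)"
    using assms by (induction rule: finite_induct) (simp_all add: summable_on_add infsum_add)
  then show "(\<lambda>x. \<Sum>a\<in>A. f a x) summable_on X" "(\<Sum>\<^sub>\<infinity>x\<in>X. \<Sum>a\<in>A. f a x) = (\<Sum>a\<in>A. infsum (f a) X)"
    by blast+
qed

lemma infsum_nat_eq_suminf: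
  fixes f :: "nat \<Rightarrow> 'a::banach"
  shows "f summable_on UNIV \<Longrightarrow> (\<Sum>\<^sub>\<infinity>n. f n) = (\<Sum>n. f n)"
  using has_sum_imp_sums sums_unique summable_iff_has_sum_infsum by metis

lemma continuous_on_infsum:
  fixes f :: "'i \<Rightarrow> 'a::topological_space \<Rightarrow> 'b::banach"
  assumes "\<And>i. i \<in> X \<Longrightarrow> continuous_on Y (f i)"
    and "\<And>i y. i \<in> X \<Longrightarrow> y \<in> Y \<Longrightarrow> norm (f i y) \<le> M i"
    and "M summable_on X"
  shows "continuous_on Y (\<lambda>y. \<Sum>\<^sub>\<infinity>i\<in>X. f i y)"
proof (rule uniform_limit_theorem)
  show "uniform_limit Y (\<lambda>F y. \<Sum>i\<in>F. f i y) (\<lambda>y. \<Sum>\<^sub>\<infinity>i\<in>X. f i y) (finite_subsets_at_top X)"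
    using assms(2,3) by (rule Weierstrass_m_test_general)
  show "\<forall>\<^sub>F F in finite_subsets_at_top X. continuous_on Y (\<lambda>y. \<Sum>i\<in>F. f i y)"
    by (rule eventually_finite_subsets_at_top_weakI) (use assms(1) in \<open>auto intro!: continuous_intros\<close>)
qed simp

lemma has_sum_integral:
  fixes f :: "'i \<Rightarrow> real \<Rightarrow> complex"
  assumes cont: "\<And>i. i \<in> X \<Longrightarrow> continuous_on {a..b} (f i)"
    and bd: "\<And>i y. i \<in> X \<Longrightarrow> y \<in> {a..b} \<Longrightarrow> norm (f i y) \<le> M i"
    and M: "M summable_on X"
  shows "((\<lambda>i. integral {a..b} (f i)) has_sum integral {a..b} (\<lambda>y. \<Sum>\<^sub>\<infinity>i\<in>X. f i y)) X"
proof -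
  \<comment> \<open>Indices outside \<open>X\<close> get the zero function, because the theorem on
    limits of integrals wants continuous partial sums over every index set, not only over subsets of
    \<open>X\<close>.\<close>
  define f' where "f' i = (if i \<in> X then f i else (\<lambda>_. 0))" for i
  have ul: "uniform_limit {a..b} (\<lambda>F y. \<Sum>i\<in>F. f' i y) (\<lambda>y. \<Sum>\<^sub>\<infinity>i\<in>X. f' i y) (finite_subsets_at_top X)"
    by (rule Weierstrass_m_test_general[OF _ M]) (use bd in \<open>auto simp: f'_def\<close>)
  have c': "continuous_on {a..b} (f' i)" for i
    using cont by (auto simp: f'_def)
  have c: "continuous_on {a..b} (\<lambda>y. \<Sum>i\<in>F. f' i y)" for F
    using c' by (auto intro!: continuous_intros)
  obtain I L where IL: "\<And>F. ((\<lambda>y. \<Sum>i\<in>F. f' i y) has_integral I F) {a..b}"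
    "((\<lambda>y. \<Sum>\<^sub>\<infinity>i\<in>X. f' i y) has_integral L) {a..b}" "(I \<longlongrightarrow> L) (finite_subsets_at_top X)"
    by (rule uniform_limit_integral[OF ul c]) auto
  have "I F = (\<Sum>i\<in>F. integral {a..b} (f' i))" if "finite F" for F
  proof -
    have "((\<lambda>y. \<Sum>i\<in>F. f' i y) has_integral (\<Sum>i\<in>F. integral {a..b} (f' i))) {a..b}"
      using c' by (intro has_integral_sum that integrable_integral integrable_continuous_real)
    with IL(1) show ?thesis by (rule has_integral_unique)
  qed
  then have "((\<lambda>F. \<Sum>i\<in>F. integral {a..b} (f' i)) \<longlongrightarrow> L) (finite_subsets_at_top X)"
    by (intro Lim_transform_eventually[OF IL(3)] eventually_finite_subsets_at_top_weakI) auto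
  then have "((\<lambda>i. integral {a..b} (f' i)) has_sum L) X"
    by (simp add: has_sum_def)
  moreover have "L = integral {a..b} (\<lambda>y. \<Sum>\<^sub>\<infinity>i\<in>X. f' i y)"
    using IL(2) by (rule integral_unique[symmetric])
  moreover have "(\<Sum>\<^sub>\<infinity>i\<in>X. f' i y) = (\<Sum>\<^sub>\<infinity>i\<in>X. f i y)" for y
    by (rule infsum_cong) (simp add: f'_def)
  moreover have "((\<lambda>i. integral {a..b} (f' i)) has_sum L) X \<longleftrightarrow> ((\<lambda>i. integral {a..b} (f i)) has_sum L) X"
    by (rule has_sum_cong) (simp add: f'_def)
  ultimately show ?thesis by simp
qed

text \<open>Each term is half the difference of 1/(2n - 1) and 1/(2n + 1), so the sum over all
  nonzero integers is exactly 1. The terms are the off-diagonal Gram entries of a frequency lattice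
  at the critical window length, relative to the diagonal entry; the value 1 is what places Ingham's
  threshold at 2 pi / \<gamma>.\<close>

lemma sum_inverse_odd_products:
  fixes N :: "int set"
  assumes "finite N" "0 \<notin> N"
  shows "(\<Sum>n\<in>N. 1 / (4 * (real_of_int n)\<^sup>2 - 1)) \<le> 1"
proof -
  have pos: "0 \<le> 1 / (4 * (real_of_int n)\<^sup>2 - 1)" if "n \<noteq> 0" for n
  proof -
    have "1 \<le> n\<^sup>2" using that by (simp add: int_one_le_iff_zero_less)
    then have "1 \<le> (real_of_int n)\<^sup>2" by (metis of_int_1 of_int_le_iff of_int_power)
    then show ?thesis by simp
  qed
  obtain K where K: "N \<subseteq> {- int K..int K}"
  proof
    show "N \<subseteq> {- int (Max (insert 0 (nat ` abs ` N)))..int (Max (insert 0 (nat ` abs ` N)))}"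
    proof
      fix n assume "n \<in> N"
      then have "nat \<bar>n\<bar> \<le> Max (insert 0 (nat ` abs ` N))"
        using assms by (intro Max_ge) auto
      then show "n \<in> {- int (Max (insert 0 (nat ` abs ` N)))..int (Max (insert 0 (nat ` abs ` N)))}"
        by auto
    qed
  qed
  have step: "{- int (Suc K)..int (Suc K)} - {0} = insert (int K + 1) (insert (- (int K + 1)) ({- int K..int K} - {0}))" for K
    by auto
  have "(\<Sum>n\<in>{- int K..int K} - {0}. 1 / (4 * (real_of_int n)\<^sup>2 - 1)) = 1 - 1 / (2 * real K + 1)"
  proof (induction K)
    case (Suc K)
    have e: "4 * (real K + 1)\<^sup>2 - 1 = (2 * real K + 1) * (2 * real K + 3)"
      by (simp add: power2_eq_square algebra_simps)
    have "(\<Sum>n\<in>{- int (Suc K)..int (Suc K)} - {0}. 1 / (4 * (real_of_int n)\<^sup>2 - 1)) =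
      2 / (4 * (real K + 1)\<^sup>2 - 1) + (1 - 1 / (2 * real K + 1))"
      unfolding step by (simp add: Suc.IH) (simp add: power2_eq_square algebra_simps)
    also have "\<dots> = 1 - 1 / (2 * real (Suc K) + 1)"
      unfolding e by (simp add: divide_simps) (simp add: algebra_simps)
    finally show ?case .
  qed simp
  moreover have "(\<Sum>n\<in>N. 1 / (4 * (real_of_int n)\<^sup>2 - 1)) \<le> (\<Sum>n\<in>{- int K..int K} - {0}. 1 / (4 * (real_of_int n)\<^sup>2 - 1))"
    using K assms pos by (intro sum_mono2) auto
  moreover have "0 \<le> 1 / (2 * real K + 1)" by simp
  ultimately show ?thesis by linarith
qed

section \<open>Fourier series of periodic test functions\<close>

lemma summable_inverse_int_square: "(\<lambda>k. 1 / (1 + \<bar>real_of_int k\<bar>)\<^sup>2) summable_on UNIV"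
proof (rule summable_on_nonneg_bounded(1))
  fix F :: "int set" assume F: "finite F"
  have le: "1 / (1 + \<bar>real_of_int k\<bar>)\<^sup>2 \<le> 4 * (1 / (4 * (real_of_int k)\<^sup>2 - 1))" if "k \<noteq> 0" for k
  proof -
    have "1 \<le> k\<^sup>2" using that by (simp add: int_one_le_iff_zero_less)
    then have 1: "1 \<le> (real_of_int k)\<^sup>2" by (metis of_int_1 of_int_le_iff of_int_power)
    have "4 * (real_of_int k)\<^sup>2 - 1 \<le> 4 * (1 + \<bar>real_of_int k\<bar>)\<^sup>2"
      by (simp add: power2_sum)
    then have "4 / (4 * (1 + \<bar>real_of_int k\<bar>)\<^sup>2) \<le> 4 / (4 * (real_of_int k)\<^sup>2 - 1)"
      using 1 by (intro divide_left_mono) (auto intro!: mult_pos_pos)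
    then show ?thesis by simp
  qed
  have "(\<Sum>k\<in>F. 1 / (1 + \<bar>real_of_int k\<bar>)\<^sup>2) \<le> (\<Sum>k\<in>insert 0 (F - {0}). 1 / (1 + \<bar>real_of_int k\<bar>)\<^sup>2)"
    using F by (intro sum_mono2) auto
  also have "\<dots> = 1 + (\<Sum>k\<in>F - {0}. 1 / (1 + \<bar>real_of_int k\<bar>)\<^sup>2)"
    using F by (subst sum.insert) auto
  also have "(\<Sum>k\<in>F - {0}. 1 / (1 + \<bar>real_of_int k\<bar>)\<^sup>2) \<le> (\<Sum>k\<in>F - {0}. 4 * (1 / (4 * (real_of_int k)\<^sup>2 - 1)))"
    by (intro sum_mono le) auto
  also have "\<dots> \<le> 4 * 1"
    unfolding sum_distrib_left[symmetric] using F by (intro mult_left_mono sum_inverse_odd_products) auto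
  finally show "(\<Sum>k\<in>F. 1 / (1 + \<bar>real_of_int k\<bar>)\<^sup>2) \<le> 5" by simp
qed simp

lemma norm_cexpi [simp]: "cmod (cexpi k x) = 1"
  by (simp add: cexpi_def norm_exp_eq_Re)

lemma cexpi_0 [simp]: "cexpi 0 x = 1"
  by (simp add: cexpi_def)

lemma cexpi_at_0 [simp]: "cexpi k 0 = 1"
  by (simp add: cexpi_def)

lemma cexpi_add: "cexpi (k + l) x = cexpi k x * cexpi l x"
  by (simp add: cexpi_def algebra_simps exp_add)

lemma cexpi_mult: "cexpi k x * cexpi l x = cexpi (k + l) x"
  by (simp add: cexpi_add)

lemma cexpi_diff_arg: "cexpi k (x - y) = cexpi k x * cexpi (- k) y"
  by (simp add: cexpi_def algebra_simps flip: exp_add)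

lemma cnj_cexpi: "cnj (cexpi k x) = cexpi (- k) x"
  by (simp add: cexpi_def exp_cnj)

lemma continuous_on_cexpi [continuous_intros]: "continuous_on X (cexpi k)"
  by (rule periodic_test_continuous[OF periodic_test_cexpi])

lemma cexpi_has_vector_derivative: "(cexpi k has_vector_derivative (\<i> * of_int k) * cexpi k x) (at x within X)"
  using differentiable_vderiv[OF cexpi_differentiable, of k x]
  by (simp add: cexpi_deriv has_vector_derivative_at_within)

lemma periodic_test_periodic: "\<phi> \<in> periodic_test \<Longrightarrow> \<phi> (x + 2 * pi) = \<phi> x"
  by (simp add: periodic_test_def)

lemma periodic_test_funpow: "\<phi> \<in> periodic_test \<Longrightarrow> (vderiv ^^ j) \<phi> \<in> periodic_test"
  by (induction j) (auto intro: periodic_test_vderiv)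

lemma periodic_test_cmult: "\<phi> \<in> periodic_test \<Longrightarrow> (\<lambda>x. c * \<phi> x) \<in> periodic_test"
  by (rule periodic_test_mult[OF periodic_test_const])

lemma periodic_test_diff: "\<phi> \<in> periodic_test \<Longrightarrow> \<psi> \<in> periodic_test \<Longrightarrow> (\<lambda>x. \<phi> x - \<psi> x) \<in> periodic_test"
  using periodic_test_add[of \<phi> "\<lambda>x. (-1) * \<psi> x"] periodic_test_cmult[of \<psi> "-1"] by simp

lemma periodic_test_sum:
  "(\<And>i. i \<in> I \<Longrightarrow> \<phi> i \<in> periodic_test) \<Longrightarrow> (\<lambda>x. \<Sum>i\<in>I. \<phi> i x) \<in> periodic_test"
  by (induction I rule: infinite_finite_induct) (auto intro: periodic_test_const periodic_test_add)

text \<open>\<open>fcoef \<phi> k\<close> is the \<open>(-k)\<close>-th Fourier coefficient of \<open>\<phi>\<close> times \<open>2 * pi\<close>.\<close>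

definition fcoef :: "(real \<Rightarrow> complex) \<Rightarrow> int \<Rightarrow> complex" where
  "fcoef \<phi> k = integral {0..2 * pi} (\<lambda>x. \<phi> x * cexpi k x)"

lemma integral_cexpi: "integral {0..2 * pi} (cexpi k) = (if k = 0 then 2 * pi else 0)"
proof (cases "k = 0")
  case True
  then have "cexpi k = (\<lambda>_. 1)" by auto
  then show ?thesis using True by (simp add: scaleR_conv_of_real)
next
  case False
  have "((\<lambda>x. (\<i> * of_int k) * cexpi k x) has_integral cexpi k (2 * pi) - cexpi k 0) {0..2 * pi}"
    by (intro fundamental_theorem_of_calculus cexpi_has_vector_derivative) simp
  moreover have "cexpi k (2 * pi) = 1"
    using periodic_test_periodic[OF periodic_test_cexpi, of k 0] by simp
  ultimately have "integral {0..2 * pi} (\<lambda>x. (\<i> * of_int k) * cexpi k x) = 1 - 1"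
    by (simp only: integral_unique cexpi_at_0)
  with False show ?thesis by simp
qed

lemma fcoef_cexpi: "fcoef (cexpi n) k = (if k = - n then 2 * pi else 0)"
proof -
  have "fcoef (cexpi n) k = integral {0..2 * pi} (cexpi (n + k))"
    unfolding fcoef_def cexpi_mult ..
  moreover have "n + k = 0 \<longleftrightarrow> k = - n" by linarith
  ultimately show ?thesis by (simp only: integral_cexpi)
qed

lemma fcoef_vderiv:
  assumes "\<phi> \<in> periodic_test"
  shows "fcoef (vderiv \<phi>) k = - (\<i> * of_int k) * fcoef \<phi> k"
proof -
  let ?p = "\<lambda>x. \<phi> x * cexpi k x"
  have "(?p has_vector_derivative \<phi> x * ((\<i> * of_int k) * cexpi k x) + vderiv \<phi> x * cexpi k x) (at x within {0..2 * pi})" for x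
    using differentiable_vderiv[OF periodic_test_differentiable[OF assms], of x]
    by (intro has_vector_derivative_mult cexpi_has_vector_derivative) (rule has_vector_derivative_at_within)
  then have "((\<lambda>x. \<phi> x * ((\<i> * of_int k) * cexpi k x) + vderiv \<phi> x * cexpi k x) has_integral ?p (2 * pi) - ?p 0) {0..2 * pi}"
    by (intro fundamental_theorem_of_calculus) auto
  moreover have "?p (2 * pi) = ?p 0"
    using periodic_test_periodic[OF assms, of 0] periodic_test_periodic[OF periodic_test_cexpi, of k 0] by simp
  ultimately have "integral {0..2 * pi} (\<lambda>x. (\<i> * of_int k) * (\<phi> x * cexpi k x) + vderiv \<phi> x * cexpi k x) = 0"
    by (simp add: integral_unique mult_ac)
  moreover have "integral {0..2 * pi} (\<lambda>x. (\<i> * of_int k) * (\<phi> x * cexpi k x) + vderiv \<phi> x * cexpi k x)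
      = (\<i> * of_int k) * fcoef \<phi> k + fcoef (vderiv \<phi>) k"
  proof -
    have c: "continuous_on {0..2 * pi} \<phi>" "continuous_on {0..2 * pi} (vderiv \<phi>)"
      using assms by (intro periodic_test_continuous periodic_test_vderiv; simp)+
    show ?thesis
      unfolding fcoef_def by (subst integral_add) (auto intro!: integrable_continuous_real continuous_intros c)
  qed
  ultimately show ?thesis
    by (simp only: eq_neg_iff_add_eq_0 mult_minus_left add.commute)
qed

lemma fcoef_funpow:
  "\<phi> \<in> periodic_test \<Longrightarrow> fcoef ((vderiv ^^ j) \<phi>) k = (- (\<i> * of_int k)) ^ j * fcoef \<phi> k"
  by (induction j) (simp_all add: fcoef_vderiv periodic_test_funpow)

lemma fcoef_bound:
  assumes "continuous_on {0..2 * pi} \<phi>" "\<And>x. cmod (\<phi> x) \<le> B"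
  shows "cmod (fcoef \<phi> k) \<le> 2 * pi * B"
proof -
  have "cmod (fcoef \<phi> k) \<le> B * (2 * pi - 0)"
    unfolding fcoef_def using assms
    by (intro integral_bound) (auto simp: norm_mult intro!: continuous_intros)
  then show ?thesis by (simp add: mult.commute)
qed

lemma power_one_plus_le:
  fixes x :: real assumes "0 \<le> x" shows "(1 + x) ^ N \<le> 2 ^ N * (1 + x ^ N)"
proof -
  have "1 + x \<le> 2 * max 1 x" by simp
  then have "(1 + x) ^ N \<le> (2 * max 1 x) ^ N"
    using assms by (intro power_mono) auto
  also have "\<dots> = 2 ^ N * (max 1 x) ^ N" by (simp add: power_mult_distrib)
  also have "(max 1 x) ^ N \<le> 1 + x ^ N"
    using assms by (auto simp: max_def)
  finally show ?thesis by simp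
qed

text \<open>\<open>N\<close> integrations by parts. The constant is explicit and linear in the
  common bound of \<phi> and its \<open>N\<close>-th derivative, because the continuity of the
  distributions constructed in \<open>tempered_coeff_realised\<close> is read off from it.\<close>

lemma fcoef_decay:
  assumes "\<phi> \<in> periodic_test" "\<And>x. cmod (\<phi> x) \<le> B" "\<And>x. cmod ((vderiv ^^ N) \<phi> x) \<le> B"
  shows "cmod (fcoef \<phi> k) * (1 + \<bar>real_of_int k\<bar>) ^ N \<le> 2 ^ N * 4 * pi * B"
proof -
  have "cmod (fcoef \<phi> k) \<le> 2 * pi * B"
    using assms by (intro fcoef_bound periodic_test_continuous)
  moreover have "\<bar>real_of_int k\<bar> ^ N * cmod (fcoef \<phi> k) \<le> 2 * pi * B"
  proof -
    have "cmod (fcoef ((vderiv ^^ N) \<phi>) k) \<le> 2 * pi * B"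
      using assms by (intro fcoef_bound periodic_test_continuous periodic_test_funpow)
    then show ?thesis
      using assms(1) by (simp add: fcoef_funpow norm_mult norm_power)
  qed
  ultimately have "(1 + \<bar>real_of_int k\<bar> ^ N) * cmod (fcoef \<phi> k) \<le> 4 * pi * B"
    by (simp add: algebra_simps)
  have "cmod (fcoef \<phi> k) * (1 + \<bar>real_of_int k\<bar>) ^ N \<le> cmod (fcoef \<phi> k) * (2 ^ N * (1 + \<bar>real_of_int k\<bar> ^ N))"
    by (intro mult_left_mono power_one_plus_le) auto
  also have "\<dots> = 2 ^ N * ((1 + \<bar>real_of_int k\<bar> ^ N) * cmod (fcoef \<phi> k))"
    by (simp add: mult_ac)
  also have "\<dots> \<le> 2 ^ N * (4 * pi * B)"
    using \<open>(1 + \<bar>real_of_int k\<bar> ^ N) * cmod (fcoef \<phi> k) \<le> 4 * pi * B\<close> by (intro mult_left_mono) auto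
  finally show ?thesis by (simp add: mult.assoc)
qed

lemma fcoef_decay_ex:
  assumes "\<phi> \<in> periodic_test"
  obtains C where "0 \<le> C" "\<And>k. cmod (fcoef \<phi> k) * (1 + \<bar>real_of_int k\<bar>) ^ N \<le> C"
proof -
  obtain B1 where B1: "\<And>x. cmod (\<phi> x) \<le> B1"
    using periodic_test_bounded[OF assms] by (auto simp: bounded_iff)
  obtain B2 where B2: "\<And>x. cmod ((vderiv ^^ N) \<phi> x) \<le> B2"
    using periodic_test_bounded[OF periodic_test_funpow[OF assms]] by (auto simp: bounded_iff)
  have B: "cmod (\<phi> x) \<le> max B1 B2" "cmod ((vderiv ^^ N) \<phi> x) \<le> max B1 B2" for x
    using B1[of x] B2[of x] by auto
  have le: "cmod (fcoef \<phi> k) * (1 + \<bar>real_of_int k\<bar>) ^ N \<le> 2 ^ N * 4 * pi * max B1 B2" for k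
    using assms B by (rule fcoef_decay)
  show thesis
  proof
    show "0 \<le> 2 ^ N * 4 * pi * max B1 B2"
      using order_trans[OF norm_ge_zero B(1)[of 0]] by simp
  qed (rule le)
qed

lemma integral_complex_of_real_continuous:
  fixes f :: "real \<Rightarrow> real"
  assumes "continuous_on {a..b} f"
  shows "integral {a..b} (\<lambda>x. complex_of_real (f x)) = of_real (integral {a..b} f)"
  using assms by (intro integral_unique has_integral_of_real integrable_integral integrable_continuous_real)

text \<open>The polynomial \<open>p\<close> is the orthogonal projection of \<open>h\<close>, so the
  energy of \<open>h - p\<close> is that of \<open>h\<close> minus the scaled coefficient sum, and
  it is non-negative. The modes \<open>cexpi (- k)\<close> appear in \<open>p\<close> because
  \<open>fcoef\<close> pairs with exp(ikx) without conjugation.\<close>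

lemma bessel_inequality:
  assumes h: "continuous_on {0..2 * pi} h" and "finite F"
  shows "(\<Sum>k\<in>F. (cmod (fcoef h k))\<^sup>2) \<le> 2 * pi * integral {0..2 * pi} (\<lambda>x. (cmod (h x))\<^sup>2)"
proof -
  define c where "c k = fcoef h k / (2 * pi)" for k
  define p where "p x = (\<Sum>k\<in>F. c k * cexpi (- k) x)" for x
  have p: "continuous_on X p" for X
    unfolding p_def by (intro continuous_intros)
  note int = integrable_continuous_real continuous_intros h p
  have ck: "2 * pi * c k = fcoef h k" for k by (simp add: c_def)
  have orth: "integral {0..2 * pi} (\<lambda>x. (h x - p x) * cexpi k x) = 0" if "k \<in> F" for k
  proof -
    have "p x * cexpi k x = (\<Sum>l\<in>F. c l * cexpi (k - l) x)" for x
      unfolding p_def sum_distrib_right by (rule sum.cong) (simp_all add: mult.assoc cexpi_mult)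
    then have "integral {0..2 * pi} (\<lambda>x. p x * cexpi k x) = integral {0..2 * pi} (\<lambda>x. \<Sum>l\<in>F. c l * cexpi (k - l) x)"
      by simp
    also have "\<dots> = (\<Sum>l\<in>F. c l * (if k = l then 2 * pi else 0))"
      using assms(2) by (subst integral_sum) (auto intro!: int simp: integral_cexpi cong: if_cong)
    also have "\<dots> = fcoef h k"
      using that assms(2) ck[of k] by (simp add: if_distrib mult.commute cong: if_cong)
    finally have "integral {0..2 * pi} (\<lambda>x. p x * cexpi k x) = fcoef h k" .
    then show ?thesis
      unfolding left_diff_distrib by (subst integral_diff) (auto intro!: int simp: fcoef_def)
  qed
  have orth': "integral {0..2 * pi} (\<lambda>x. (h x - p x) * cnj (p x)) = 0"
  proof -
    have "integral {0..2 * pi} (\<lambda>x. (h x - p x) * cnj (p x)) =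
        integral {0..2 * pi} (\<lambda>x. \<Sum>k\<in>F. cnj (c k) * ((h x - p x) * cexpi k x))"
      by (simp add: p_def[of _, THEN arg_cong[of _ _ cnj]] cnj_cexpi sum_distrib_left mult.left_commute)
    also have "\<dots> = (\<Sum>k\<in>F. cnj (c k) * integral {0..2 * pi} (\<lambda>x. (h x - p x) * cexpi k x))"
      using assms(2) by (subst integral_sum) (auto intro!: int)
    also have "\<dots> = 0" using orth by simp
    finally show ?thesis .
  qed
  have hc: "integral {0..2 * pi} (\<lambda>x. cexpi (- k) x * cnj (h x)) = cnj (fcoef h k)" for k
    unfolding fcoef_def Henstock_Kurzweil_Integration.integral_cnj by (simp add: cnj_cexpi mult.commute)
  have ph: "integral {0..2 * pi} (\<lambda>x. p x * cnj (h x)) = (\<Sum>k\<in>F. c k * cnj (fcoef h k))"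
    unfolding p_def sum_distrib_right mult.assoc
    using assms(2) by (subst integral_sum) (auto intro!: int simp: hc)
  have "complex_of_real (integral {0..2 * pi} (\<lambda>x. (cmod (h x - p x))\<^sup>2)) = integral {0..2 * pi} (\<lambda>x. of_real ((cmod (h x - p x))\<^sup>2))"
    by (intro integral_complex_of_real_continuous[symmetric] continuous_intros h p)
  also have "\<dots> = integral {0..2 * pi} (\<lambda>x. (h x - p x) * cnj (h x) - (h x - p x) * cnj (p x))"
    by (simp only: complex_norm_square complex_cnj_diff right_diff_distrib)
  also have "\<dots> = integral {0..2 * pi} (\<lambda>x. (h x - p x) * cnj (h x))"
    by (subst integral_diff) (auto intro!: int simp: orth')
  also have "\<dots> = integral {0..2 * pi} (\<lambda>x. h x * cnj (h x)) - (\<Sum>k\<in>F. c k * cnj (fcoef h k))"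
    unfolding left_diff_distrib ph[symmetric] by (rule integral_diff) (auto intro!: int)
  also have "integral {0..2 * pi} (\<lambda>x. h x * cnj (h x)) = integral {0..2 * pi} (\<lambda>x. of_real ((cmod (h x))\<^sup>2))"
    by (simp only: complex_norm_square)
  also have "\<dots> = complex_of_real (integral {0..2 * pi} (\<lambda>x. (cmod (h x))\<^sup>2))"
    by (intro integral_complex_of_real_continuous continuous_intros h)
  also have "(\<Sum>k\<in>F. c k * cnj (fcoef h k)) = complex_of_real ((\<Sum>k\<in>F. (cmod (fcoef h k))\<^sup>2) / (2 * pi))"
    by (simp add: c_def sum_divide_distrib complex_norm_square del: of_real_power)
  finally have "integral {0..2 * pi} (\<lambda>x. (cmod (h x - p x))\<^sup>2) =
      integral {0..2 * pi} (\<lambda>x. (cmod (h x))\<^sup>2) - (\<Sum>k\<in>F. (cmod (fcoef h k))\<^sup>2) / (2 * pi)"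
    unfolding of_real_diff[symmetric] of_real_eq_iff .
  moreover have "0 \<le> integral {0..2 * pi} (\<lambda>x. (cmod (h x - p x))\<^sup>2)"
    by (intro integral_nonneg) (auto intro!: int)
  ultimately have "(\<Sum>k\<in>F. (cmod (fcoef h k))\<^sup>2) / (2 * pi) \<le> integral {0..2 * pi} (\<lambda>x. (cmod (h x))\<^sup>2)"
    by linarith
  then show ?thesis by (simp add: pos_divide_le_eq mult.commute)
qed

text \<open>Bessel's inequality makes the squared coefficients summable along any injective sequence
  of indices. The sequence is left free because both ends of a telescoped symmetric sum have to
  vanish.\<close>

lemma riemann_lebesgue:
  assumes h: "continuous_on {0..2 * pi} h" and inj: "inj \<kappa>"
  shows "(\<lambda>n::nat. fcoef h (\<kappa> n)) \<longlonglongrightarrow> 0"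
proof -
  have "summable (\<lambda>n. (cmod (fcoef h (\<kappa> n)))\<^sup>2)"
  proof (rule summableI_nonneg_bounded)
    fix n
    have "(\<Sum>i<n. (cmod (fcoef h (\<kappa> i)))\<^sup>2) = (\<Sum>k\<in>\<kappa> ` {..<n}. (cmod (fcoef h k))\<^sup>2)"
      using inj by (subst sum.reindex) (auto intro: inj_on_subset)
    also have "\<dots> \<le> 2 * pi * integral {0..2 * pi} (\<lambda>x. (cmod (h x))\<^sup>2)"
      using h by (rule bessel_inequality) simp
    finally show "(\<Sum>i<n. (cmod (fcoef h (\<kappa> i)))\<^sup>2) \<le> 2 * pi * integral {0..2 * pi} (\<lambda>x. (cmod (h x))\<^sup>2)" .
  qed simp
  then have "(\<lambda>n. (cmod (fcoef h (\<kappa> n)))\<^sup>2) \<longlonglongrightarrow> 0"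
    by (rule summable_LIMSEQ_zero)
  then have "(\<lambda>n. sqrt ((cmod (fcoef h (\<kappa> n)))\<^sup>2)) \<longlonglongrightarrow> sqrt 0"
    by (rule tendsto_real_sqrt)
  then show ?thesis by (simp add: tendsto_norm_zero_iff)
qed

lemma tendsto_difference_quotient:
  fixes f :: "real \<Rightarrow> complex"
  assumes "(f has_vector_derivative d) (at x)"
  shows "((\<lambda>y. (f y - f x) / of_real (y - x)) \<longlongrightarrow> d) (at x)"
proof -
  have "((\<lambda>y. cmod ((f y - f x) - (y - x) *\<^sub>R d) / norm (y - x)) \<longlongrightarrow> 0) (at x)"
    using assms unfolding has_vector_derivative_def has_derivative_iff_norm by simp
  moreover have "\<forall>\<^sub>F y in at x. cmod ((f y - f x) - (y - x) *\<^sub>R d) / norm (y - x) = cmod ((f y - f x) / of_real (y - x) - d)"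
  proof (rule eventually_at_ball'[of 1, THEN eventually_mono])
    fix y assume "y \<in> ball x 1 \<and> y \<noteq> x \<and> y \<in> UNIV"
    then have "(f y - f x) / of_real (y - x) - d = ((f y - f x) - (y - x) *\<^sub>R d) / of_real (y - x)"
      by (simp add: scaleR_conv_of_real diff_divide_distrib)
    then show "cmod ((f y - f x) - (y - x) *\<^sub>R d) / norm (y - x) = cmod ((f y - f x) / of_real (y - x) - d)"
      by (simp add: norm_divide flip: of_real_diff)
  qed simp
  ultimately have "((\<lambda>y. cmod ((f y - f x) / of_real (y - x) - d)) \<longlongrightarrow> 0) (at x)"
    by (rule Lim_transform_eventually)
  then show ?thesis
    by (simp add: tendsto_norm_zero_iff LIM_zero_iff)
qed

lemma cexpi_1_eq_1_iff: "cexpi 1 x = 1 \<longleftrightarrow> (\<exists>m::int. x = of_int m * (2 * pi))"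
proof
  assume "cexpi 1 x = 1"
  then have "exp (\<i> * of_real x) = 1" by (simp add: cexpi_def)
  then obtain m :: int where "Im (\<i> * of_real x) = of_int (2 * m) * pi"
    by (auto simp: exp_eq_1)
  then show "\<exists>m::int. x = of_int m * (2 * pi)" by (intro exI[of _ m]) simp
next
  assume "\<exists>m::int. x = of_int m * (2 * pi)"
  then obtain m :: int where "x = of_int m * (2 * pi)" by blast
  then show "cexpi 1 x = 1" by (auto simp: cexpi_def exp_eq_1)
qed

lemma periodic_test_shift_int:
  assumes "\<phi> \<in> periodic_test" shows "\<phi> (x + of_int m * (2 * pi)) = \<phi> x"
proof -
  interpret periodic_fun_simple \<phi> "2 * pi"
    by unfold_locales (use assms in \<open>auto simp: periodic_test_def\<close>)
  show ?thesis by (rule plus_of_int)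
qed

text \<open>Chernoff's argument: dividing \<open>\<phi> - \<phi> x\<^sub>0\<close> by \<open>exp (\<i> * (x - x\<^sub>0)) - 1\<close> leaves a continuous
  function, in whose Fourier coefficients the partial sums telescope.\<close>

lemma fourier_series_pointwise:
  fixes \<phi> :: "real \<Rightarrow> complex"
  assumes \<phi>: "\<phi> \<in> periodic_test"
  shows "(\<lambda>n. \<Sum>k\<in>{- int n..int n}. fcoef \<phi> (- k) * cexpi k x\<^sub>0) \<longlonglongrightarrow> 2 * pi * \<phi> x\<^sub>0"
proof -
  define E where "E x = cexpi 1 (x - x\<^sub>0)" for x
  \<comment> \<open>Where \<open>E x = 1\<close> the value is the limit of the quotient, the ratio
    of the derivatives of \<phi> and of \<open>E\<close>, the latter being \<i> there.\<close>
  define h where "h x = (if E x = 1 then vderiv \<phi> x / \<i> else (\<phi> x - \<phi> x\<^sub>0) / (E x - 1))" for x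
  have E_cont: "continuous_on X E" for X
    unfolding E_def by (rule continuous_on_compose2[OF continuous_on_cexpi[of UNIV]]) (auto intro!: continuous_intros)
  have E_deriv: "(E has_vector_derivative \<i> * E x) (at x)" for x
    unfolding E_def cexpi_diff_arg
    using has_vector_derivative_mult_left[OF cexpi_has_vector_derivative[of 1 x UNIV], of "cexpi (- 1) x\<^sub>0"] by (simp add: mult.assoc)
  have special: "\<phi> x = \<phi> x\<^sub>0" if E: "E x = 1" for x
  proof -
    obtain m :: int where "x - x\<^sub>0 = of_int m * (2 * pi)"
      using E unfolding E_def cexpi_1_eq_1_iff by blast
    then have "x = x\<^sub>0 + of_int m * (2 * pi)" by simp
    then show ?thesis using periodic_test_shift_int[OF \<phi>, of x\<^sub>0 m] by simp
  qed
  have h_eq: "\<phi> x - \<phi> x\<^sub>0 = (E x - 1) * h x" for x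
    using special[of x] by (simp add: h_def)
  have h_isCont: "isCont h y" for y
  proof (cases "E y = 1")
    case True
    have 1: "((\<lambda>x. (\<phi> x - \<phi> y) / of_real (x - y)) \<longlongrightarrow> vderiv \<phi> y) (at y)"
      by (intro tendsto_difference_quotient differentiable_vderiv periodic_test_differentiable \<phi>)
    have 2: "((\<lambda>x. (E x - E y) / of_real (x - y)) \<longlongrightarrow> \<i>) (at y)"
      using tendsto_difference_quotient[OF E_deriv, of y] True by simp
    have "((\<lambda>x. ((\<phi> x - \<phi> y) / of_real (x - y)) / ((E x - E y) / of_real (x - y))) \<longlongrightarrow> vderiv \<phi> y / \<i>) (at y)"
      using 1 2 by (rule tendsto_divide) simp
    moreover have "\<forall>\<^sub>F x in at y. ((\<phi> x - \<phi> y) / of_real (x - y)) / ((E x - E y) / of_real (x - y)) = h x"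
    proof (rule eventually_at_ball'[of "2 * pi", THEN eventually_mono])
      fix x assume x: "x \<in> ball y (2 * pi) \<and> x \<noteq> y \<and> x \<in> UNIV"
      have "E x \<noteq> 1"
      proof
        assume "E x = 1"
        then obtain m :: int where m: "x - x\<^sub>0 = of_int m * (2 * pi)"
          unfolding E_def cexpi_1_eq_1_iff by blast
        obtain m' :: int where m': "y - x\<^sub>0 = of_int m' * (2 * pi)"
          using True unfolding E_def cexpi_1_eq_1_iff by blast
        have d: "x - y = of_int (m - m') * (2 * pi)" using m m' by (simp add: algebra_simps)
        with x have "m - m' \<noteq> 0" by auto
        then have "1 \<le> \<bar>real_of_int (m - m')\<bar>" by linarith
        then have "1 * (2 * pi) \<le> \<bar>real_of_int (m - m')\<bar> * (2 * pi)" by (rule mult_right_mono) simp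
        also have "\<dots> = \<bar>x - y\<bar>" unfolding d by (simp add: abs_mult)
        finally show False using x by (simp add: dist_real_def abs_minus_commute)
      qed
      then show "((\<phi> x - \<phi> y) / of_real (x - y)) / ((E x - E y) / of_real (x - y)) = h x"
        using x True special[OF True] by (simp add: h_def flip: of_real_diff)
    qed simp
    ultimately have "(h \<longlongrightarrow> vderiv \<phi> y / \<i>) (at y)"
      by (rule Lim_transform_eventually)
    then show ?thesis using True by (simp add: isCont_def h_def)
  next
    case False
    have "open {x. E x \<noteq> 1}"
      using open_Collect_neq[OF E_cont, of "\<lambda>_. 1"] by simp
    moreover have "continuous_on {x. E x \<noteq> 1} h"
    proof (rule continuous_on_eq)
      show "continuous_on {x. E x \<noteq> 1} (\<lambda>x. (\<phi> x - \<phi> x\<^sub>0) / (E x - 1))"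
        by (intro continuous_intros E_cont periodic_test_continuous \<phi>) auto
    qed (simp add: h_def)
    ultimately show ?thesis using False by (simp add: continuous_on_eq_continuous_at)
  qed
  then have h: "continuous_on X h" for X
    by (simp add: continuous_at_imp_continuous_on)
  define H where "H k = cexpi k x\<^sub>0 * fcoef h (- k)" for k
  note int = integrable_continuous_real continuous_intros h periodic_test_continuous[OF \<phi>]
  \<comment> \<open>Multiplication by \<open>E - 1\<close> shifts the coefficients of
    \<open>h\<close> by one index, so each coefficient of \<phi> - \<phi>(x0), rotated by
    \<open>cexpi k x\<^sub>0\<close>, is a difference of consecutive values of
    \<open>H\<close>.\<close>
  have tele: "fcoef \<phi> (- k) * cexpi k x\<^sub>0 - \<phi> x\<^sub>0 * (if k = 0 then 2 * pi else 0) = H (k - 1) - H k" for k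
  proof -
    have "cexpi k x\<^sub>0 * integral {0..2 * pi} (\<lambda>x. (\<phi> x - \<phi> x\<^sub>0) * cexpi (- k) x) =
        cexpi k x\<^sub>0 * integral {0..2 * pi} (\<lambda>x. \<phi> x * cexpi (- k) x - \<phi> x\<^sub>0 * cexpi (- k) x)"
      by (simp add: left_diff_distrib)
    also have "\<dots> = cexpi k x\<^sub>0 * (fcoef \<phi> (- k) - \<phi> x\<^sub>0 * integral {0..2 * pi} (cexpi (- k)))"
      by (subst integral_diff) (auto intro!: int simp: fcoef_def)
    also have "\<dots> = fcoef \<phi> (- k) * cexpi k x\<^sub>0 - \<phi> x\<^sub>0 * (if k = 0 then 2 * pi else 0)"
      by (simp only: integral_cexpi neg_equal_0_iff_equal) (simp add: algebra_simps)
    finally have 1: "cexpi k x\<^sub>0 * integral {0..2 * pi} (\<lambda>x. (\<phi> x - \<phi> x\<^sub>0) * cexpi (- k) x) =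
       fcoef \<phi> (- k) * cexpi k x\<^sub>0 - \<phi> x\<^sub>0 * (if k = 0 then 2 * pi else 0)" .
    have "(\<phi> x - \<phi> x\<^sub>0) * cexpi (- k) x = cexpi (- 1) x\<^sub>0 * (h x * cexpi (1 - k) x) - h x * cexpi (- k) x" for x
      unfolding h_eq E_def cexpi_diff_arg using cexpi_mult[of 1 x "- k"] by (simp add: algebra_simps)
    then have "integral {0..2 * pi} (\<lambda>x. (\<phi> x - \<phi> x\<^sub>0) * cexpi (- k) x) = cexpi (- 1) x\<^sub>0 * fcoef h (1 - k) - fcoef h (- k)"
      by simp (subst integral_diff, auto intro!: int simp: fcoef_def)
    then have "cexpi k x\<^sub>0 * integral {0..2 * pi} (\<lambda>x. (\<phi> x - \<phi> x\<^sub>0) * cexpi (- k) x) = H (k - 1) - H k"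
      using cexpi_mult[of k x\<^sub>0 "- 1"] by (simp add: H_def right_diff_distrib flip: mult.assoc)
    with 1 show ?thesis by simp
  qed
  have tsum: "(\<Sum>k\<in>{- int n..int n}. H (k - 1) - H k) = H (- int n - 1) - H (int n)" for n
  proof (induction n)
    case (Suc n)
    have "{- int (Suc n)..int (Suc n)} = insert (int n + 1) (insert (- int n - 1) {- int n..int n})"
      by auto
    then show ?case using Suc by (simp add: algebra_simps)
  qed simp
  have eq: "(\<Sum>k\<in>{- int n..int n}. fcoef \<phi> (- k) * cexpi k x\<^sub>0) = 2 * pi * \<phi> x\<^sub>0 + (H (- int n - 1) - H (int n))" for n
  proof -
    have "H (- int n - 1) - H (int n) = (\<Sum>k\<in>{- int n..int n}. fcoef \<phi> (- k) * cexpi k x\<^sub>0) -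
       (\<Sum>k\<in>{- int n..int n}. \<phi> x\<^sub>0 * (if k = 0 then 2 * pi else 0))"
      unfolding tsum[symmetric] tele[symmetric] by (simp add: sum_subtractf)
    also have "(\<Sum>k\<in>{- int n..int n}. \<phi> x\<^sub>0 * (if k = 0 then 2 * pi else 0)) = 2 * pi * \<phi> x\<^sub>0"
      by (simp add: if_distrib mult.commute cong: if_cong)
    finally show ?thesis by simp
  qed
  have "(\<lambda>n. H (- int n - 1)) \<longlonglongrightarrow> 0" "(\<lambda>n. H (int n)) \<longlonglongrightarrow> 0"
  proof -
    have "(\<lambda>n. fcoef h (int n + 1)) \<longlonglongrightarrow> 0" "(\<lambda>n. fcoef h (- int n)) \<longlonglongrightarrow> 0"
      using h by (intro riemann_lebesgue; auto simp: inj_def)+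
    then have "(\<lambda>n. cmod (fcoef h (int n + 1))) \<longlonglongrightarrow> 0" "(\<lambda>n. cmod (fcoef h (- int n))) \<longlonglongrightarrow> 0"
      by (auto simp: tendsto_norm_zero_iff)
    then have "(\<lambda>n. cmod (H (- int n - 1))) \<longlonglongrightarrow> 0" "(\<lambda>n. cmod (H (int n))) \<longlonglongrightarrow> 0"
      by (simp_all add: H_def norm_mult add.commute)
    then show "(\<lambda>n. H (- int n - 1)) \<longlonglongrightarrow> 0" "(\<lambda>n. H (int n)) \<longlonglongrightarrow> 0"
      by (auto simp: tendsto_norm_zero_iff)
  qed
  then have "(\<lambda>n. 2 * pi * \<phi> x\<^sub>0 + (H (- int n - 1) - H (int n))) \<longlonglongrightarrow> 2 * pi * \<phi> x\<^sub>0 + (0 - 0)"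
    by (intro tendsto_intros)
  then show ?thesis unfolding eq by simp
qed

text \<open>Passes from unordered sums to symmetric partial sums. Values of Fourier series are
  identified along the latter, whereas majorants give convergence of the former.\<close>

lemma filterlim_symmetric_intervals:
  "filterlim (\<lambda>n. {- int n..int n}) (finite_subsets_at_top UNIV) sequentially"
  unfolding filterlim_def le_filter_def
proof (intro allI impI)
  fix P assume "eventually P (finite_subsets_at_top (UNIV :: int set))"
  then obtain X where X: "finite X" "\<And>Y. finite Y \<Longrightarrow> X \<subseteq> Y \<Longrightarrow> P Y"
    by (auto simp: eventually_finite_subsets_at_top)
  define N where "N = Max (insert 0 ((\<lambda>k. nat \<bar>k\<bar>) ` X))"
  have "X \<subseteq> {- int n..int n}" if "N \<le> n" for n
  proof
    fix k assume "k \<in> X"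
    then have "nat \<bar>k\<bar> \<le> N" unfolding N_def using X by (intro Max_ge) auto
    with that show "k \<in> {- int n..int n}" by auto
  qed
  then have "\<forall>n\<ge>N. P {- int n..int n}" using X(2) by simp
  then show "eventually P (filtermap (\<lambda>n. {- int n..int n}) sequentially)"
    unfolding eventually_filtermap eventually_sequentially by blast
qed

text \<open>Quadratic decay of the coefficients gives uniform convergence by the M-test; the
  pointwise theorem identifies the limit.\<close>

lemma fourier_series_uniform:
  assumes \<phi>: "\<phi> \<in> periodic_test"
  shows "uniform_limit UNIV (\<lambda>n x. \<Sum>k\<in>{- int n..int n}. fcoef \<phi> (- k) / (2 * pi) * cexpi k x) \<phi> sequentially"
proof -
  obtain C where C: "0 \<le> C" "\<And>k. cmod (fcoef \<phi> k) * (1 + \<bar>real_of_int k\<bar>) ^ 2 \<le> C"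
    using fcoef_decay_ex[OF \<phi>] by blast
  define f where "f k x = fcoef \<phi> (- k) / (2 * pi) * cexpi k x" for k x
  define M where "M k = C / (2 * pi) * (1 / (1 + \<bar>real_of_int k\<bar>)\<^sup>2)" for k
  have fM: "cmod (f k x) \<le> M k" for k x
  proof -
    have "0 < (1 + \<bar>real_of_int k\<bar>)\<^sup>2" by simp
    with C(2)[of "- k"] have "cmod (fcoef \<phi> (- k)) \<le> C / (1 + \<bar>real_of_int k\<bar>)\<^sup>2"
      by (simp add: pos_le_divide_eq)
    then have "cmod (fcoef \<phi> (- k)) / (2 * pi) \<le> C / (1 + \<bar>real_of_int k\<bar>)\<^sup>2 / (2 * pi)"
      by (rule divide_right_mono) simp
    then show ?thesis by (simp add: f_def M_def norm_mult norm_divide mult.commute)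
  qed
  have "M summable_on UNIV"
    unfolding M_def by (intro summable_on_cmult_right summable_inverse_int_square)
  then have "uniform_limit UNIV (\<lambda>F x. \<Sum>k\<in>F. f k x) (\<lambda>x. \<Sum>\<^sub>\<infinity>k. f k x) (finite_subsets_at_top UNIV)"
    by (rule Weierstrass_m_test_general[OF fM])
  then have ul: "uniform_limit UNIV (\<lambda>n x. \<Sum>k\<in>{- int n..int n}. f k x) (\<lambda>x. \<Sum>\<^sub>\<infinity>k. f k x) sequentially"
    by (rule filterlim_compose[OF _ filterlim_symmetric_intervals])
  have "(\<Sum>\<^sub>\<infinity>k. f k x) = \<phi> x" for x
  proof (rule LIMSEQ_unique)
    show "(\<lambda>n. \<Sum>k\<in>{- int n..int n}. f k x) \<longlonglongrightarrow> (\<Sum>\<^sub>\<infinity>k. f k x)"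
      using ul by (rule tendsto_uniform_limitI) simp
    show "(\<lambda>n. \<Sum>k\<in>{- int n..int n}. f k x) \<longlonglongrightarrow> \<phi> x"
      using tendsto_divide[OF fourier_series_pointwise[OF \<phi>, of x] tendsto_const[of "complex_of_real (2 * pi)"]]
      by (simp add: f_def sum_divide_distrib)
  qed
  with ul show ?thesis by (simp add: f_def)
qed

lemma vderiv_funpow_trig_poly:
  "(vderiv ^^ j) (\<lambda>x. \<Sum>k\<in>F. c k * cexpi k x) = (\<lambda>x. \<Sum>k\<in>F. (\<i> * of_int k) ^ j * c k * cexpi k x)"
proof (induction j)
  case (Suc j)
  have "vderiv (\<lambda>x. \<Sum>k\<in>F. (\<i> * of_int k) ^ j * c k * cexpi k x) =
      (\<lambda>x. \<Sum>k\<in>F. (\<i> * of_int k) ^ j * c k * ((\<i> * of_int k) * cexpi k x))"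
    by (intro vderivI has_vector_derivative_sum has_vector_derivative_mult_right cexpi_has_vector_derivative)
  with Suc show ?case by (simp add: mult_ac)
qed simp

text \<open>Differentiating the series term by term gives the series of the derivative, to which
  uniform convergence applies again. Trigonometric polynomials are thus dense in the test topology,
  so that a distribution is determined by its coefficients.\<close>

theorem fourier_series_test_converges:
  assumes \<phi>: "\<phi> \<in> periodic_test"
  shows "test_converges (\<lambda>n x. \<Sum>k\<in>{- int n..int n}. fcoef \<phi> (- k) / (2 * pi) * cexpi k x) \<phi>"
  unfolding test_converges_def
proof
  fix j
  have "uniform_limit UNIV (\<lambda>n x. \<Sum>k\<in>{- int n..int n}. fcoef ((vderiv ^^ j) \<phi>) (- k) / (2 * pi) * cexpi k x)
      ((vderiv ^^ j) \<phi>) sequentially"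
    by (rule fourier_series_uniform[OF periodic_test_funpow[OF \<phi>]])
  then show "uniform_limit UNIV (\<lambda>n. (vderiv ^^ j) (\<lambda>x. \<Sum>k\<in>{- int n..int n}. fcoef \<phi> (- k) / (2 * pi) * cexpi k x))
      ((vderiv ^^ j) \<phi>) sequentially"
    unfolding vderiv_funpow_trig_poly by (simp add: fcoef_funpow[OF \<phi>])
qed

section \<open>Inversion of diagonally dominant infinite matrices on l1\<close>

text \<open>Column sums bounded by \<theta> make \<open>P\<close> a contraction of l1, so (1 + P) b
  = e_j is solved by the alternating series of powers of \<open>P\<close> applied to e_j. The bound
  depends on \<theta> alone, neither on \<open>X\<close> nor on \<open>j\<close>; this is the source
  of the uniform bound on the profiles.\<close>

lemma neumann_series_l1:
  fixes P :: "'a \<Rightarrow> 'a \<Rightarrow> complex"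
  assumes \<theta>: "0 \<le> \<theta>" "\<theta> < 1"
    and col: "\<And>k F. k \<in> X \<Longrightarrow> finite F \<Longrightarrow> F \<subseteq> X \<Longrightarrow> (\<Sum>l\<in>F. cmod (P l k)) \<le> \<theta>"
    and j: "j \<in> X"
  obtains b where "(\<lambda>k. cmod (b k)) summable_on X" "(\<Sum>\<^sub>\<infinity>k\<in>X. cmod (b k)) \<le> 1 / (1 - \<theta>)"
    "\<And>l. l \<in> X \<Longrightarrow> b l + (\<Sum>\<^sub>\<infinity>k\<in>X. P l k * b k) = (if l = j then 1 else 0)"
proof -
  \<comment> \<open>\<open>c n\<close> is the n-th power of -P applied to the unit vector at
    \<open>j\<close>.\<close>
  define c where "c = rec_nat (\<lambda>l. if l = j then 1 else 0) (\<lambda>_ c l. - (\<Sum>\<^sub>\<infinity>k\<in>X. P l k * c k))"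
  have c0: "c 0 = (\<lambda>l. if l = j then 1 else 0)" and cS: "\<And>n l. c (Suc n) l = - (\<Sum>\<^sub>\<infinity>k\<in>X. P l k * c n k)"
    by (simp_all add: c_def)
  have P1: "cmod (P l k) \<le> \<theta>" if "l \<in> X" "k \<in> X" for l k
    using col[of k "{l}"] that by simp
  have bound: "(\<lambda>k. cmod (c n k)) summable_on X \<and> (\<Sum>\<^sub>\<infinity>k\<in>X. cmod (c n k)) \<le> \<theta> ^ n" for n
  proof (induction n)
    case 0
    have "sum (\<lambda>k. cmod (c 0 k)) F \<le> 1" if "finite F" "F \<subseteq> X" for F
      using that by (simp add: c0 if_distrib cong: if_cong)
    then show ?case
      using summable_on_nonneg_bounded[of X "\<lambda>k. cmod (c 0 k)" 1] by auto
  next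
    case (Suc n)
    have s: "(\<lambda>k. P l k * c n k) abs_summable_on X" if "l \<in> X" for l
    proof (rule Infinite_Sum.abs_summable_on_comparison_test)
      show "(\<lambda>k. \<theta> * c n k) abs_summable_on X"
        using Suc \<theta> by (auto simp: norm_mult intro!: summable_on_cmult_right)
      show "cmod (P l k * c n k) \<le> cmod (\<theta> * c n k)" if "k \<in> X" for k
        using P1[OF \<open>l \<in> X\<close> that] \<theta> by (simp add: norm_mult mult_right_mono)
    qed
    have "sum (\<lambda>l. cmod (c (Suc n) l)) F \<le> \<theta> ^ Suc n" if F: "finite F" "F \<subseteq> X" for F
    proof -
      have "sum (\<lambda>l. cmod (c (Suc n) l)) F \<le> (\<Sum>l\<in>F. \<Sum>\<^sub>\<infinity>k\<in>X. cmod (P l k * c n k))"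
        using s F by (intro sum_mono) (auto simp: cS intro!: norm_infsum_bound)
      also have "\<dots> = (\<Sum>\<^sub>\<infinity>k\<in>X. \<Sum>l\<in>F. cmod (P l k * c n k))"
        using s F by (intro infsum_sum[symmetric]) auto
      also have "\<dots> \<le> (\<Sum>\<^sub>\<infinity>k\<in>X. \<theta> * cmod (c n k))"
      proof (rule infsum_mono)
        show "(\<lambda>k. \<Sum>l\<in>F. cmod (P l k * c n k)) summable_on X"
          using s F by (intro summable_on_sum) auto
        show "(\<lambda>k. \<theta> * cmod (c n k)) summable_on X"
          using Suc by (auto intro!: summable_on_cmult_right)
        show "(\<Sum>l\<in>F. cmod (P l k * c n k)) \<le> \<theta> * cmod (c n k)" if "k \<in> X" for k
          using col[OF that F] by (simp add: norm_mult mult_right_mono flip: sum_distrib_right)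
      qed
      also have "\<dots> = \<theta> * (\<Sum>\<^sub>\<infinity>k\<in>X. cmod (c n k))"
        by (rule infsum_cmult_right')
      also have "\<dots> \<le> \<theta> ^ Suc n"
        using Suc \<theta> by (simp add: mult_left_mono)
      finally show ?thesis .
    qed
    then show ?case
      using summable_on_nonneg_bounded[of X "\<lambda>k. cmod (c (Suc n) k)" "\<theta> ^ Suc n"] by auto
  qed
  have geo: "(\<lambda>n. \<theta> ^ n) summable_on UNIV" "(\<Sum>\<^sub>\<infinity>n. \<theta> ^ n) = 1 / (1 - \<theta>)"
    using \<theta> by (auto simp: summable_on_UNIV_nonneg_real_iff summable_geometric suminf_geometric
        infsum_nat_eq_suminf intro!: summable_nonneg_imp_summable_on)
  \<comment> \<open>Absolute summability over the pairs (n, k), by comparison with the geometric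
    series, justifies the two exchanges of summation below.\<close>
  have double: "(\<lambda>(n, k). c n k) abs_summable_on UNIV \<times> X"
  proof (subst Infinite_Sum.abs_summable_on_Sigma_iff, intro conjI ballI)
    show "(\<lambda>n. \<Sum>\<^sub>\<infinity>k\<in>X. cmod (case (n, k) of (n, k) \<Rightarrow> c n k)) abs_summable_on UNIV"
      by (rule Infinite_Sum.abs_summable_on_comparison_test[of "\<lambda>n. \<theta> ^ n"])
        (use geo bound \<theta> in \<open>auto simp: infsum_nonneg\<close>)
  qed (use bound in auto)
  define b where "b k = (\<Sum>\<^sub>\<infinity>n. c n k)" for k
  have double': "(\<lambda>(k, n). c n k) abs_summable_on X \<times> UNIV"
    using summable_on_swap[of "\<lambda>(n, k). cmod (c n k)" UNIV X] double
    by (simp add: case_prod_unfold)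
  then have sk: "(\<lambda>n. c n k) abs_summable_on UNIV" if "k \<in> X" for k
    using Infinite_Sum.abs_summable_on_Sigma_iff[THEN iffD1, OF double', THEN conjunct1, rule_format, OF that] by simp
  have b_bound: "sum (\<lambda>k. cmod (b k)) F \<le> 1 / (1 - \<theta>)" if F: "finite F" "F \<subseteq> X" for F
  proof -
    have "sum (\<lambda>k. cmod (b k)) F \<le> (\<Sum>k\<in>F. \<Sum>\<^sub>\<infinity>n. cmod (c n k))"
      unfolding b_def using sk F by (intro sum_mono norm_infsum_bound) auto
    also have "\<dots> = (\<Sum>\<^sub>\<infinity>n. \<Sum>k\<in>F. cmod (c n k))"
      using sk F by (intro infsum_sum[symmetric]) auto
    also have "\<dots> \<le> (\<Sum>\<^sub>\<infinity>n. \<theta> ^ n)"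
    proof (rule infsum_mono)
      show "(\<lambda>n. \<Sum>k\<in>F. cmod (c n k)) summable_on UNIV"
        using sk F by (intro summable_on_sum) auto
      show "(\<Sum>k\<in>F. cmod (c n k)) \<le> \<theta> ^ n" for n
        using finite_sum_le_infsum[of "\<lambda>k. cmod (c n k)" X F] F bound[of n] by (meson norm_ge_zero order_trans)
    qed (rule geo)
    finally show ?thesis by (simp add: geo)
  qed
  show thesis
  proof
    show "(\<lambda>k. cmod (b k)) summable_on X"
      by (rule summable_on_nonneg_bounded(1)[OF _ b_bound]) simp_all
    show "(\<Sum>\<^sub>\<infinity>k\<in>X. cmod (b k)) \<le> 1 / (1 - \<theta>)"
      by (rule summable_on_nonneg_bounded(2)[OF _ b_bound]) simp_all
    fix l assume l: "l \<in> X"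
    have dl: "(\<lambda>(k, n). P l k * c n k) abs_summable_on X \<times> UNIV"
    proof (rule Infinite_Sum.abs_summable_on_comparison_test)
      show "(\<lambda>x. \<theta> * (case x of (k, n) \<Rightarrow> c n k)) abs_summable_on X \<times> UNIV"
        using summable_on_cmult_right[OF double', of \<theta>] \<theta> by (simp add: norm_mult)
      show "cmod (case x of (k, n) \<Rightarrow> P l k * c n k) \<le> cmod (\<theta> * (case x of (k, n) \<Rightarrow> c n k))"
        if "x \<in> X \<times> UNIV" for x
        using that P1[OF l] \<theta> by (auto simp: norm_mult mult_right_mono split: prod.splits)
    qed
    have "(\<Sum>\<^sub>\<infinity>k\<in>X. P l k * b k) = (\<Sum>\<^sub>\<infinity>k\<in>X. \<Sum>\<^sub>\<infinity>n. P l k * c n k)"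
      unfolding b_def by (simp add: infsum_cmult_right')
    also have "\<dots> = (\<Sum>\<^sub>\<infinity>n. \<Sum>\<^sub>\<infinity>k\<in>X. P l k * c n k)"
      by (rule infsum_swap_banach) (rule Infinite_Sum.abs_summable_summable[OF dl])
    also have "\<dots> = (\<Sum>\<^sub>\<infinity>n. - c (Suc n) l)"
      by (simp add: cS)
    also have "\<dots> = - (\<Sum>n. c (Suc n) l)"
    proof -
      have "(\<lambda>n. c (Suc n) l) abs_summable_on UNIV"
        using summable_on_reindex[of Suc UNIV "\<lambda>n. cmod (c n l)"] sk[OF l]
          summable_on_subset_banach[of "\<lambda>n. cmod (c n l)" UNIV "range Suc"] by (simp add: o_def)
      then show ?thesis
        by (simp add: infsum_uminus infsum_nat_eq_suminf Infinite_Sum.abs_summable_summable)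
    qed
    \<comment> \<open>The shift loses only the term n = 0, which is the unit vector at
      \<open>j\<close>.\<close>
    also have "(\<Sum>n. c (Suc n) l) = b l - c 0 l"
      using suminf_split_head[of "\<lambda>n. c n l"] sk[OF l]
      by (simp add: b_def infsum_nat_eq_suminf Infinite_Sum.abs_summable_summable summable_on_imp_summable)
    finally show "b l + (\<Sum>\<^sub>\<infinity>k\<in>X. P l k * b k) = (if l = j then 1 else 0)"
      by (simp add: c0)
  qed
qed

section \<open>Biorthogonal families of exponentials\<close>

text \<open>Continuity on the whole line forces a pulse to vanish at the ends of its interval as
  well. Hence translates and sums of pulses are pulses on a longer interval, without boundary
  terms.\<close>

definition pulse :: "real \<Rightarrow> (real \<Rightarrow> complex) \<Rightarrow> bool" where
  "pulse \<tau> q \<longleftrightarrow> continuous_on UNIV q \<and> (\<forall>t. t \<notin> {0..\<tau>} \<longrightarrow> q t = 0)"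

text \<open>The integral runs over the whole line, so the value does not refer to the interval
  carrying the pulse, and a translation only contributes a phase.\<close>

definition ft :: "(real \<Rightarrow> complex) \<Rightarrow> real \<Rightarrow> complex" where
  "ft q u = integral UNIV (\<lambda>t. q t * cis (- (u * t)))"

lemma pulse_mono: "pulse \<tau> q \<Longrightarrow> \<tau> \<le> \<tau>' \<Longrightarrow> pulse \<tau>' q"
  by (auto simp: pulse_def)

lemma has_integral_ft:
  assumes "pulse \<tau> q"
  shows "((\<lambda>t. q t * cis (- (u * t))) has_integral ft q u) {0..\<tau>}"
proof -
  let ?f = "\<lambda>t. q t * cis (- (u * t))"
  have "continuous_on {0..\<tau>} q"
    using assms continuous_on_subset by (auto simp: pulse_def)
  then have "continuous_on {0..\<tau>} ?f"
    by (intro continuous_intros)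
  then have i: "(?f has_integral integral {0..\<tau>} ?f) {0..\<tau>}"
    by (intro integrable_integral integrable_continuous_real)
  then have "(?f has_integral integral {0..\<tau>} ?f) UNIV"
    by (rule has_integral_on_superset) (use assms in \<open>auto simp: pulse_def\<close>)
  then have "ft q u = integral {0..\<tau>} ?f"
    unfolding ft_def by (rule integral_unique)
  with i show ?thesis by simp
qed

lemma pulse_shift:
  assumes "pulse \<tau> q" "0 \<le> e"
  shows "pulse (\<tau> + e) (\<lambda>t. q (t - e))" and "ft (\<lambda>t. q (t - e)) u = cis (- (u * e)) * ft q u"
proof -
  have "continuous_on UNIV q"
    using assms by (simp add: pulse_def)
  then have "continuous_on UNIV (\<lambda>t. q (t - e))"
    by (rule continuous_on_compose2) (auto intro!: continuous_intros)
  then show p: "pulse (\<tau> + e) (\<lambda>t. q (t - e))"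
    using assms by (auto simp: pulse_def)
  have "((\<lambda>t. q (t - e) * cis (- (u * (t - e)))) has_integral ft q u) {0 + e..\<tau> + e}"
    using has_integral_shift_real_ivl_iff[where f = "\<lambda>t. q (t - e) * cis (- (u * (t - e)))" and c = e and a = "0 + e" and b = "\<tau> + e"]
      has_integral_ft[OF assms(1), of u] by simp
  then have "((\<lambda>t. cis (- (u * e)) * (q (t - e) * cis (- (u * (t - e))))) has_integral cis (- (u * e)) * ft q u) {0 + e..\<tau> + e}"
    by (rule has_integral_mult_right)
  moreover have "cis (- (u * e)) * (q (t - e) * cis (- (u * (t - e)))) = q (t - e) * cis (- (u * t))" for t
    by (simp add: cis_mult mult.left_commute) (simp add: algebra_simps)
  ultimately have "((\<lambda>t. q (t - e) * cis (- (u * t))) has_integral cis (- (u * e)) * ft q u) {0 + e..\<tau> + e}"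
    by simp
  then have "((\<lambda>t. q (t - e) * cis (- (u * t))) has_integral cis (- (u * e)) * ft q u) {0..\<tau> + e}"
    by (rule has_integral_on_superset) (use assms in \<open>auto simp: pulse_def\<close>)
  with has_integral_ft[OF p, of u] show "ft (\<lambda>t. q (t - e)) u = cis (- (u * e)) * ft q u"
    by (rule has_integral_unique)
qed

lemma pulse_lincomb:
  assumes "pulse \<tau> p" "pulse \<tau> q"
  shows "pulse \<tau> (\<lambda>t. c * p t + d * q t)" and "ft (\<lambda>t. c * p t + d * q t) u = c * ft p u + d * ft q u"
proof -
  show r: "pulse \<tau> (\<lambda>t. c * p t + d * q t)"
    using assms by (auto simp: pulse_def intro!: continuous_intros)
  have "((\<lambda>t. c * (p t * cis (- (u * t))) + d * (q t * cis (- (u * t)))) has_integral c * ft p u + d * ft q u) {0..\<tau>}"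
    using assms by (intro has_integral_add has_integral_mult_right has_integral_ft)
  then have "((\<lambda>t. (c * p t + d * q t) * cis (- (u * t))) has_integral c * ft p u + d * ft q u) {0..\<tau>}"
    by (simp add: algebra_simps)
  with has_integral_ft[OF r, of u] show "ft (\<lambda>t. c * p t + d * q t) u = c * ft p u + d * ft q u"
    by (rule has_integral_unique)
qed

text \<open>For positive \<tau>, clamping the argument extends the half sine wave by zero, as the
  sine vanishes at both ends. The absence of jumps gives a transform of order u^(-2), summable over
  separated frequencies, which the indicator of the interval would not provide.\<close>

definition window :: "real \<Rightarrow> real \<Rightarrow> complex" where
  "window \<tau> t = of_real (sin (pi / \<tau> * min \<tau> (max 0 t)))"

lemma pulse_window: "0 < \<tau> \<Longrightarrow> pulse \<tau> (window \<tau>)"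
  unfolding pulse_def window_def by (intro conjI continuous_intros) (auto simp: min_def max_def)

lemma norm_window: "cmod (window \<tau> t) \<le> 1"
  by (simp add: window_def)

lemma ft_window:
  assumes "0 < \<tau>" "u\<^sup>2 \<noteq> (pi / \<tau>)\<^sup>2"
  shows "ft (window \<tau>) u = of_real (pi / \<tau>) * (1 + cis (- (u * \<tau>))) / of_real ((pi / \<tau>)\<^sup>2 - u\<^sup>2)"
proof -
  define a where "a = pi / \<tau>"
  define D where "D = complex_of_real (a\<^sup>2 - u\<^sup>2)"
  have D: "D \<noteq> 0"
    using assms unfolding D_def a_def of_real_eq_0_iff by auto
  \<comment> \<open>An antiderivative of exp(-iuz) sin(az), as obtained from two integrations by
    parts. It is taken in the complex variable and then restricted to the real line.\<close>
  define F where "F z = exp (- (\<i> * of_real u * z)) * (- (\<i> * of_real u * sin (of_real a * z)) - of_real a * cos (of_real a * z)) / D" for z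
  have D': "(\<i> * of_real u)\<^sup>2 + (of_real a)\<^sup>2 = D"
    by (simp add: D_def power_mult_distrib)
  have "(F has_field_derivative exp (- (\<i> * of_real u * z)) * sin (of_real a * z)) (at z)" for z
  proof -
    define e where "e = exp (- (\<i> * of_real u * z))"
    have 1: "((\<lambda>z. exp (- (\<i> * of_real u * z))) has_field_derivative e * - (\<i> * of_real u)) (at z)"
      unfolding e_def by (auto intro!: derivative_eq_intros)
    have 2: "((\<lambda>z. - (\<i> * of_real u * sin (of_real a * z)) - of_real a * cos (of_real a * z)) has_field_derivative
        - (\<i> * of_real u * (cos (of_real a * z) * of_real a)) - of_real a * (- sin (of_real a * z) * of_real a)) (at z)"
      by (auto intro!: derivative_eq_intros)
    have "e * - (\<i> * of_real u) * (- (\<i> * of_real u * sin (of_real a * z)) - of_real a * cos (of_real a * z)) +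
        (- (\<i> * of_real u * (cos (of_real a * z) * of_real a)) - of_real a * (- sin (of_real a * z) * of_real a)) * e
      = e * sin (of_real a * z) * D"
      unfolding D'[symmetric] power2_eq_square by (simp add: algebra_simps)
    then have "(e * - (\<i> * of_real u) * (- (\<i> * of_real u * sin (of_real a * z)) - of_real a * cos (of_real a * z)) +
        (- (\<i> * of_real u * (cos (of_real a * z) * of_real a)) - of_real a * (- sin (of_real a * z) * of_real a)) * e) / D
      = e * sin (of_real a * z)"
      using D by simp
    moreover have "(F has_field_derivative (e * - (\<i> * of_real u) * (- (\<i> * of_real u * sin (of_real a * z)) - of_real a * cos (of_real a * z)) +
        (- (\<i> * of_real u * (cos (of_real a * z) * of_real a)) - of_real a * (- sin (of_real a * z) * of_real a)) * e) / D) (at z)"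
      unfolding F_def using DERIV_cdivide[OF DERIV_mult[OF 1 2], of D] by (simp add: e_def)
    ultimately show ?thesis by (simp add: e_def)
  qed
  then have "((\<lambda>t. F (of_real t)) has_vector_derivative exp (- (\<i> * of_real u * of_real t)) * sin (of_real a * of_real t)) (at t within {0..\<tau>})" for t
    by (rule has_vector_derivative_real_field)
  then have "((\<lambda>t. exp (- (\<i> * of_real u * of_real t)) * sin (of_real a * of_real t)) has_integral F (of_real \<tau>) - F (of_real 0)) {0..\<tau>}"
    using assms by (intro fundamental_theorem_of_calculus) auto
  moreover have "exp (- (\<i> * of_real u * of_real t)) * sin (of_real a * of_real t) = window \<tau> t * cis (- (u * t))" if "t \<in> {0..\<tau>}" for t
  proof -
    have "min \<tau> (max 0 t) = t" using that by simp
    then show ?thesis by (simp add: window_def a_def cis_conv_exp mult_ac flip: sin_of_real of_real_mult)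
  qed
  ultimately have "((\<lambda>t. window \<tau> t * cis (- (u * t))) has_integral F (of_real \<tau>) - F (of_real 0)) {0..\<tau>}"
    by (subst has_integral_cong[symmetric]) auto
  with has_integral_ft[OF pulse_window[OF assms(1)], of u] have "ft (window \<tau>) u = F (of_real \<tau>) - F (of_real 0)"
    by (rule has_integral_unique)
  also have "complex_of_real a * of_real \<tau> = of_real pi"
    using assms by (simp add: a_def)
  then have "F (of_real \<tau>) = of_real a * cis (- (u * \<tau>)) / D"
    by (simp add: F_def cis_conv_exp mult_ac sin_of_real cos_of_real)
  also have "F (of_real 0) = - (of_real a / D)"
    by (simp add: F_def)
  finally show ?thesis
    by (simp add: a_def D_def add_divide_distrib distrib_left)
qed

text \<open>The diagonal dominance behind Ingham's inequality; comparing with the lattice of spacing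
  \<open>\<gamma>\<close>, the off-diagonal sum telescopes.\<close>

lemma ft_window_row_sum:
  fixes \<Lambda> :: "real set"
  assumes "0 < \<gamma>" "2 * pi / \<gamma> < \<tau>"
    and sep: "\<And>x y. x \<in> \<Lambda> \<Longrightarrow> y \<in> \<Lambda> \<Longrightarrow> x \<noteq> y \<Longrightarrow> \<gamma> \<le> \<bar>x - y\<bar>"
    and "\<mu> \<in> \<Lambda>" "finite F" "F \<subseteq> \<Lambda> - {\<mu>}"
  shows "(\<Sum>x\<in>F. cmod (ft (window \<tau>) (x - \<mu>))) \<le> (2 * pi / (\<tau> * \<gamma>))\<^sup>2 * (2 * \<tau> / pi)"
proof -
  define a where "a = pi / \<tau>"
  define \<theta> where "\<theta> = 2 * pi / (\<tau> * \<gamma>)"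
  have "0 < 2 * pi / \<gamma>"
    using assms by simp
  then have \<tau>: "0 < \<tau>" using assms(2) by linarith
  have a: "0 < a" using \<tau> by (simp add: a_def)
  have \<theta>: "0 < \<theta>" "\<theta> < 1" "a = \<theta> * \<gamma> / 2"
    using assms(1,2) \<tau> by (simp_all add: \<theta>_def a_def field_simps)
  have \<theta>2: "\<theta>\<^sup>2 < 1"
    using \<theta> by (simp add: power2_eq_square mult_strict_mono' [of \<theta> 1 \<theta> 1, simplified])
  define fl where "fl z = \<lfloor>z / \<gamma>\<rfloor>" for z
  \<comment> \<open>Rounding the distance from \<mu> down to a multiple of \<gamma>, with the side
    as sign, assigns to each frequency a lattice point no farther from \<mu>. Separation makes the
    assignment injective and nonzero.\<close>
  define n where "n x = (if x > \<mu> then fl (x - \<mu>) else - fl (\<mu> - x))" for x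
  have fl: "1 \<le> fl z" "of_int (fl z) * \<gamma> \<le> z" if "\<gamma> \<le> z" for z
    using that assms(1) by (simp_all add: fl_def le_floor_iff flip: pos_le_divide_eq)
  have nx: "n x \<noteq> 0 \<and> \<bar>of_int (n x)\<bar> * \<gamma> \<le> \<bar>x - \<mu>\<bar>" if "x \<in> F" for x
  proof (cases "x > \<mu>")
    case True
    then have "\<gamma> \<le> x - \<mu>" using sep[of x \<mu>] that assms by auto
    from fl[OF this] True show ?thesis by (auto simp: n_def)
  next
    case False
    then have "\<gamma> \<le> \<mu> - x" using sep[of x \<mu>] that assms by auto
    from fl[OF this] False show ?thesis by (auto simp: n_def)
  qed
  have floor_inj: "fl z \<noteq> fl w" if "\<gamma> \<le> w - z" for z w
  proof -
    have "z / \<gamma> + 1 = (z + \<gamma>) / \<gamma>" using assms(1) by (simp add: add_divide_distrib)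
    also have "\<dots> \<le> w / \<gamma>" using that assms(1) by (intro divide_right_mono) auto
    finally show ?thesis unfolding fl_def by linarith
  qed
  have inj: "inj_on n F"
  proof (rule inj_onI, rule ccontr)
    fix x y assume xy: "x \<in> F" "y \<in> F" "n x = n y" "x \<noteq> y"
    then have g: "\<gamma> \<le> \<bar>x - y\<bar>" "\<gamma> \<le> \<bar>x - \<mu>\<bar>" "\<gamma> \<le> \<bar>y - \<mu>\<bar>" using sep assms by auto
    consider "x > \<mu>" "y > \<mu>" | "x < \<mu>" "y < \<mu>" | "x > \<mu>" "y < \<mu>" | "x < \<mu>" "y > \<mu>"
      using g assms(1) by linarith
    then show False
    proof cases
      case 1
      with xy g floor_inj[of "y - \<mu>" "x - \<mu>"] floor_inj[of "x - \<mu>" "y - \<mu>"] show False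
        by (auto simp: n_def abs_if split: if_splits)
    next
      case 2
      with xy g floor_inj[of "\<mu> - y" "\<mu> - x"] floor_inj[of "\<mu> - x" "\<mu> - y"] show False
        by (auto simp: n_def abs_if split: if_splits)
    next
      case 3
      with xy g fl(1)[of "x - \<mu>"] fl(1)[of "\<mu> - y"] show False
        by (auto simp: n_def)
    next
      case 4
      with xy g fl(1)[of "y - \<mu>"] fl(1)[of "\<mu> - x"] show False
        by (auto simp: n_def)
    qed
  qed
  \<comment> \<open>Here a = \<theta> \<gamma> / 2 with \<theta> < 1, and the distance to \<mu> is
    at least |n| \<gamma>. So the denominator (x - \<mu>)^2 - a^2 is at least (4 n^2 - 1) \<gamma>^2
    / 4, and the factor \<theta>^2 comes from expressing a^2 through \<gamma>^2.\<close>
  have tm: "cmod (ft (window \<tau>) (x - \<mu>)) \<le> \<theta>\<^sup>2 * (2 * \<tau> / pi) * (1 / (4 * (real_of_int (n x))\<^sup>2 - 1))" if "x \<in> F" for x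
  proof -
    define m where "m = (real_of_int (n x))\<^sup>2"
    have "1 \<le> (n x)\<^sup>2" using nx[OF that] by (simp add: int_one_le_iff_zero_less)
    then have m: "1 \<le> m" unfolding m_def by (metis of_int_1 of_int_le_iff of_int_power)
    have "(\<bar>of_int (n x)\<bar> * \<gamma>)\<^sup>2 \<le> \<bar>x - \<mu>\<bar>\<^sup>2"
      using nx[OF that] assms(1) by (intro power_mono) auto
    then have mu: "m * \<gamma>\<^sup>2 \<le> (x - \<mu>)\<^sup>2" by (simp add: m_def power_mult_distrib)
    have a2: "a\<^sup>2 = \<theta>\<^sup>2 * \<gamma>\<^sup>2 / 4" by (simp add: \<theta>(3) power_mult_distrib power_divide)
    have g2: "0 < \<gamma>\<^sup>2" using assms(1) by simp
    have "\<theta>\<^sup>2 * \<gamma>\<^sup>2 \<le> 1 * \<gamma>\<^sup>2"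
      using \<theta>2 g2 by (intro mult_right_mono) auto
    moreover have "(4 * m - 1) * \<gamma>\<^sup>2 / 4 = m * \<gamma>\<^sup>2 - \<gamma>\<^sup>2 / 4"
      by (simp add: field_simps)
    ultimately have "(4 * m - 1) * \<gamma>\<^sup>2 / 4 \<le> m * \<gamma>\<^sup>2 - a\<^sup>2"
      unfolding a2 by linarith
    with mu have den: "(4 * m - 1) * \<gamma>\<^sup>2 / 4 \<le> (x - \<mu>)\<^sup>2 - a\<^sup>2" by linarith
    have den0: "0 < (4 * m - 1) * \<gamma>\<^sup>2 / 4" using m g2 by simp
    have "cmod (1 + cis (- ((x - \<mu>) * \<tau>))) \<le> 2"
      using norm_triangle_ineq[of 1 "cis (- ((x - \<mu>) * \<tau>))"] by simp
    then have "cmod (ft (window \<tau>) (x - \<mu>)) \<le> a * 2 / ((x - \<mu>)\<^sup>2 - a\<^sup>2)"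
      using a den den0 \<tau>
      by (subst ft_window) (auto simp: norm_mult norm_divide a_def[symmetric] abs_if simp flip: of_real_power of_real_diff intro!: divide_right_mono mult_left_mono)
    also have "\<dots> \<le> a * 2 / ((4 * m - 1) * \<gamma>\<^sup>2 / 4)"
      using den den0 a by (intro divide_left_mono) auto
    also have "\<dots> = \<theta>\<^sup>2 * (2 / a) * (1 / (4 * m - 1))"
    proof -
      have "a * 2 / ((4 * m - 1) * \<gamma>\<^sup>2 / 4) = (a\<^sup>2 * 4 / \<gamma>\<^sup>2) * (2 / a) * (1 / (4 * m - 1))"
        using a by (simp add: field_simps power2_eq_square)
      also have "a\<^sup>2 * 4 / \<gamma>\<^sup>2 = \<theta>\<^sup>2" using g2 by (simp add: a2)
      finally show ?thesis .
    qed
    finally show ?thesis by (simp add: a_def m_def)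
  qed
  have "(\<Sum>x\<in>F. cmod (ft (window \<tau>) (x - \<mu>))) \<le> (\<Sum>x\<in>F. \<theta>\<^sup>2 * (2 * \<tau> / pi) * (1 / (4 * (real_of_int (n x))\<^sup>2 - 1)))"
    by (intro sum_mono tm)
  also have "\<dots> = \<theta>\<^sup>2 * (2 * \<tau> / pi) * (\<Sum>k\<in>n ` F. 1 / (4 * (real_of_int k)\<^sup>2 - 1))"
    using inj by (simp add: sum.reindex sum_distrib_left)
  also have "\<dots> \<le> \<theta>\<^sup>2 * (2 * \<tau> / pi) * 1"
    using nx assms(5) \<tau> by (intro mult_left_mono sum_inverse_odd_products) auto
  finally show ?thesis by (simp add: \<theta>_def)
qed


text \<open>With the ansatz of a window times a combination of the exponentials in \<Lambda>,
  biorthogonality is a linear system for the coefficients, whose matrix is the Gram matrix. The l1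
  bound on its solution bounds the pulse in supremum norm, by a constant that depends on \<tau> and
  \<gamma> only.\<close>

lemma ingham_biorthogonal:
  fixes \<Lambda> :: "real set"
  assumes "0 < \<gamma>" "2 * pi / \<gamma> < \<tau>"
    and sep: "\<And>x y. x \<in> \<Lambda> \<Longrightarrow> y \<in> \<Lambda> \<Longrightarrow> x \<noteq> y \<Longrightarrow> \<gamma> \<le> \<bar>x - y\<bar>"
    and "\<mu> \<in> \<Lambda>"
  obtains q where "pulse \<tau> q" "\<And>t. cmod (q t) \<le> pi / (2 * \<tau>) / (1 - (2 * pi / (\<tau> * \<gamma>))\<^sup>2)"
    "\<And>x. x \<in> \<Lambda> \<Longrightarrow> ft q x = (if x = \<mu> then 1 else 0)"
proof -
  define \<theta> where "\<theta> = (2 * pi / (\<tau> * \<gamma>))\<^sup>2"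
  define W where "W = 2 * \<tau> / pi"
  have "0 < 2 * pi / \<gamma>"
    using assms by simp
  then have \<tau>: "0 < \<tau>" using assms(2) by linarith
  have W: "0 < W" using \<tau> by (simp add: W_def)
  have "0 < 2 * pi / (\<tau> * \<gamma>)" "2 * pi / (\<tau> * \<gamma>) < 1"
    using assms(1,2) \<tau> by (simp_all add: field_simps)
  then have \<theta>: "0 \<le> \<theta>" "\<theta> < 1"
    by (simp_all add: \<theta>_def power_less_one_iff)
  have ft0: "ft (window \<tau>) 0 = of_real W"
    using \<tau> by (subst ft_window) (simp_all add: W_def field_simps power2_eq_square)
  \<comment> \<open>The Gram matrix divided by its constant diagonal value \<open>W\<close>, minus
    the identity.\<close>
  define P where "P x y = (if x = y then 0 else ft (window \<tau>) (x - y) / of_real W)" for x y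
  have col: "(\<Sum>x\<in>F. cmod (P x y)) \<le> \<theta>" if "y \<in> \<Lambda>" "finite F" "F \<subseteq> \<Lambda>" for y F
  proof -
    have "(\<Sum>x\<in>F. cmod (P x y)) = (\<Sum>x\<in>F - {y}. cmod (P x y))"
      using that by (intro sum.mono_neutral_right) (auto simp: P_def)
    also have "\<dots> = (\<Sum>x\<in>F - {y}. cmod (ft (window \<tau>) (x - y))) / W"
      using W by (auto simp: P_def norm_divide sum_divide_distrib intro!: sum.cong)
    also have "\<dots> \<le> \<theta> * W / W"
      using W that ft_window_row_sum[OF assms(1,2) sep, where \<mu> = y and F = "F - {y}"]
      by (intro divide_right_mono) (auto simp: \<theta>_def W_def)
    finally show ?thesis using W by simp
  qed
  obtain b where b: "(\<lambda>y. cmod (b y)) summable_on \<Lambda>" "(\<Sum>\<^sub>\<infinity>y\<in>\<Lambda>. cmod (b y)) \<le> 1 / (1 - \<theta>)"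
    "\<And>x. x \<in> \<Lambda> \<Longrightarrow> b x + (\<Sum>\<^sub>\<infinity>y\<in>\<Lambda>. P x y * b y) = (if x = \<mu> then 1 else 0)"
    by (rule neumann_series_l1[where P = P, OF \<theta> col assms(4)]) (assumption+, rule that)
  define f where "f y t = b y / of_real W * (window \<tau> t * cis (y * t))" for y t
  define q where "q t = (\<Sum>\<^sub>\<infinity>y\<in>\<Lambda>. f y t)" for t
  have f_bd: "cmod (f y t) \<le> cmod (b y) / W" for y t
    using W norm_window[of \<tau> t] by (simp add: f_def norm_mult norm_divide divide_right_mono mult_left_le)
  have bW: "(\<lambda>y. cmod (b y) / W) summable_on \<Lambda>"
    using summable_on_cmult_left[OF b(1), of "1 / W"] by simp
  have f_cont: "continuous_on X (f y)" for X y
  proof -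
    have "continuous_on X (window \<tau>)"
      using pulse_window[OF \<tau>] continuous_on_subset by (auto simp: pulse_def)
    then show ?thesis unfolding f_def by (intro continuous_intros)
  qed
  have q: "pulse \<tau> q"
    unfolding pulse_def
  proof (intro conjI allI impI)
    show "continuous_on UNIV q"
      unfolding q_def using f_cont f_bd bW by (rule continuous_on_infsum)
    show "q t = 0" if "t \<notin> {0..\<tau>}" for t
      using that pulse_window[OF \<tau>] by (simp add: q_def f_def pulse_def)
  qed
  show thesis
  proof
    show "pulse \<tau> q" by (rule q)
    show "cmod (q t) \<le> pi / (2 * \<tau>) / (1 - (2 * pi / (\<tau> * \<gamma>))\<^sup>2)" for t
    proof -
      have s: "(\<lambda>y. f y t) abs_summable_on \<Lambda>"
        using f_bd by (intro Infinite_Sum.abs_summable_on_comparison_test'[OF bW]) auto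
      have "cmod (q t) \<le> (\<Sum>\<^sub>\<infinity>y\<in>\<Lambda>. cmod (f y t))"
        unfolding q_def using s by (rule norm_infsum_bound)
      also have "\<dots> \<le> (\<Sum>\<^sub>\<infinity>y\<in>\<Lambda>. cmod (b y) / W)"
        using s bW f_bd by (rule infsum_mono)
      also have "\<dots> = (\<Sum>\<^sub>\<infinity>y\<in>\<Lambda>. cmod (b y)) * (1 / W)"
        using infsum_cmult_left'[of "\<lambda>y. cmod (b y)" "1 / W" \<Lambda>] by simp
      also have "\<dots> \<le> 1 / (1 - \<theta>) * (1 / W)"
        using b(2) W by (intro mult_right_mono) auto
      finally show ?thesis by (simp add: \<theta>_def W_def mult.commute)
    qed
    show "ft q x = (if x = \<mu> then 1 else 0)" if x: "x \<in> \<Lambda>" for x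
    proof -
      define G where "G y = b y / of_real W * ft (window \<tau>) (x - y)" for y
      have cq: "q t * cis (- (x * t)) = (\<Sum>\<^sub>\<infinity>y\<in>\<Lambda>. f y t * cis (- (x * t)))" for t
        unfolding q_def by (rule infsum_cmult_left'[symmetric])
      have "((\<lambda>y. integral {0..\<tau>} (\<lambda>t. f y t * cis (- (x * t)))) has_sum
          integral {0..\<tau>} (\<lambda>t. \<Sum>\<^sub>\<infinity>y\<in>\<Lambda>. f y t * cis (- (x * t)))) \<Lambda>"
        using f_cont f_bd by (intro has_sum_integral[OF _ _ bW] continuous_intros) (auto simp: norm_mult)
      moreover have "integral {0..\<tau>} (\<lambda>t. f y t * cis (- (x * t))) = G y" for y
      proof (rule integral_unique)
        have "((\<lambda>t. b y / of_real W * (window \<tau> t * cis (- ((x - y) * t)))) has_integral G y) {0..\<tau>}"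
          unfolding G_def by (intro has_integral_mult_right has_integral_ft pulse_window \<tau>)
        moreover have "f y t * cis (- (x * t)) = b y / of_real W * (window \<tau> t * cis (- ((x - y) * t)))" for t
          unfolding f_def mult.assoc by (simp add: cis_mult) (simp add: algebra_simps)
        ultimately show "((\<lambda>t. f y t * cis (- (x * t))) has_integral G y) {0..\<tau>}"
          by (simp only:)
      qed
      ultimately have hs: "(G has_sum ft q x) \<Lambda>"
        using integral_unique[OF has_integral_ft[OF q, of x]] by (simp add: cq)
      have "G x = b x"
        using W by (simp add: G_def ft0)
      have "(G has_sum ft q x - b x) (\<Lambda> - {x})"
        using has_sum_Diff[OF hs, of "{x}" "b x"] x \<open>G x = b x\<close> by (simp add: has_sum_finite_iff)
      then have "((\<lambda>y. P x y * b y) has_sum ft q x - b x) (\<Lambda> - {x})"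
        by (rule has_sum_cong[THEN iffD1, rotated]) (auto simp: G_def P_def)
      then have "((\<lambda>y. P x y * b y) has_sum ft q x - b x) \<Lambda>"
        by (rule has_sum_cong_neutral[THEN iffD1, rotated -1]) (auto simp: P_def)
      then have "(\<Sum>\<^sub>\<infinity>y\<in>\<Lambda>. P x y * b y) = ft q x - b x"
        by (rule infsumI)
      with b(3)[OF x] show ?thesis by simp
    qed
  qed
qed

section \<open>Removing finitely many frequencies by translates\<close>

text \<open>Subtracting a translate rotated by the frequency \<mu> multiplies the transform by a
  factor vanishing at \<mu>; division by \<open>D\<close> restores the value 1 at \<nu>. As the
  transform is only multiplied, its zeros survive.\<close>

lemma pulse_annihilate:
  fixes \<nu> \<mu> :: real
  assumes q: "pulse \<tau> q" "\<And>t. cmod (q t) \<le> B" "ft q \<nu> = 1"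
    and "0 < \<epsilon>" "0 < \<delta>" "\<delta> \<le> \<bar>\<mu> - \<nu>\<bar>"
  obtains Q where "pulse (\<tau> + \<epsilon>) Q" "\<And>t. cmod (Q t) \<le> 2 / (1 - cos (min (\<delta> * \<epsilon>) pi)) * B" "ft Q \<nu> = 1" "ft Q \<mu> = 0"
    "\<And>x. ft q x = 0 \<Longrightarrow> ft Q x = 0"
proof -
  \<comment> \<open>The shift is shortened when \<mu> is far from \<nu>, so that the phase |\<mu> -
    \<nu>| e stays between min(\<delta> \<epsilon>, pi) and pi. On this range 1 - cos is bounded
    below, which keeps \<open>D\<close> away from 0 uniformly in \<mu>.\<close>
  define e where "e = min \<epsilon> (pi / \<bar>\<mu> - \<nu>\<bar>)"
  define \<kappa> where "\<kappa> = 1 - cos (min (\<delta> * \<epsilon>) pi)"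
  define D where "D = 1 - cis ((\<mu> - \<nu>) * e)"
  have e: "0 < e" "e \<le> \<epsilon>" using assms by (auto simp: e_def)
  have B: "0 \<le> B" using q(2)[of 0] norm_ge_zero order_trans by blast
  have "cos (min (\<delta> * \<epsilon>) pi) < cos 0"
    using assms by (intro cos_monotone_0_pi) auto
  then have \<kappa>: "0 < \<kappa>" by (simp add: \<kappa>_def)
  have angle: "min (\<delta> * \<epsilon>) pi \<le> \<bar>\<mu> - \<nu>\<bar> * e" "\<bar>\<mu> - \<nu>\<bar> * e \<le> pi"
  proof -
    have m: "\<bar>\<mu> - \<nu>\<bar> * e = min (\<bar>\<mu> - \<nu>\<bar> * \<epsilon>) pi"
      using assms by (auto simp: e_def min_mult_distrib_left)
    show "\<bar>\<mu> - \<nu>\<bar> * e \<le> pi" unfolding m by simp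
    have "\<delta> * \<epsilon> \<le> \<bar>\<mu> - \<nu>\<bar> * \<epsilon>" using assms by (intro mult_right_mono) auto
    then show "min (\<delta> * \<epsilon>) pi \<le> \<bar>\<mu> - \<nu>\<bar> * e" unfolding m by (rule min.mono) simp
  qed
  have "\<kappa> \<le> Re D"
  proof -
    have "cos (\<bar>\<mu> - \<nu>\<bar> * e) \<le> cos (min (\<delta> * \<epsilon>) pi)"
      using angle assms by (intro cos_monotone_0_pi_le) auto
    moreover have "cos (\<bar>\<mu> - \<nu>\<bar> * e) = cos ((\<mu> - \<nu>) * e)"
      using e by (metis abs_mult abs_of_pos cos_abs_real)
    ultimately show ?thesis by (simp add: \<kappa>_def D_def)
  qed
  then have D: "\<kappa> \<le> cmod D" using complex_Re_le_cmod order_trans by blast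
  with \<kappa> have D0: "D \<noteq> 0" by auto
  define Q where "Q t = 1 / D * q t + (- cis (\<mu> * e) / D) * q (t - e)" for t
  have p: "pulse (\<tau> + e) q" using q e by (auto intro: pulse_mono)
  note sh = pulse_shift[OF q(1), of e]
  have Q: "pulse (\<tau> + e) Q" and ftQ: "ft Q u = ft q u * (1 - cis ((\<mu> - u) * e)) / D" for u
  proof -
    show "pulse (\<tau> + e) Q"
      unfolding Q_def using p sh e by (intro pulse_lincomb) auto
    have "ft Q u = 1 / D * ft q u + (- cis (\<mu> * e) / D) * (cis (- (u * e)) * ft q u)"
      unfolding Q_def using p sh e by (subst pulse_lincomb[of "\<tau> + e"]) auto
    also have "cis ((\<mu> - u) * e) = cis (\<mu> * e) * cis (- (u * e))"
      by (simp add: cis_mult algebra_simps)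
    then have "1 / D * ft q u + (- cis (\<mu> * e) / D) * (cis (- (u * e)) * ft q u) = ft q u * (1 - cis ((\<mu> - u) * e)) / D"
      by (simp add: algebra_simps diff_divide_distrib)
    finally show "ft Q u = ft q u * (1 - cis ((\<mu> - u) * e)) / D" .
  qed
  show thesis
  proof
    show "pulse (\<tau> + \<epsilon>) Q" using Q e by (auto intro: pulse_mono)
    show "ft Q \<nu> = 1" using q(3) D0 by (simp add: ftQ) (simp add: D_def)
    show "ft Q \<mu> = 0" by (simp add: ftQ)
    show "ft Q x = 0" if "ft q x = 0" for x using that by (simp add: ftQ)
    show "cmod (Q t) \<le> 2 / (1 - cos (min (\<delta> * \<epsilon>) pi)) * B" for t
    proof -
      have "cmod (Q t) \<le> 1 / cmod D * cmod (q t) + 1 / cmod D * cmod (q (t - e))"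
        unfolding Q_def by (rule order_trans[OF norm_triangle_ineq]) (simp add: norm_mult norm_divide)
      also have "\<dots> \<le> 1 / \<kappa> * B + 1 / \<kappa> * B"
      proof -
        have "1 / cmod D \<le> 1 / \<kappa>"
          using D \<kappa> by (intro divide_left_mono mult_pos_pos) linarith+
        then have "1 / cmod D * cmod (q x) \<le> 1 / \<kappa> * B" for x
          using q(2) \<kappa> by (intro mult_mono) auto
        then show ?thesis by (intro add_mono)
      qed
      finally show ?thesis by (simp add: \<kappa>_def)
    qed
  qed
qed

lemma pulse_annihilate_finite:
  fixes \<nu> \<epsilon> :: real
  assumes "finite N" "pulse \<tau> q" "\<And>t. cmod (q t) \<le> B" "ft q \<nu> = 1"
    and "0 < \<epsilon>" "0 < \<delta>" "\<And>\<mu>. \<mu> \<in> N \<Longrightarrow> \<delta> \<le> \<bar>\<mu> - \<nu>\<bar>"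
  obtains Q where "pulse (\<tau> + card N * \<epsilon>) Q" "\<And>t. cmod (Q t) \<le> (2 / (1 - cos (min (\<delta> * \<epsilon>) pi))) ^ card N * B" "ft Q \<nu> = 1"
    "\<And>\<mu>. \<mu> \<in> N \<Longrightarrow> ft Q \<mu> = 0" "\<And>x. ft q x = 0 \<Longrightarrow> ft Q x = 0"
proof -
  have "\<exists>Q. pulse (\<tau> + card N * \<epsilon>) Q \<and> (\<forall>t. cmod (Q t) \<le> (2 / (1 - cos (min (\<delta> * \<epsilon>) pi))) ^ card N * B) \<and> ft Q \<nu> = 1 \<and>
    (\<forall>\<mu>\<in>N. ft Q \<mu> = 0) \<and> (\<forall>x. ft q x = 0 \<longrightarrow> ft Q x = 0)"
    using assms(1,7)
  proof (induction rule: finite_induct)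
    case empty
    then show ?case using assms by auto
  next
    case (insert \<mu> N)
    then obtain Q where Q: "pulse (\<tau> + card N * \<epsilon>) Q" "\<And>t. cmod (Q t) \<le> (2 / (1 - cos (min (\<delta> * \<epsilon>) pi))) ^ card N * B" "ft Q \<nu> = 1"
      "\<forall>\<mu>\<in>N. ft Q \<mu> = 0" "\<forall>x. ft q x = 0 \<longrightarrow> ft Q x = 0"
      by auto
    obtain R where R: "pulse (\<tau> + card N * \<epsilon> + \<epsilon>) R"
      "\<And>t. cmod (R t) \<le> 2 / (1 - cos (min (\<delta> * \<epsilon>) pi)) * ((2 / (1 - cos (min (\<delta> * \<epsilon>) pi))) ^ card N * B)"
      "ft R \<nu> = 1" "ft R \<mu> = 0" "\<And>x. ft Q x = 0 \<Longrightarrow> ft R x = 0"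
      using pulse_annihilate[OF Q(1-3) assms(5,6), of \<mu>] insert.prems by blast
    have "pulse (\<tau> + card (insert \<mu> N) * \<epsilon>) R"
      using R(1) insert.hyps by (simp add: algebra_simps)
    moreover have "cmod (R t) \<le> (2 / (1 - cos (min (\<delta> * \<epsilon>) pi))) ^ card (insert \<mu> N) * B" for t
      using R(2)[of t] insert.hyps by (simp add: mult.assoc)
    ultimately show ?case
      using R(3-5) Q(4,5) by blast
  qed
  with that show thesis by blast
qed

text \<open>The bound is free of the centre \<open>c\<close>. It limits, uniformly in the target
  frequency, how many neighbours have to be annihilated.\<close>

lemma card_separated_le:
  fixes X :: "real set"
  assumes "0 < \<delta>" and sep: "\<And>x y. x \<in> X \<Longrightarrow> y \<in> X \<Longrightarrow> x \<noteq> y \<Longrightarrow> \<delta> \<le> \<bar>x - y\<bar>"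
    and near: "\<And>x. x \<in> X \<Longrightarrow> \<bar>x - c\<bar> \<le> \<rho>"
  shows "finite X" and "card X \<le> card {\<lfloor>- \<rho> / \<delta>\<rfloor>..\<lfloor>\<rho> / \<delta>\<rfloor>}"
proof -
  define n where "n x = \<lfloor>(x - c) / \<delta>\<rfloor>" for x
  have ne: "n x \<noteq> n y" if "\<delta> \<le> y - x" for x y
  proof -
    have "(x - c) / \<delta> + 1 = (x - c + \<delta>) / \<delta>" using assms(1) by (simp add: add_divide_distrib)
    also have "\<dots> \<le> (y - c) / \<delta>" using that assms(1) by (intro divide_right_mono) auto
    finally show ?thesis unfolding n_def by linarith
  qed
  have inj: "inj_on n X"
  proof (rule inj_onI, rule ccontr)
    fix x y assume "x \<in> X" "y \<in> X" "n x = n y" "x \<noteq> y"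
    with sep[of x y] ne[of x y] ne[of y x] show False by (auto simp: abs_if split: if_splits)
  qed
  have sub: "n ` X \<subseteq> {\<lfloor>- \<rho> / \<delta>\<rfloor>..\<lfloor>\<rho> / \<delta>\<rfloor>}"
  proof clarify
    fix x assume "x \<in> X"
    from near[OF this] have "- \<rho> \<le> x - c" "x - c \<le> \<rho>" by auto
    then show "n x \<in> {\<lfloor>- \<rho> / \<delta>\<rfloor>..\<lfloor>\<rho> / \<delta>\<rfloor>}"
      using assms(1) unfolding n_def atLeastAtMost_iff by (intro conjI floor_mono divide_right_mono) auto
  qed
  show "finite X"
    using inj sub by (meson finite_atLeastAtMost_int finite_imageD finite_subset)
  show "card X \<le> card {\<lfloor>- \<rho> / \<delta>\<rfloor>..\<lfloor>\<rho> / \<delta>\<rfloor>}"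
    using inj sub by (metis card_image card_mono finite_atLeastAtMost_int)
qed

text \<open>For each \<nu> a bounded number of other frequencies is set aside so that the rest, with
  \<nu>, is separated by \<gamma>; Ingham's pulse for the rest is then corrected at those set aside.
  Since their number is bounded uniformly in \<nu>, a single bound \<open>B\<close> serves the whole
  family.\<close>

theorem biorthogonal_exponentials:
  fixes \<Lambda> S :: "real set"
  assumes "0 < \<delta>" and sep: "\<And>x y. x \<in> \<Lambda> \<Longrightarrow> y \<in> \<Lambda> \<Longrightarrow> x \<noteq> y \<Longrightarrow> \<delta> \<le> \<bar>x - y\<bar>"
    and "0 < \<gamma>" "finite S"
    and sep': "\<And>x y. x \<in> \<Lambda> - S \<Longrightarrow> y \<in> \<Lambda> - S \<Longrightarrow> x \<noteq> y \<Longrightarrow> \<gamma> \<le> \<bar>x - y\<bar>"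
    and T: "2 * pi / \<gamma> < T"
  obtains B q where "\<And>\<nu>. \<nu> \<in> \<Lambda> \<Longrightarrow> pulse T (q \<nu>)" "\<And>\<nu> t. \<nu> \<in> \<Lambda> \<Longrightarrow> cmod (q \<nu> t) \<le> B"
    "\<And>\<nu> x. \<nu> \<in> \<Lambda> \<Longrightarrow> x \<in> \<Lambda> \<Longrightarrow> ft (q \<nu>) x = (if x = \<nu> then 1 else 0)"
proof -
  define m where "m = card S + card {\<lfloor>- \<gamma> / \<delta>\<rfloor>..\<lfloor>\<gamma> / \<delta>\<rfloor>}"
  \<comment> \<open>The slack between 2 pi / \<gamma> and T is halved: one half makes the Gram
    matrix strictly dominant, the other is shared among at most \<open>m\<close> translations. The
    extra share in m + 1 avoids a division by zero.\<close>
  define \<tau> where "\<tau> = (2 * pi / \<gamma> + T) / 2"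
  define \<epsilon> where "\<epsilon> = (T - \<tau>) / (real m + 1)"
  define \<kappa> where "\<kappa> = 2 / (1 - cos (min (\<delta> * \<epsilon>) pi))"
  define B where "B = pi / (2 * \<tau>) / (1 - (2 * pi / (\<tau> * \<gamma>))\<^sup>2)"
  have \<tau>: "2 * pi / \<gamma> < \<tau>" "\<tau> < T" using T by (auto simp: \<tau>_def)
  then have \<epsilon>: "0 < \<epsilon>" by (simp add: \<epsilon>_def)
  have "cos (min (\<delta> * \<epsilon>) pi) < cos 0"
    using assms \<epsilon> by (intro cos_monotone_0_pi) auto
  moreover have "-1 \<le> cos (min (\<delta> * \<epsilon>) pi)" by simp
  ultimately have \<kappa>: "1 \<le> \<kappa>" by (simp add: \<kappa>_def)
  have "\<exists>q. pulse T q \<and> (\<forall>t. cmod (q t) \<le> \<kappa> ^ m * B) \<and> (\<forall>x\<in>\<Lambda>. ft q x = (if x = \<nu> then 1 else 0))"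
    if \<nu>: "\<nu> \<in> \<Lambda>" for \<nu>
  proof -
    \<comment> \<open>A \<nu> in \<open>S\<close> may be closer than \<gamma> to frequencies outside
      \<open>S\<close>, so removing \<open>S\<close> alone would not isolate it. Its neighbours are
      removed as well, and \<delta>-separation limits their number.\<close>
    define near where "near = {x \<in> \<Lambda>. \<bar>x - \<nu>\<bar> < \<gamma>}"
    define N where "N = (S \<union> near) \<inter> \<Lambda> - {\<nu>}"
    have near: "finite near" "card near \<le> card {\<lfloor>- \<gamma> / \<delta>\<rfloor>..\<lfloor>\<gamma> / \<delta>\<rfloor>}"
      using card_separated_le[of \<delta> near \<nu> \<gamma>] assms(1) sep by (auto simp: near_def)
    have N: "finite N" "card N \<le> m"
    proof -
      show "finite N" using near assms(4) by (auto simp: N_def)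
      have "card N \<le> card (S \<union> near)"
        using near assms(4) by (intro card_mono) (auto simp: N_def)
      also have "\<dots> \<le> m" using near card_Un_le[of S near] by (simp add: m_def)
      finally show "card N \<le> m" .
    qed
    have "\<gamma> \<le> \<bar>x - y\<bar>" if "x \<in> \<Lambda> - N" "y \<in> \<Lambda> - N" "x \<noteq> y" for x y
    proof (cases "x = \<nu> \<or> y = \<nu>")
      case True
      then show ?thesis using that by (auto simp: N_def near_def abs_minus_commute)
    next
      case False
      then show ?thesis using that by (intro sep') (auto simp: N_def)
    qed
    moreover have "\<nu> \<in> \<Lambda> - N" using \<nu> by (simp add: N_def)
    ultimately obtain q where q: "pulse \<tau> q" "\<And>t. cmod (q t) \<le> B"
      "\<And>x. x \<in> \<Lambda> - N \<Longrightarrow> ft q x = (if x = \<nu> then 1 else 0)"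
      using ingham_biorthogonal[OF assms(3) \<tau>(1), of "\<Lambda> - N" \<nu>] unfolding B_def by blast
    have "ft q \<nu> = 1" using q(3) \<open>\<nu> \<in> \<Lambda> - N\<close> by simp
    moreover have "\<delta> \<le> \<bar>\<mu> - \<nu>\<bar>" if "\<mu> \<in> N" for \<mu>
      using that sep \<nu> by (auto simp: N_def)
    ultimately obtain Q where Q: "pulse (\<tau> + card N * \<epsilon>) Q" "\<And>t. cmod (Q t) \<le> \<kappa> ^ card N * B" "ft Q \<nu> = 1"
      "\<And>\<mu>. \<mu> \<in> N \<Longrightarrow> ft Q \<mu> = 0" "\<And>x. ft q x = 0 \<Longrightarrow> ft Q x = 0"
      using pulse_annihilate_finite[OF N(1) q(1,2) _ \<epsilon> assms(1), of \<nu>] unfolding \<kappa>_def by metis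
    have B: "0 \<le> B" using q(2)[of 0] norm_ge_zero order_trans by blast
    have "real (card N) * \<epsilon> \<le> (real m + 1) * \<epsilon>"
      using N \<epsilon> by (intro mult_right_mono) auto
    also have "\<dots> = T - \<tau>" by (simp add: \<epsilon>_def)
    finally have "pulse T Q" by (intro pulse_mono[OF Q(1)]) simp
    moreover have "cmod (Q t) \<le> \<kappa> ^ m * B" for t
    proof -
      have "\<kappa> ^ card N * B \<le> \<kappa> ^ m * B"
        using N \<kappa> B by (intro mult_right_mono power_increasing) auto
      with Q(2)[of t] show ?thesis by linarith
    qed
    moreover have "ft Q x = (if x = \<nu> then 1 else 0)" if "x \<in> \<Lambda>" for x
      using that Q(3-5) q(3)[of x] by (cases "x \<in> N") (auto simp: N_def)
    ultimately show ?thesis by blast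
  qed
  then obtain q where "\<forall>\<nu>\<in>\<Lambda>. pulse T (q \<nu>) \<and> (\<forall>t. cmod (q \<nu> t) \<le> \<kappa> ^ m * B) \<and>
      (\<forall>x\<in>\<Lambda>. ft (q \<nu>) x = (if x = \<nu> then 1 else 0))"
    by metis
  with that show thesis by blast
qed

section \<open>Fourier coefficients of periodic distributions\<close>

lemma is_distribution_pairing: "is_distribution (pairing v)"
  using pairing[of v] by simp

lemmas pairing_add = is_distributionD(1)[OF is_distribution_pairing]
  and pairing_cmult = is_distributionD(2)[OF is_distribution_pairing]
  and pairing_tendsto = is_distributionD(3)[OF is_distribution_pairing]
  and pairing_non_test = is_distributionD(4)[OF is_distribution_pairing]

lemma pairing_sum:
  assumes "\<And>i. i \<in> I \<Longrightarrow> \<phi> i \<in> periodic_test"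
  shows "pairing v (\<lambda>x. \<Sum>i\<in>I. \<phi> i x) = (\<Sum>i\<in>I. pairing v (\<phi> i))"
proof -
  have zero: "pairing v (\<lambda>x. 0) = 0"
    using pairing_cmult[OF periodic_test_const[of 0], of v 0] by simp
  show ?thesis
    using assms
    by (induction I rule: infinite_finite_induct) (simp_all add: zero pairing_add periodic_test_sum)
qed

lemma pairing_diff:
  assumes "\<phi> \<in> periodic_test" "\<psi> \<in> periodic_test"
  shows "pairing v (\<lambda>x. \<phi> x - \<psi> x) = pairing v \<phi> - pairing v \<psi>"
  using pairing_add[OF assms(1) periodic_test_cmult[OF assms(2), of "-1"], of v]
    pairing_cmult[OF assms(2), of v "-1"] by simp

text \<open>Parseval's formula for an arbitrary distribution, from its continuity along the Fourier
  series of the test function. Only symmetric partial sums are claimed, as nothing is known yet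
  about the growth of the coefficients.\<close>

lemma pairing_fourier_series:
  assumes "\<phi> \<in> periodic_test"
  shows "(\<lambda>n. \<Sum>k\<in>{- int n..int n}. fourier_coeff v k * fcoef \<phi> k) \<longlonglongrightarrow> pairing v \<phi>"
proof -
  have "(\<lambda>n. pairing v (\<lambda>x. \<Sum>k\<in>{- int n..int n}. fcoef \<phi> (- k) / (2 * pi) * cexpi k x)) \<longlonglongrightarrow> pairing v \<phi>"
    using assms
    by (intro pairing_tendsto fourier_series_test_converges periodic_test_sum periodic_test_cmult periodic_test_cexpi)
  moreover have "pairing v (\<lambda>x. \<Sum>k\<in>{- int n..int n}. fcoef \<phi> (- k) / (2 * pi) * cexpi k x)
      = (\<Sum>k\<in>{- int n..int n}. fourier_coeff v k * fcoef \<phi> k)" for n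
  proof -
    have "pairing v (\<lambda>x. \<Sum>k\<in>{- int n..int n}. fcoef \<phi> (- k) / (2 * pi) * cexpi k x)
      = (\<Sum>k\<in>{- int n..int n}. fcoef \<phi> (- k) / (2 * pi) * pairing v (cexpi k))"
      by (subst pairing_sum) (simp_all only: pairing_cmult periodic_test_cexpi periodic_test_cmult)
    also have "\<dots> = (\<Sum>k\<in>{- int n..int n}. fourier_coeff v k * fcoef \<phi> k)"
      by (rule sum.reindex_bij_witness[of _ uminus uminus]) (auto simp: fourier_coeff_def)
    finally show ?thesis .
  qed
  ultimately show ?thesis by simp
qed

lemma pairing_has_sum:
  assumes "\<phi> \<in> periodic_test" "(\<lambda>k. fourier_coeff v k * fcoef \<phi> k) summable_on UNIV"
  shows "((\<lambda>k. fourier_coeff v k * fcoef \<phi> k) has_sum pairing v \<phi>) UNIV"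
proof -
  let ?f = "\<lambda>k. fourier_coeff v k * fcoef \<phi> k"
  have "(sum ?f \<longlongrightarrow> infsum ?f UNIV) (finite_subsets_at_top UNIV)"
    using assms(2) by (rule infsum_tendsto)
  then have "(\<lambda>n. sum ?f {- int n..int n}) \<longlonglongrightarrow> infsum ?f UNIV"
    by (rule filterlim_compose[OF _ filterlim_symmetric_intervals])
  then have "infsum ?f UNIV = pairing v \<phi>"
    using pairing_fourier_series[OF assms(1)] by (rule LIMSEQ_unique)
  with assms(2) show ?thesis by (simp add: has_sum_iff)
qed

lemma pdistr_eqI:
  assumes "\<And>k. fourier_coeff v k = fourier_coeff w k"
  shows "v = w"
proof -
  have "pairing v \<phi> = pairing w \<phi>" for \<phi>
  proof (cases "\<phi> \<in> periodic_test")
    case True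
    from pairing_fourier_series[OF this, of v] pairing_fourier_series[OF this, of w] assms
    show ?thesis by (simp add: LIMSEQ_unique)
  qed (simp add: pairing_non_test)
  then show ?thesis by (auto simp: fun_eq_iff simp flip: pairing_inject)
qed

lemma fourier_coeff_0 [simp]: "fourier_coeff 0 k = 0"
  by (simp add: fourier_coeff_def zero_pdistr.rep_eq)

lemma fourier_coeff_add [simp]: "fourier_coeff (v + w) k = fourier_coeff v k + fourier_coeff w k"
  by (simp add: fourier_coeff_def plus_pdistr.rep_eq add_divide_distrib)

lemma fourier_coeff_diff [simp]: "fourier_coeff (v - w) k = fourier_coeff v k - fourier_coeff w k"
  by (simp add: fourier_coeff_def minus_pdistr.rep_eq diff_divide_distrib)

lemma fourier_coeff_scaleR [simp]: "fourier_coeff (c *\<^sub>R v) k = c *\<^sub>R fourier_coeff v k"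
  by (simp add: fourier_coeff_def scaleR_pdistr.rep_eq scaleR_conv_of_real)

lemma fourier_coeff_cscale [simp]: "fourier_coeff (cscale c v) k = c * fourier_coeff v k"
  by (simp add: fourier_coeff_def cscale.rep_eq)

lemma fourier_coeff_distr_deriv [simp]: "fourier_coeff (distr_deriv v) k = \<i> * of_int k * fourier_coeff v k"
  by (simp only: fourier_coeff_def distr_deriv.rep_eq periodic_test_cexpi cexpi_deriv pairing_cmult if_True) simp

section \<open>Distributions with prescribed coefficients of polynomial growth\<close>

definition tempered_coeff :: "(int \<Rightarrow> complex) \<Rightarrow> bool" where
  "tempered_coeff c \<longleftrightarrow> (\<exists>K N. 0 \<le> K \<and> (\<forall>k. cmod (c k) \<le> K * (1 + \<bar>real_of_int k\<bar>) ^ N))"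

lemma tempered_times_rapid:
  assumes "0 \<le> K" "\<And>k. cmod (c k) \<le> K * (1 + \<bar>real_of_int k\<bar>) ^ N"
    and "\<And>k. cmod (d k) * (1 + \<bar>real_of_int k\<bar>) ^ (N + 2) \<le> C"
  shows "cmod (c k * d k) \<le> K * C * (1 / (1 + \<bar>real_of_int k\<bar>)\<^sup>2)"
proof -
  define b where "b = 1 + \<bar>real_of_int k\<bar>"
  have b: "0 < b" by (simp add: b_def)
  have "cmod (c k * d k) \<le> K * b ^ N * cmod (d k)"
    using assms(2)[of k] by (simp add: norm_mult mult_right_mono b_def)
  also have "\<dots> = K * (cmod (d k) * b ^ (N + 2)) * (1 / b\<^sup>2)"
    using b by (simp add: power_add power2_eq_square)
  also have "\<dots> \<le> K * C * (1 / b\<^sup>2)"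
    using assms(1) assms(3)[of k] unfolding b_def[symmetric]
    by (intro mult_right_mono mult_left_mono) auto
  finally show ?thesis by (simp add: b_def)
qed

lemma tempered_summable:
  assumes "tempered_coeff c" "\<phi> \<in> periodic_test"
  shows "(\<lambda>k. c k * fcoef \<phi> k) abs_summable_on UNIV"
proof -
  obtain K N where K: "0 \<le> K" "\<And>k. cmod (c k) \<le> K * (1 + \<bar>real_of_int k\<bar>) ^ N"
    using assms(1) by (auto simp: tempered_coeff_def)
  obtain C where C: "0 \<le> C" "\<And>k. cmod (fcoef \<phi> k) * (1 + \<bar>real_of_int k\<bar>) ^ (N + 2) \<le> C"
    using fcoef_decay_ex[OF assms(2)] by blast
  show ?thesis
    by (rule Infinite_Sum.abs_summable_on_comparison_test'[OF summable_on_cmult_right[OF summable_inverse_int_square, of "K * C"]])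
      (rule tempered_times_rapid[OF K C(2)])
qed

lemma fcoef_add: "\<phi> \<in> periodic_test \<Longrightarrow> \<psi> \<in> periodic_test \<Longrightarrow> fcoef (\<lambda>x. \<phi> x + \<psi> x) k = fcoef \<phi> k + fcoef \<psi> k"
  unfolding fcoef_def distrib_right
  by (intro integral_add integrable_continuous_real periodic_test_continuous periodic_test_mult periodic_test_cexpi)

lemma fcoef_diff: "\<phi> \<in> periodic_test \<Longrightarrow> \<psi> \<in> periodic_test \<Longrightarrow> fcoef (\<lambda>x. \<phi> x - \<psi> x) k = fcoef \<phi> k - fcoef \<psi> k"
  unfolding fcoef_def left_diff_distrib
  by (intro integral_diff integrable_continuous_real periodic_test_continuous periodic_test_mult periodic_test_cexpi)

lemma fcoef_cmult: "fcoef (\<lambda>x. c * \<phi> x) k = c * fcoef \<phi> k"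
  by (simp add: fcoef_def mult.assoc)

lemma fcoef_mult_cexpi: "fcoef (\<lambda>x. \<phi> x * cexpi l x) k = fcoef \<phi> (l + k)"
  by (simp add: fcoef_def mult.assoc cexpi_mult)

lemma vderiv_funpow_diff:
  assumes "\<phi> \<in> periodic_test" "\<psi> \<in> periodic_test"
  shows "(vderiv ^^ j) (\<lambda>x. \<phi> x - \<psi> x) = (\<lambda>x. (vderiv ^^ j) \<phi> x - (vderiv ^^ j) \<psi> x)"
proof -
  have "(vderiv ^^ j) (\<lambda>x. (\<phi> x - \<psi> x) + \<psi> x) = (\<lambda>x. (vderiv ^^ j) (\<lambda>x. \<phi> x - \<psi> x) x + (vderiv ^^ j) \<psi> x)"
    using assms by (intro vderiv_add_funpow periodic_test_diff)
  then show ?thesis by (simp add: fun_eq_iff)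
qed

text \<open>The distribution is defined by Parseval's formula. Decay of order N + 2 of the test
  coefficients beats growth of order N with a summable remainder, and the resulting bound involves
  only the suprema of \<phi> and of its derivative of order N + 2, which test convergence
  controls.\<close>

lemma tempered_coeff_realised:
  assumes "tempered_coeff c"
  obtains v where "\<And>k. fourier_coeff v k = c k"
proof -
  obtain K N where K: "0 \<le> K" "\<And>k. cmod (c k) \<le> K * (1 + \<bar>real_of_int k\<bar>) ^ N"
    using assms by (auto simp: tempered_coeff_def)
  define v where "v \<phi> = (if \<phi> \<in> periodic_test then \<Sum>\<^sub>\<infinity>k. c k * fcoef \<phi> k else 0)" for \<phi>
  define Z where "Z = (\<Sum>\<^sub>\<infinity>k. 1 / (1 + \<bar>real_of_int k\<bar>)\<^sup>2)"
  define D where "D = K * (2 ^ (N + 2) * 4 * pi) * Z"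
  have Z: "0 \<le> Z" unfolding Z_def by (intro infsum_nonneg) auto
  have D: "0 \<le> D" using K Z by (simp add: D_def)
  have s: "(\<lambda>k. c k * fcoef \<phi> k) summable_on UNIV" if "\<phi> \<in> periodic_test" for \<phi>
    using tempered_summable[OF assms that] by (rule Infinite_Sum.abs_summable_summable)
  have diff: "v \<phi> - v \<psi> = v (\<lambda>x. \<phi> x - \<psi> x)" if "\<phi> \<in> periodic_test" "\<psi> \<in> periodic_test" for \<phi> \<psi>
  proof -
    have "(\<Sum>\<^sub>\<infinity>k. c k * fcoef (\<lambda>x. \<phi> x - \<psi> x) k + c k * fcoef \<psi> k) =
        (\<Sum>\<^sub>\<infinity>k. c k * fcoef (\<lambda>x. \<phi> x - \<psi> x) k) + (\<Sum>\<^sub>\<infinity>k. c k * fcoef \<psi> k)"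
      using that by (intro infsum_add s periodic_test_diff)
    then show ?thesis
      using that by (simp add: v_def fcoef_diff periodic_test_diff algebra_simps)
  qed
  have bound: "cmod (v \<phi>) \<le> D * e"
    if "\<phi> \<in> periodic_test" "\<And>x. cmod (\<phi> x) \<le> e" "\<And>x. cmod ((vderiv ^^ (N + 2)) \<phi> x) \<le> e" for \<phi> e
  proof -
    let ?m = "\<lambda>k. K * (2 ^ (N + 2) * 4 * pi * e) * (1 / (1 + \<bar>real_of_int k\<bar>)\<^sup>2)"
    have le: "cmod (c k * fcoef \<phi> k) \<le> ?m k" for k
      by (rule tempered_times_rapid[OF K fcoef_decay[OF that]])
    have "cmod (v \<phi>) \<le> (\<Sum>\<^sub>\<infinity>k. cmod (c k * fcoef \<phi> k))"
      using that(1) tempered_summable[OF assms that(1)] by (simp add: v_def norm_infsum_bound)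
    also have "\<dots> \<le> infsum ?m UNIV"
      using le by (intro infsum_mono tempered_summable[OF assms that(1)] summable_on_cmult_right summable_inverse_int_square)
    also have "\<dots> = K * (2 ^ (N + 2) * 4 * pi * e) * Z"
      unfolding Z_def by (rule infsum_cmult_right')
    finally show ?thesis by (simp add: D_def mult_ac)
  qed
  have "is_distribution v"
  proof (rule is_distributionI)
    fix \<phi> \<psi> assume "\<phi> \<in> periodic_test" "\<psi> \<in> periodic_test"
    then show "v (\<lambda>x. \<phi> x + \<psi> x) = v \<phi> + v \<psi>"
      by (simp add: v_def periodic_test_add fcoef_add distrib_left infsum_add s)
  next
    fix a \<phi> assume "\<phi> \<in> periodic_test"
    then show "v (\<lambda>x. a * \<phi> x) = a * v \<phi>"
      by (simp add: v_def periodic_test_cmult fcoef_cmult mult.left_commute[of _ a] infsum_cmult_right')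
  next
    fix \<phi>s \<phi> assume \<phi>: "\<phi> \<in> periodic_test" and \<phi>s: "\<And>n. \<phi>s n \<in> periodic_test" and lim: "test_converges \<phi>s \<phi>"
    have ev: "\<forall>\<^sub>F n in sequentially. \<forall>x\<in>UNIV. dist ((vderiv ^^ j) (\<phi>s n) x) ((vderiv ^^ j) \<phi> x) < e" if "0 < e" for e j
      using lim that unfolding test_converges_def uniform_limit_iff by blast
    show "(\<lambda>n. v (\<phi>s n)) \<longlonglongrightarrow> v \<phi>"
    proof (rule tendstoI)
      fix \<epsilon> :: real assume \<epsilon>: "0 < \<epsilon>"
      define e where "e = \<epsilon> / (D + 1)"
      have e: "0 < e" using D \<epsilon> by (simp add: e_def)
      have De: "D * e < \<epsilon>" using D \<epsilon> by (simp add: e_def field_simps)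
      show "\<forall>\<^sub>F n in sequentially. dist (v (\<phi>s n)) (v \<phi>) < \<epsilon>"
        using ev[OF e, of 0] ev[OF e, of "N + 2"]
      proof eventually_elim
        case (elim n)
        have "cmod (v (\<lambda>x. \<phi>s n x - \<phi> x)) \<le> D * e"
        proof (rule bound)
          show "cmod (\<phi>s n x - \<phi> x) \<le> e" for x
            using elim(1) by (auto simp: dist_norm less_imp_le)
          show "cmod ((vderiv ^^ (N + 2)) (\<lambda>x. \<phi>s n x - \<phi> x) x) \<le> e" for x
            using elim(2) unfolding vderiv_funpow_diff[OF \<phi>s \<phi>] by (auto simp: dist_norm intro: less_imp_le)
        qed (intro periodic_test_diff \<phi>s \<phi>)
        with De show ?case by (simp add: dist_norm diff \<phi>s \<phi>)
      qed
    qed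
  next
    fix \<phi> :: "real \<Rightarrow> complex" assume "\<phi> \<notin> periodic_test"
    then show "v \<phi> = 0" by (simp add: v_def)
  qed
  then have p: "pairing (Abs_pdistr v) = v"
    by (simp add: Abs_pdistr_inverse)
  show thesis
  proof
    fix k
    have "(\<Sum>\<^sub>\<infinity>l. c l * fcoef (cexpi (- k)) l) = (\<Sum>\<^sub>\<infinity>l\<in>{k}. c l * fcoef (cexpi (- k)) l)"
      by (rule infsum_cong_neutral) (auto simp: fcoef_cexpi)
    then show "fourier_coeff (Abs_pdistr v) k = c k"
      by (simp add: fourier_coeff_def p v_def periodic_test_cexpi fcoef_cexpi)
  qed
qed

section \<open>Weighted square-summable coefficients and the propagator\<close>

definition l2_weighted :: "real \<Rightarrow> (int \<Rightarrow> complex) \<Rightarrow> bool" where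
  "l2_weighted s c \<longleftrightarrow> (\<lambda>k. sobolev_weight s k * (cmod (c k))\<^sup>2) summable_on UNIV"

lemma sobolev_iff_l2: "v \<in> sobolev s \<longleftrightarrow> l2_weighted s (fourier_coeff v)"
  by (simp add: sobolev_def l2_weighted_def)

lemma sobolev_weight_pos [simp]: "0 < sobolev_weight s k"
  by (simp add: sobolev_weight_def)

lemma sobolev_weight_nonneg [simp]: "0 \<le> sobolev_weight s k"
  by (simp add: sobolev_weight_def)

lemma sobolev_weight_eq_square: "sobolev_weight s k = ((1 + \<bar>real_of_int k\<bar>) powr s)\<^sup>2"
  by (simp add: sobolev_weight_def power2_eq_square flip: powr_add)

lemma l2_weighted_term_le:
  assumes "l2_weighted s c"
  shows "sobolev_weight s k * (cmod (c k))\<^sup>2 \<le> (\<Sum>\<^sub>\<infinity>k. sobolev_weight s k * (cmod (c k))\<^sup>2)"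
  using finite_sum_le_infsum[of "\<lambda>k. sobolev_weight s k * (cmod (c k))\<^sup>2" UNIV "{k}"] assms
  by (simp add: l2_weighted_def)

lemma l2_weighted_imp_tempered:
  assumes "l2_weighted s c"
  shows "tempered_coeff c"
proof -
  define S where "S = (\<Sum>\<^sub>\<infinity>k. sobolev_weight s k * (cmod (c k))\<^sup>2)"
  define N where "N = nat \<lceil>\<bar>s\<bar>\<rceil>"
  have S: "0 \<le> S" unfolding S_def by (intro infsum_nonneg) auto
  have sN: "- s \<le> real N" unfolding N_def by linarith
  have "cmod (c k) \<le> sqrt S * (1 + \<bar>real_of_int k\<bar>) ^ N" for k
  proof -
    define b where "b = 1 + \<bar>real_of_int k\<bar>"
    have b: "1 \<le> b" by (simp add: b_def)
    have "(b powr s * cmod (c k))\<^sup>2 \<le> S"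
      using l2_weighted_term_le[OF assms, of k] by (simp add: S_def sobolev_weight_eq_square power_mult_distrib b_def)
    then have 1: "b powr s * cmod (c k) \<le> sqrt S"
      by (rule real_le_rsqrt)
    have "cmod (c k) = b powr (- s) * (b powr s * cmod (c k))"
      using b by (simp flip: mult.assoc powr_add)
    also have "\<dots> \<le> b powr (- s) * sqrt S"
      using 1 by (intro mult_left_mono) auto
    also have "\<dots> \<le> b powr (real N) * sqrt S"
      using b S sN by (intro mult_right_mono powr_mono) auto
    also have "b powr (real N) = b ^ N" using b by (simp add: powr_realpow)
    finally show ?thesis by (simp add: b_def mult.commute)
  qed
  with S show ?thesis unfolding tempered_coeff_def by (intro exI[of _ "sqrt S"] exI[of _ N]) auto
qed

text \<open>If some distribution has the coefficients \<open>c\<close>, it is unique by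
  \<open>pdistr_eqI\<close> and is the one chosen; otherwise the value is arbitrary. States and
  controls are built from their coefficients in this way.\<close>

definition of_coeff :: "(int \<Rightarrow> complex) \<Rightarrow> pdistr" where
  "of_coeff c = (SOME v. \<forall>k. fourier_coeff v k = c k)"

lemma fourier_coeff_of_coeff:
  assumes "l2_weighted s c" shows "fourier_coeff (of_coeff c) = c"
proof -
  have "\<exists>v. \<forall>k. fourier_coeff v k = c k"
    using tempered_coeff_realised[OF l2_weighted_imp_tempered[OF assms]] by blast
  from someI_ex[OF this] show ?thesis by (auto simp: of_coeff_def)
qed

lemma of_coeff_in_sobolev: "l2_weighted s c \<Longrightarrow> of_coeff c \<in> sobolev s"
  by (simp add: sobolev_iff_l2 fourier_coeff_of_coeff)

lemma l2_weighted_comparison: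
  assumes "l2_weighted s c" "\<And>k. cmod (d k) \<le> B * cmod (c k)"
  shows "l2_weighted s d"
  unfolding l2_weighted_def
proof (rule summable_on_comparison_test)
  show "(\<lambda>k. B\<^sup>2 * (sobolev_weight s k * (cmod (c k))\<^sup>2)) summable_on UNIV"
    using assms(1) unfolding l2_weighted_def by (rule summable_on_cmult_right)
  show "sobolev_weight s k * (cmod (d k))\<^sup>2 \<le> B\<^sup>2 * (sobolev_weight s k * (cmod (c k))\<^sup>2)" for k
    using power_mono[OF assms(2)[of k], of 2] mult_left_mono[of "(cmod (d k))\<^sup>2" "(B * cmod (c k))\<^sup>2" "sobolev_weight s k"]
    by (simp add: power_mult_distrib mult_ac)
qed auto

text \<open>Justifies the definite description in \<open>propagator\<close>: the phases have modulus
  1, so the rotated sequence is again weighted square-summable and realised, and coefficients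
  determine a distribution.\<close>

lemma fourier_coeff_propagator:
  assumes "v \<in> sobolev s"
  shows "fourier_coeff (propagator a t v) k = cis (eigval a k * t) * fourier_coeff v k"
proof -
  define w where "w = of_coeff (\<lambda>k. cis (eigval a k * t) * fourier_coeff v k)"
  have "l2_weighted s (\<lambda>k. cis (eigval a k * t) * fourier_coeff v k)"
    using assms unfolding sobolev_iff_l2 by (rule l2_weighted_comparison[where B = 1]) (simp add: norm_mult)
  then have w: "fourier_coeff w k = cis (eigval a k * t) * fourier_coeff v k" for k
    by (simp add: w_def fourier_coeff_of_coeff)
  have e: "exp (\<i> * of_int k * of_real (a k) * of_real t) = cis (eigval a k * t)" for k
    by (simp add: cis_conv_exp eigval_def mult_ac)
  have "propagator a t v = w"
    unfolding propagator_def e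
  proof (rule the_equality)
    show "\<forall>k. fourier_coeff w k = cis (eigval a k * t) * fourier_coeff v k" using w by blast
    show "x = w" if "\<forall>k. fourier_coeff x k = cis (eigval a k * t) * fourier_coeff v k" for x
      using that w by (intro pdistr_eqI) simp
  qed
  with w show ?thesis by simp
qed

section \<open>The control operator as a matrix\<close>

abbreviation complexify :: "(real \<Rightarrow> real) \<Rightarrow> real \<Rightarrow> complex" where
  "complexify g \<equiv> (\<lambda>x. of_real (g x))"

text \<open>Entry (k, n) is the k-th Fourier coefficient of the image of exp(inx) under
  \<open>control_op g\<close>. The factor 1/(2 pi) is the normalisation of the coefficients; the
  rest is the covariance of exp(inx) and exp(ikx) under \<open>g\<close>.\<close>

definition ctrl_matrix :: "(real \<Rightarrow> real) \<Rightarrow> int \<Rightarrow> int \<Rightarrow> complex" where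
  "ctrl_matrix g k n = (fcoef (complexify g) (n - k) - fcoef (complexify g) (- k) * fcoef (complexify g) n) / (2 * pi)"

text \<open>The operator is transposed onto the exponential: the k-th coefficient pairs
  \<open>v\<close> with a smooth function whose coefficients are row \<open>k\<close>. Their rapid
  decay turns Parseval's formula into an absolutely convergent sum.\<close>

lemma ctrl_matrix_has_sum:
  assumes g: "complexify g \<in> periodic_test" and v: "tempered_coeff (fourier_coeff v)"
  shows "(\<lambda>n. ctrl_matrix g k n * fourier_coeff v n) abs_summable_on UNIV"
    and "((\<lambda>n. ctrl_matrix g k n * fourier_coeff v n) has_sum fourier_coeff (control_op g v) k) UNIV"
proof -
  let ?G = "complexify g"
  define \<phi> where "\<phi> x = ?G x * cexpi (- k) x - fcoef ?G (- k) * ?G x" for x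
  have \<phi>: "\<phi> \<in> periodic_test"
    unfolding \<phi>_def using g by (intro periodic_test_diff periodic_test_mult periodic_test_cmult periodic_test_cexpi)
  have M: "fcoef \<phi> n = 2 * pi * ctrl_matrix g k n" for n
    unfolding \<phi>_def using g
    by (subst fcoef_diff)
      (auto simp: ctrl_matrix_def fcoef_cmult fcoef_mult_cexpi periodic_test_mult periodic_test_cmult periodic_test_cexpi)
  have eq: "fourier_coeff v n * fcoef \<phi> n / (2 * pi) = ctrl_matrix g k n * fourier_coeff v n" for n
    by (simp add: M)
  have s: "(\<lambda>n. fourier_coeff v n * fcoef \<phi> n) abs_summable_on UNIV"
    by (rule tempered_summable[OF v \<phi>])
  have "(\<lambda>n. cmod (fourier_coeff v n * fcoef \<phi> n) * (1 / (2 * pi))) summable_on UNIV"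
    using s by (rule summable_on_cmult_left)
  then show "(\<lambda>n. ctrl_matrix g k n * fourier_coeff v n) abs_summable_on UNIV"
    unfolding eq[symmetric] by (simp only: norm_divide norm_of_real times_divide_eq_right mult_1_right) simp
  have "((\<lambda>n. fourier_coeff v n * fcoef \<phi> n * (1 / (2 * pi))) has_sum pairing v \<phi> * (1 / (2 * pi))) UNIV"
    by (rule has_sum_cmult_left[OF pairing_has_sum[OF \<phi> Infinite_Sum.abs_summable_summable[OF s]]])
  moreover have "pairing v \<phi> * (1 / (2 * pi)) = fourier_coeff (control_op g v) k"
  proof -
    have "pairing v \<phi> = pairing v (\<lambda>x. ?G x * cexpi (- k) x) - fcoef ?G (- k) * pairing v ?G"
      unfolding \<phi>_def using g
      by (simp only: pairing_diff pairing_cmult periodic_test_mult periodic_test_cmult periodic_test_cexpi)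
    moreover have "pairing (control_op g v) (cexpi (- k)) = pairing v (\<lambda>x. ?G x * cexpi (- k) x) - pairing v ?G * fcoef ?G (- k)"
      using g by (simp only: control_op_def Let_def minus_pdistr.rep_eq distr_mult.rep_eq cscale.rep_eq distr_of.rep_eq
          fcoef_def periodic_test_cexpi if_True simp_thms)
    ultimately show ?thesis by (simp add: fourier_coeff_def)
  qed
  ultimately show "((\<lambda>n. ctrl_matrix g k n * fourier_coeff v n) has_sum fourier_coeff (control_op g v) k) UNIV"
    using eq by simp
qed

text \<open>The first term depends on n - k and inherits the decay of the coefficients of
  \<open>g\<close>. In the product of means each factor decays in its own index, and 1 + |k - n| is
  at most (1 + |k|)(1 + |n|).\<close>

lemma ctrl_matrix_decay:
  assumes g: "complexify g \<in> periodic_test"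
  obtains \<kappa> where "0 \<le> \<kappa>" "\<And>k n. cmod (ctrl_matrix g k n) * (1 + \<bar>real_of_int (k - n)\<bar>) ^ N \<le> \<kappa>"
proof -
  obtain C where C: "0 \<le> C" "\<And>k. cmod (fcoef (complexify g) k) * (1 + \<bar>real_of_int k\<bar>) ^ N \<le> C"
    using fcoef_decay_ex[OF g] by blast
  have "cmod (ctrl_matrix g k n) * (1 + \<bar>real_of_int (k - n)\<bar>) ^ N \<le> (C + C * C) / (2 * pi)" for k n
  proof -
    define d where "d = (1 + \<bar>real_of_int (k - n)\<bar>) ^ N"
    let ?f = "fcoef (complexify g)"
    have d: "0 \<le> d" "d \<le> (1 + \<bar>real_of_int (- k)\<bar>) ^ N * (1 + \<bar>real_of_int n\<bar>) ^ N"
    proof -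
      have "1 + \<bar>real_of_int (k - n)\<bar> \<le> (1 + \<bar>real_of_int (- k)\<bar>) * (1 + \<bar>real_of_int n\<bar>)"
        by (simp add: algebra_simps abs_mult[symmetric])
      then show "d \<le> (1 + \<bar>real_of_int (- k)\<bar>) ^ N * (1 + \<bar>real_of_int n\<bar>) ^ N"
        unfolding d_def power_mult_distrib[symmetric] by (intro power_mono) auto
    qed (simp add: d_def)
    have 1: "cmod (?f (n - k)) * d \<le> C"
      using C(2)[of "n - k"] by (simp add: d_def abs_minus_commute)
    have "cmod (?f (- k) * ?f n) * d \<le> cmod (?f (- k) * ?f n) * ((1 + \<bar>real_of_int (- k)\<bar>) ^ N * (1 + \<bar>real_of_int n\<bar>) ^ N)"
      using d by (intro mult_left_mono) auto
    also have "\<dots> = (cmod (?f (- k)) * (1 + \<bar>real_of_int (- k)\<bar>) ^ N) * (cmod (?f n) * (1 + \<bar>real_of_int n\<bar>) ^ N)"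
      by (simp add: norm_mult)
    also have "\<dots> \<le> C * C"
      using C(1) C(2)[of "- k"] C(2)[of n] by (intro mult_mono) auto
    finally have 2: "cmod (?f (- k) * ?f n) * d \<le> C * C" .
    have "cmod (ctrl_matrix g k n) * d \<le> (cmod (?f (n - k)) + cmod (?f (- k) * ?f n)) / (2 * pi) * d"
      using d unfolding ctrl_matrix_def by (intro mult_right_mono) (auto simp: norm_divide intro!: divide_right_mono norm_triangle_ineq4)
    also have "\<dots> = (cmod (?f (n - k)) * d + cmod (?f (- k) * ?f n) * d) / (2 * pi)"
      by (simp add: distrib_right)
    also have "\<dots> \<le> (C + C * C) / (2 * pi)"
      using 1 2 by (intro divide_right_mono add_mono) auto
    finally show ?thesis by (simp add: d_def)
  qed
  moreover have "0 \<le> (C + C * C) / (2 * pi)" using C by simp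
  ultimately show thesis using that by blast
qed

section \<open>Boundedness of rapidly decaying matrices on weighted l2\<close>

text \<open>The two multiplicative hypotheses are symmetric in \<open>x\<close> and
  \<open>y\<close>, so a negative exponent is handled by exchanging their roles.\<close>

lemma powr_peetre:
  fixes x y z :: real
  assumes "1 \<le> x" "1 \<le> y" "1 \<le> z" "x \<le> y * z" "y \<le> x * z"
  shows "x powr s \<le> y powr s * z powr \<bar>s\<bar>"
proof (cases "0 \<le> s")
  case True
  then have "x powr s \<le> (y * z) powr s"
    using assms by (intro powr_mono2) auto
  with True assms show ?thesis by (simp add: powr_mult)
next
  case False
  then have "y powr (- s) \<le> (x * z) powr (- s)"
    using assms by (intro powr_mono2) auto
  then have "y powr (- s) \<le> x powr (- s) * z powr (- s)"
    using assms by (simp add: powr_mult)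
  then have "(x powr s * y powr s) * y powr (- s) \<le> (x powr s * y powr s) * (x powr (- s) * z powr (- s))"
    by (intro mult_left_mono) auto
  moreover have "(x powr s * y powr s) * y powr (- s) = x powr s"
    using assms by (simp add: mult.assoc flip: powr_add)
  moreover have "(x powr s * y powr s) * (x powr (- s) * z powr (- s)) = (x powr s * x powr (- s)) * (y powr s * z powr (- s))"
    by (simp add: mult_ac)
  moreover have "x powr s * x powr (- s) = 1"
    using assms by (simp flip: powr_add)
  ultimately show ?thesis using False by simp
qed

text \<open>Schur's test with the weights transported by Peetre's inequality.\<close>

lemma weighted_schur_test:
  fixes M :: "int \<Rightarrow> int \<Rightarrow> complex"
  assumes \<kappa>: "0 \<le> \<kappa>" "\<And>k n. cmod (M k n) * (1 + \<bar>real_of_int (k - n)\<bar>) ^ N \<le> \<kappa>"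
    and N: "\<bar>s\<bar> + 2 \<le> real N" and x: "l2_weighted s x"
    and y: "\<And>k. cmod (y k) \<le> (\<Sum>\<^sub>\<infinity>n. cmod (M k n * x n))"
  shows "l2_weighted s y"
    and "(\<Sum>\<^sub>\<infinity>k. sobolev_weight s k * (cmod (y k))\<^sup>2) \<le>
      (\<kappa> * (\<Sum>\<^sub>\<infinity>k. 1 / (1 + \<bar>real_of_int k\<bar>)\<^sup>2))\<^sup>2 * (\<Sum>\<^sub>\<infinity>k. sobolev_weight s k * (cmod (x k))\<^sup>2)"
proof -
  define p where "p k = 1 / (1 + \<bar>real_of_int k\<bar>)\<^sup>2" for k
  define Z where "Z = (\<Sum>\<^sub>\<infinity>k. p k)"
  define X where "X n = (1 + \<bar>real_of_int n\<bar>) powr s * cmod (x n)" for n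
  define S where "S = (\<Sum>\<^sub>\<infinity>n. (X n)\<^sup>2)"
  have X0: "0 \<le> X n" for n by (simp add: X_def)
  have X2: "sobolev_weight s n * (cmod (x n))\<^sup>2 = (X n)\<^sup>2" for n
    by (simp add: X_def sobolev_weight_eq_square power_mult_distrib)
  have sX: "(\<lambda>n. (X n)\<^sup>2) summable_on UNIV"
    using x by (simp add: l2_weighted_def X2)
  have p0: "0 \<le> p k" for k by (simp add: p_def)
  have sp: "p summable_on UNIV"
    using summable_inverse_int_square by (simp add: p_def[abs_def])
  have Z0: "0 \<le> Z" unfolding Z_def using p0 by (intro infsum_nonneg) auto
  have pZ: "(\<Sum>k\<in>F. p (j k)) \<le> Z" if "finite F" "inj_on j F" for F :: "int set" and j
  proof -
    have "(\<Sum>k\<in>F. p (j k)) = sum p (j ` F)" using that by (simp add: sum.reindex)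
    also have "\<dots> \<le> Z" unfolding Z_def using that sp p0 by (intro finite_sum_le_infsum) auto
    finally show ?thesis .
  qed
  have p1: "p k \<le> Z" for k using pZ[of "{k}" "\<lambda>k. k"] by simp
  \<comment> \<open>Of the decay of order \<open>N\<close>, the part |s| pays for moving the weight
    from \<open>n\<close> to \<open>k\<close>, and two further orders remain as the summable kernel
    \<open>p\<close>.\<close>
  have tm: "(1 + \<bar>real_of_int k\<bar>) powr s * cmod (M k n * x n) \<le> \<kappa> * (p (k - n) * X n)" for k n
  proof -
    define bk where "bk = 1 + \<bar>real_of_int k\<bar>"
    define bn where "bn = 1 + \<bar>real_of_int n\<bar>"
    define d where "d = 1 + \<bar>real_of_int (k - n)\<bar>"
    have ge: "1 \<le> bk" "1 \<le> bn" "1 \<le> d" by (simp_all add: bk_def bn_def d_def)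
    have "\<bar>real_of_int k\<bar> \<le> \<bar>real_of_int n\<bar> + \<bar>real_of_int (k - n)\<bar>" "\<bar>real_of_int n\<bar> \<le> \<bar>real_of_int k\<bar> + \<bar>real_of_int (k - n)\<bar>"
      by auto
    moreover have "0 \<le> \<bar>real_of_int n\<bar> * \<bar>real_of_int (k - n)\<bar>" "0 \<le> \<bar>real_of_int k\<bar> * \<bar>real_of_int (k - n)\<bar>"
      by auto
    ultimately have "bk \<le> bn * d" "bn \<le> bk * d"
      unfolding bk_def bn_def d_def distrib_left distrib_right by linarith+
    then have "bk powr s \<le> bn powr s * d powr \<bar>s\<bar>"
      using ge by (intro powr_peetre)
    then have "bk powr s * cmod (M k n) * d\<^sup>2 \<le> bn powr s * d powr \<bar>s\<bar> * cmod (M k n) * d\<^sup>2"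
      by (intro mult_right_mono) auto
    also have "\<dots> = bn powr s * (cmod (M k n) * (d powr \<bar>s\<bar> * d powr 2))"
      using ge by (simp add: powr_numeral)
    also have "\<dots> = bn powr s * (cmod (M k n) * d powr (\<bar>s\<bar> + 2))"
      by (simp add: powr_add)
    also have "\<dots> \<le> bn powr s * (cmod (M k n) * d powr (real N))"
      using N ge by (intro mult_left_mono powr_mono) auto
    also have "\<dots> \<le> bn powr s * \<kappa>"
      using \<kappa>(2)[of k n] ge by (intro mult_left_mono) (auto simp: powr_realpow d_def)
    finally have "bk powr s * cmod (M k n) \<le> bn powr s * \<kappa> / d\<^sup>2"
      using ge by (simp add: pos_le_divide_eq)
    then have "bk powr s * cmod (M k n) * cmod (x n) \<le> bn powr s * \<kappa> / d\<^sup>2 * cmod (x n)"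
      by (rule mult_right_mono) simp
    then show ?thesis
      by (simp add: norm_mult X_def p_def bk_def bn_def d_def mult_ac)
  qed
  define Q where "Q k = (\<Sum>\<^sub>\<infinity>n. p (k - n) * (X n)\<^sup>2)" for k
  have sQ: "(\<lambda>n. p (k - n) * (X n)\<^sup>2) summable_on UNIV" for k
    by (rule summable_on_comparison_test[OF summable_on_cmult_right[OF sX, of Z]])
      (use p0 p1 in \<open>auto intro!: mult_right_mono\<close>)
  have Q0: "0 \<le> Q k" for k unfolding Q_def using p0 by (intro infsum_nonneg) auto
  \<comment> \<open>Cauchy-Schwarz with the kernel split into two square roots; one factor sums to
    at most \<open>Z\<close>, the other is the averaged square \<open>Q\<close>.\<close>
  have finite_bound: "(\<Sum>n\<in>F. p (k - n) * X n) \<le> sqrt (Z * Q k)" if "finite F" for F k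
  proof (rule real_le_rsqrt)
    have "(\<Sum>n\<in>F. p (k - n) * X n)\<^sup>2 = (\<Sum>n\<in>F. sqrt (p (k - n)) * (sqrt (p (k - n)) * X n))\<^sup>2"
      using p0 by (simp flip: mult.assoc)
    also have "\<dots> \<le> (\<Sum>n\<in>F. (sqrt (p (k - n)))\<^sup>2) * (\<Sum>n\<in>F. (sqrt (p (k - n)) * X n)\<^sup>2)"
      by (rule Cauchy_Schwarz_ineq_sum)
    also have "\<dots> = (\<Sum>n\<in>F. p (k - n)) * (\<Sum>n\<in>F. p (k - n) * (X n)\<^sup>2)"
      using p0 by (simp add: power_mult_distrib)
    also have "\<dots> \<le> Z * Q k"
    proof (rule mult_mono)
      show "(\<Sum>n\<in>F. p (k - n)) \<le> Z" using that by (intro pZ) (auto simp: inj_on_def)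
      show "(\<Sum>n\<in>F. p (k - n) * (X n)\<^sup>2) \<le> Q k"
        unfolding Q_def using that sQ p0 by (intro finite_sum_le_infsum) auto
    qed (use Z0 p0 in \<open>auto intro!: sum_nonneg\<close>)
    finally show "(\<Sum>n\<in>F. p (k - n) * X n)\<^sup>2 \<le> Z * Q k" .
  qed
  have yk: "sobolev_weight s k * (cmod (y k))\<^sup>2 \<le> \<kappa>\<^sup>2 * (Z * Q k)" for k
  proof -
    define bk where "bk = (1 + \<bar>real_of_int k\<bar>) powr s"
    have bk: "0 < bk" by (simp add: bk_def)
    have fin: "(\<Sum>n\<in>F. cmod (M k n * x n)) \<le> \<kappa> * sqrt (Z * Q k) / bk" if "finite F" for F
    proof -
      have "bk * (\<Sum>n\<in>F. cmod (M k n * x n)) \<le> (\<Sum>n\<in>F. \<kappa> * (p (k - n) * X n))"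
        unfolding sum_distrib_left bk_def by (intro sum_mono tm)
      also have "\<dots> \<le> \<kappa> * sqrt (Z * Q k)"
        unfolding sum_distrib_left[symmetric] using that \<kappa>(1) by (intro mult_left_mono finite_bound)
      finally show ?thesis using bk by (simp add: pos_le_divide_eq mult.commute)
    qed
    have "cmod (y k) \<le> \<kappa> * sqrt (Z * Q k) / bk"
      using y[of k] summable_on_nonneg_bounded(2)[of UNIV "\<lambda>n. cmod (M k n * x n)", OF _ fin] by simp
    then have "bk * cmod (y k) \<le> \<kappa> * sqrt (Z * Q k)"
      using bk by (simp add: pos_le_divide_eq mult.commute)
    then have "(bk * cmod (y k))\<^sup>2 \<le> (\<kappa> * sqrt (Z * Q k))\<^sup>2"
      using bk by (intro power_mono) auto
    then show ?thesis
      using Z0 Q0 by (simp add: power_mult_distrib bk_def sobolev_weight_eq_square)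
  qed
  have total: "(\<Sum>k\<in>F. sobolev_weight s k * (cmod (y k))\<^sup>2) \<le> (\<kappa> * Z)\<^sup>2 * S" if F: "finite F" for F
  proof -
    have "(\<Sum>k\<in>F. sobolev_weight s k * (cmod (y k))\<^sup>2) \<le> (\<Sum>k\<in>F. \<kappa>\<^sup>2 * (Z * Q k))"
      by (intro sum_mono yk)
    also have "\<dots> = \<kappa>\<^sup>2 * (Z * (\<Sum>k\<in>F. Q k))"
      by (simp add: sum_distrib_left)
    finally have 1: "(\<Sum>k\<in>F. sobolev_weight s k * (cmod (y k))\<^sup>2) \<le> \<kappa>\<^sup>2 * (Z * (\<Sum>k\<in>F. Q k))" .
    have "(\<Sum>k\<in>F. Q k) = (\<Sum>\<^sub>\<infinity>n. \<Sum>k\<in>F. p (k - n) * (X n)\<^sup>2)"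
      unfolding Q_def by (rule infsum_sum[symmetric, OF F sQ])
    also have "\<dots> \<le> (\<Sum>\<^sub>\<infinity>n. Z * (X n)\<^sup>2)"
    proof (rule infsum_mono)
      show "(\<lambda>n. \<Sum>k\<in>F. p (k - n) * (X n)\<^sup>2) summable_on UNIV"
        by (rule summable_on_sum[OF F sQ])
      show "(\<lambda>n. Z * (X n)\<^sup>2) summable_on UNIV"
        using sX by (rule summable_on_cmult_right)
      show "(\<Sum>k\<in>F. p (k - n) * (X n)\<^sup>2) \<le> Z * (X n)\<^sup>2" for n
        unfolding sum_distrib_right[symmetric] using F by (intro mult_right_mono pZ) (auto simp: inj_on_def)
    qed
    also have "\<dots> = Z * S" unfolding S_def by (rule infsum_cmult_right')
    finally have "\<kappa>\<^sup>2 * (Z * (\<Sum>k\<in>F. Q k)) \<le> \<kappa>\<^sup>2 * (Z * (Z * S))"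
      using Z0 by (intro mult_left_mono) auto
    with 1 show ?thesis
      by (simp add: power_mult_distrib power2_eq_square mult_ac)
  qed
  show "l2_weighted s y"
    unfolding l2_weighted_def using total by (intro summable_on_nonneg_bounded(1)) auto
  show "(\<Sum>\<^sub>\<infinity>k. sobolev_weight s k * (cmod (y k))\<^sup>2) \<le>
      (\<kappa> * (\<Sum>\<^sub>\<infinity>k. 1 / (1 + \<bar>real_of_int k\<bar>)\<^sup>2))\<^sup>2 * (\<Sum>\<^sub>\<infinity>k. sobolev_weight s k * (cmod (x k))\<^sup>2)"
    using summable_on_nonneg_bounded(2)[of UNIV "\<lambda>k. sobolev_weight s k * (cmod (y k))\<^sup>2", OF _ total]
    by (simp add: X2 S_def Z_def p_def)
qed

section \<open>Sobolev norms\<close>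

text \<open>The Sobolev norm is the l2 norm of these components. On finite sets of modes it becomes
  an \<open>L2_set\<close>, to which Minkowski and Cauchy-Schwarz apply.\<close>

definition sob_comp :: "real \<Rightarrow> pdistr \<Rightarrow> int \<Rightarrow> real" where
  "sob_comp s v k = sqrt (2 * pi) * (1 + \<bar>real_of_int k\<bar>) powr s * cmod (fourier_coeff v k)"

lemma sob_comp_nonneg [simp]: "0 \<le> sob_comp s v k"
  by (simp add: sob_comp_def)

lemma sob_comp_square: "(sob_comp s v k)\<^sup>2 = 2 * pi * (sobolev_weight s k * (cmod (fourier_coeff v k))\<^sup>2)"
  by (simp add: sob_comp_def power_mult_distrib sobolev_weight_eq_square)

lemma sobolev_norm_nonneg [simp]: "0 \<le> sobolev_norm s v"
  by (simp add: sobolev_norm_def infsum_nonneg)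

lemma sobolev_norm_0 [simp]: "sobolev_norm s 0 = 0"
  by (simp add: sobolev_norm_def)

lemma sobolev_norm_minus_commute: "sobolev_norm s (v - w) = sobolev_norm s (w - v)"
  by (simp add: sobolev_norm_def norm_minus_commute)

lemma L2_set_le_sobolev_norm:
  assumes "v \<in> sobolev s" "finite F"
  shows "L2_set (sob_comp s v) F \<le> sobolev_norm s v"
proof -
  have "(\<Sum>k\<in>F. sobolev_weight s k * (cmod (fourier_coeff v k))\<^sup>2) \<le> (\<Sum>\<^sub>\<infinity>k. sobolev_weight s k * (cmod (fourier_coeff v k))\<^sup>2)"
    using assms by (intro finite_sum_le_infsum) (auto simp: sobolev_def)
  then show ?thesis
    by (simp add: L2_set_def sob_comp_square sobolev_norm_def flip: sum_distrib_left)
qed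

lemma sobolev_normI:
  assumes "\<And>F. finite F \<Longrightarrow> L2_set (sob_comp s v) F \<le> B"
  shows "v \<in> sobolev s" and "sobolev_norm s v \<le> B"
proof -
  have B: "0 \<le> B" using assms[of "{}"] by simp
  have bd: "(\<Sum>k\<in>F. sobolev_weight s k * (cmod (fourier_coeff v k))\<^sup>2) \<le> B\<^sup>2 / (2 * pi)" if "finite F" for F
  proof -
    have "sqrt (\<Sum>k\<in>F. (sob_comp s v k)\<^sup>2) \<le> B"
      using assms[OF that] by (simp add: L2_set_def)
    then have "(\<Sum>k\<in>F. (sob_comp s v k)\<^sup>2) \<le> B\<^sup>2"
      using B by (metis real_sqrt_le_iff real_sqrt_unique)
    then show ?thesis
      by (simp add: sob_comp_square pos_le_divide_eq mult.commute flip: sum_distrib_left)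
  qed
  show "v \<in> sobolev s"
    unfolding sobolev_def by (rule CollectI, rule summable_on_nonneg_bounded(1)[OF _ bd]) auto
  have "(\<Sum>\<^sub>\<infinity>k. sobolev_weight s k * (cmod (fourier_coeff v k))\<^sup>2) \<le> B\<^sup>2 / (2 * pi)"
    by (rule summable_on_nonneg_bounded(2)[OF _ bd]) auto
  then have "2 * pi * (\<Sum>\<^sub>\<infinity>k. sobolev_weight s k * (cmod (fourier_coeff v k))\<^sup>2) \<le> B\<^sup>2"
    by (simp add: pos_le_divide_eq mult.commute)
  then show "sobolev_norm s v \<le> B"
    unfolding sobolev_norm_def using B by (rule real_le_lsqrt[rotated])
qed

lemma
  assumes "v \<in> sobolev s" "w \<in> sobolev s"
  shows sobolev_add: "v + w \<in> sobolev s"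
    and sobolev_norm_triangle: "sobolev_norm s (v + w) \<le> sobolev_norm s v + sobolev_norm s w"
    and sobolev_diff: "v - w \<in> sobolev s"
    and sobolev_norm_triangle_diff: "sobolev_norm s (v - w) \<le> sobolev_norm s v + sobolev_norm s w"
proof -
  have *: "L2_set (sob_comp s u) F \<le> sobolev_norm s v + sobolev_norm s w"
    if "finite F" "\<And>k. cmod (fourier_coeff u k) \<le> cmod (fourier_coeff v k) + cmod (fourier_coeff w k)" for u F
  proof -
    have "L2_set (sob_comp s u) F \<le> L2_set (\<lambda>k. sob_comp s v k + sob_comp s w k) F"
      using that(2) by (intro L2_set_mono) (auto simp: sob_comp_def mult_left_mono simp flip: distrib_left)
    also have "\<dots> \<le> L2_set (sob_comp s v) F + L2_set (sob_comp s w) F"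
      by (rule L2_set_triangle_ineq)
    also have "\<dots> \<le> sobolev_norm s v + sobolev_norm s w"
      using that(1) assms by (intro add_mono L2_set_le_sobolev_norm)
    finally show ?thesis .
  qed
  have L: "L2_set (sob_comp s (v + w)) F \<le> sobolev_norm s v + sobolev_norm s w" if "finite F" for F
    using that by (rule *) (simp add: norm_triangle_ineq)
  show "v + w \<in> sobolev s" by (rule sobolev_normI(1)[OF L])
  show "sobolev_norm s (v + w) \<le> sobolev_norm s v + sobolev_norm s w" by (rule sobolev_normI(2)[OF L])
  have L': "L2_set (sob_comp s (v - w)) F \<le> sobolev_norm s v + sobolev_norm s w" if "finite F" for F
    using that by (rule *) (simp add: norm_triangle_ineq4)
  show "v - w \<in> sobolev s" by (rule sobolev_normI(1)[OF L'])
  show "sobolev_norm s (v - w) \<le> sobolev_norm s v + sobolev_norm s w" by (rule sobolev_normI(2)[OF L'])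
qed

lemma sobolev_norm_diff_le:
  assumes "u \<in> sobolev s" "v \<in> sobolev s" "w \<in> sobolev s"
  shows "sobolev_norm s (u - w) \<le> sobolev_norm s (u - v) + sobolev_norm s (v - w)"
  using sobolev_norm_triangle[of "u - v" s "v - w"] assms by (simp add: sobolev_diff)

lemma sobolev_norm_le_mult:
  assumes "v \<in> sobolev s" "\<And>k. cmod (fourier_coeff w k) \<le> B * cmod (fourier_coeff v k)" "0 \<le> B"
  shows "w \<in> sobolev s" and "sobolev_norm s w \<le> B * sobolev_norm s v"
proof -
  have L: "L2_set (sob_comp s w) F \<le> B * sobolev_norm s v" if "finite F" for F
  proof -
    have "sob_comp s w k \<le> B * sob_comp s v k" for k
      using mult_left_mono[OF assms(2)[of k], of "sqrt (2 * pi) * (1 + \<bar>real_of_int k\<bar>) powr s"]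
      by (simp add: sob_comp_def mult_ac)
    then have "L2_set (sob_comp s w) F \<le> L2_set (\<lambda>k. B * sob_comp s v k) F"
      by (intro L2_set_mono) auto
    also have "\<dots> = B * L2_set (sob_comp s v) F"
      using assms(3) by (rule L2_set_right_distrib[symmetric])
    also have "\<dots> \<le> B * sobolev_norm s v"
      using assms that by (intro mult_left_mono L2_set_le_sobolev_norm)
    finally show ?thesis .
  qed
  show "w \<in> sobolev s" by (rule sobolev_normI(1)[OF L])
  show "sobolev_norm s w \<le> B * sobolev_norm s v" by (rule sobolev_normI(2)[OF L])
qed

lemma fourier_coeff_le_sobolev_norm:
  obtains C where "0 < C" "\<And>v. v \<in> sobolev s \<Longrightarrow> cmod (fourier_coeff v k) \<le> C * sobolev_norm s v"
proof
  define c where "c = sqrt (2 * pi) * (1 + \<bar>real_of_int k\<bar>) powr s"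
  have c: "0 < c" by (simp add: c_def)
  show "0 < 1 / c" using c by simp
  fix v assume "v \<in> sobolev s"
  then have "c * cmod (fourier_coeff v k) \<le> sobolev_norm s v"
    using L2_set_le_sobolev_norm[of v s "{k}"] by (simp add: sob_comp_def c_def)
  then show "cmod (fourier_coeff v k) \<le> 1 / c * sobolev_norm s v"
    using c by (simp add: field_simps)
qed

text \<open>Domination by a single sequence upgrades continuity of each coefficient to continuity in the
  Sobolev norm.\<close>

definition dominated_family :: "real \<Rightarrow> real set \<Rightarrow> (real \<Rightarrow> pdistr) \<Rightarrow> bool" where
  "dominated_family s X u \<longleftrightarrow> (\<forall>k. continuous_on X (\<lambda>t. fourier_coeff (u t) k)) \<and>
     (\<exists>m. l2_weighted s m \<and> (\<forall>t\<in>X. \<forall>k. cmod (fourier_coeff (u t) k) \<le> cmod (m k)))"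

lemma dominated_family_subset: "dominated_family s X u \<Longrightarrow> Y \<subseteq> X \<Longrightarrow> dominated_family s Y u"
  unfolding dominated_family_def by (meson continuous_on_subset subset_iff)

lemma dominated_familyE:
  assumes "dominated_family s X u"
  obtains v where "v \<in> sobolev s" "\<And>t k. t \<in> X \<Longrightarrow> cmod (fourier_coeff (u t) k) \<le> cmod (fourier_coeff v k)"
proof -
  obtain m where m: "l2_weighted s m" "\<forall>t\<in>X. \<forall>k. cmod (fourier_coeff (u t) k) \<le> cmod (m k)"
    using assms by (auto simp: dominated_family_def)
  show thesis
    by (rule that[of "of_coeff m"]) (use m in \<open>auto simp: of_coeff_in_sobolev fourier_coeff_of_coeff\<close>)
qed

lemma dominated_family_sobolev: "dominated_family s X u \<Longrightarrow> t \<in> X \<Longrightarrow> u t \<in> sobolev s"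
  by (elim dominated_familyE, rule sobolev_norm_le_mult(1)[where B = 1]) auto

text \<open>The squared distance is a series of continuous functions of t. Both \<open>u t\<close>
  and \<open>w\<close> being dominated by \<open>v\<close>, its terms are at most four times those
  of the squared norm of \<open>v\<close>, so the M-test applies.\<close>

lemma continuous_on_sobolev_norm_diff:
  assumes u: "\<And>k. continuous_on X (\<lambda>t. fourier_coeff (u t) k)"
    and v: "v \<in> sobolev s" "\<And>t k. t \<in> X \<Longrightarrow> cmod (fourier_coeff (u t) k) \<le> cmod (fourier_coeff v k)"
    and w: "\<And>k. cmod (fourier_coeff w k) \<le> cmod (fourier_coeff v k)"
  shows "continuous_on X (\<lambda>t. sobolev_norm s (u t - w))"
proof -
  define f where "f k t = sobolev_weight s k * (cmod (fourier_coeff (u t) k - fourier_coeff w k))\<^sup>2" for k t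
  have "continuous_on X (\<lambda>t. \<Sum>\<^sub>\<infinity>k. f k t)"
  proof (rule continuous_on_infsum)
    show "continuous_on X (f k)" for k
      unfolding f_def by (intro continuous_intros u)
    show "norm (f k t) \<le> 4 * (sobolev_weight s k * (cmod (fourier_coeff v k))\<^sup>2)" if "t \<in> X" for k t
    proof -
      have "cmod (fourier_coeff (u t) k - fourier_coeff w k) \<le> 2 * cmod (fourier_coeff v k)"
        using v(2)[OF that, of k] w[of k] norm_triangle_ineq4[of "fourier_coeff (u t) k" "fourier_coeff w k"] by linarith
      then have "(cmod (fourier_coeff (u t) k - fourier_coeff w k))\<^sup>2 \<le> (2 * cmod (fourier_coeff v k))\<^sup>2"
        by (intro power_mono) auto
      then have "sobolev_weight s k * (cmod (fourier_coeff (u t) k - fourier_coeff w k))\<^sup>2 \<le> sobolev_weight s k * (2 * cmod (fourier_coeff v k))\<^sup>2"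
        by (intro mult_left_mono) auto
      then show ?thesis by (simp add: f_def power_mult_distrib)
    qed
    show "(\<lambda>k. 4 * (sobolev_weight s k * (cmod (fourier_coeff v k))\<^sup>2)) summable_on UNIV"
      using v(1) unfolding sobolev_def by (intro summable_on_cmult_right) simp
  qed
  then show ?thesis
    unfolding sobolev_norm_def by (auto simp: f_def intro!: continuous_intros)
qed

lemma dominated_family_dist:
  assumes u: "dominated_family s X u" and a: "a \<in> X"
  shows "continuous_on X (\<lambda>t. sobolev_norm s (u t - u a))"
proof -
  obtain v where v: "v \<in> sobolev s" "\<And>t k. t \<in> X \<Longrightarrow> cmod (fourier_coeff (u t) k) \<le> cmod (fourier_coeff v k)"
    using dominated_familyE[OF u] by blast
  show ?thesis
    by (rule continuous_on_sobolev_norm_diff[OF _ v v(2)[OF a]]) (use u in \<open>auto simp: dominated_family_def\<close>)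
qed

lemma dominated_family_norm:
  assumes u: "dominated_family s X u"
  shows "continuous_on X (\<lambda>t. sobolev_norm s (u t))"
proof -
  obtain v where v: "v \<in> sobolev s" "\<And>t k. t \<in> X \<Longrightarrow> cmod (fourier_coeff (u t) k) \<le> cmod (fourier_coeff v k)"
    using dominated_familyE[OF u] by blast
  have "continuous_on X (\<lambda>t. sobolev_norm s (u t - 0))"
    by (rule continuous_on_sobolev_norm_diff[OF _ v]) (use u in \<open>auto simp: dominated_family_def\<close>)
  then show ?thesis by simp
qed

lemma dominated_family_continuous:
  assumes u: "dominated_family s X u"
  shows "sobolev_continuous_on s X u"
  unfolding sobolev_continuous_on_def
proof (intro ballI conjI)
  fix t assume t: "t \<in> X"
  show "u t \<in> sobolev s" using u t by (rule dominated_family_sobolev)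
  show "((\<lambda>t'. sobolev_norm s (u t' - u t)) \<longlongrightarrow> 0) (at t within X)"
    using dominated_family_dist[OF u t] t by (auto simp: continuous_on_def)
qed

lemma dominated_family_bounded:
  assumes "dominated_family s X u"
  obtains B where "0 \<le> B" "\<And>t. t \<in> X \<Longrightarrow> sobolev_norm s (u t) \<le> B"
proof -
  obtain v where v: "v \<in> sobolev s" "\<And>t k. t \<in> X \<Longrightarrow> cmod (fourier_coeff (u t) k) \<le> cmod (fourier_coeff v k)"
    using dominated_familyE[OF assms] by blast
  have "sobolev_norm s (u t) \<le> 1 * sobolev_norm s v" if "t \<in> X" for t
    using v(2)[OF that] by (intro sobolev_norm_le_mult(2) v(1)) auto
  then show thesis using that[of "sobolev_norm s v"] by simp
qed

text \<open>The distance between \<open>u t\<close> and \<open>u t'\<close> is a continuous real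
  function on the compact square, hence uniformly continuous there. Comparison with the diagonal,
  where it vanishes, gives the claim.\<close>

lemma dominated_family_uniform:
  assumes u: "dominated_family s X u" and "compact X" "0 < e"
  obtains d where "0 < d" "\<And>t t'. t \<in> X \<Longrightarrow> t' \<in> X \<Longrightarrow> \<bar>t - t'\<bar> < d \<Longrightarrow> sobolev_norm s (u t - u t') < e"
proof -
  define \<rho> where "\<rho> p = sobolev_norm s (u (fst p) - u (snd p))" for p
  note mem = dominated_family_sobolev[OF u]
  have near: "\<exists>d>0. \<forall>t\<in>X. \<bar>t - a\<bar> < d \<longrightarrow> sobolev_norm s (u t - u a) < r" if "a \<in> X" "0 < r" for a r
    using dominated_family_dist[OF u that(1), unfolded continuous_on_iff, rule_format, OF that]
    by (simp add: dist_real_def)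
  have "continuous_on (X \<times> X) \<rho>"
    unfolding continuous_on_iff
  proof (intro ballI allI impI)
    fix p and r :: real assume p: "p \<in> X \<times> X" and r: "0 < r"
    obtain a b where ab: "p = (a, b)" "a \<in> X" "b \<in> X" using p by auto
    obtain d1 where d1: "0 < d1" "\<forall>t\<in>X. \<bar>t - a\<bar> < d1 \<longrightarrow> sobolev_norm s (u t - u a) < r / 2"
      using near[OF ab(2), of "r / 2"] r by auto
    obtain d2 where d2: "0 < d2" "\<forall>t\<in>X. \<bar>t - b\<bar> < d2 \<longrightarrow> sobolev_norm s (u t - u b) < r / 2"
      using near[OF ab(3), of "r / 2"] r by auto
    show "\<exists>d>0. \<forall>x'\<in>X \<times> X. dist x' p < d \<longrightarrow> dist (\<rho> x') (\<rho> p) < r"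
    proof (intro exI[of _ "min d1 d2"] conjI ballI impI)
      fix q assume q: "q \<in> X \<times> X" "dist q p < min d1 d2"
      obtain t t' where tt: "q = (t, t')" "t \<in> X" "t' \<in> X" using q by auto
      have "\<bar>t - a\<bar> < d1" "\<bar>t' - b\<bar> < d2"
        using q(2) dist_fst_le[of q p] dist_snd_le[of q p] by (auto simp: tt ab dist_real_def)
      then have 1: "sobolev_norm s (u t - u a) < r / 2" "sobolev_norm s (u t' - u b) < r / 2"
        using d1 d2 tt by auto
      have "sobolev_norm s (u t - u t') \<le> sobolev_norm s (u t - u a) + (sobolev_norm s (u a - u b) + sobolev_norm s (u b - u t'))"
        using sobolev_norm_diff_le[of "u t" s "u a" "u t'"] sobolev_norm_diff_le[of "u a" s "u b" "u t'"] mem tt ab by fastforce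
      moreover have "sobolev_norm s (u a - u b) \<le> sobolev_norm s (u a - u t) + (sobolev_norm s (u t - u t') + sobolev_norm s (u t' - u b))"
        using sobolev_norm_diff_le[of "u a" s "u t" "u b"] sobolev_norm_diff_le[of "u t" s "u t'" "u b"] mem tt ab by fastforce
      ultimately show "dist (\<rho> q) (\<rho> p) < r"
        using 1 sobolev_norm_minus_commute[of s "u t'" "u b"] sobolev_norm_minus_commute[of s "u t" "u a"]
        by (simp add: \<rho>_def tt ab dist_real_def)
    qed (use d1 d2 in auto)
  qed
  then have "uniformly_continuous_on (X \<times> X) \<rho>"
    using assms(2) by (intro compact_uniformly_continuous compact_Times)
  then obtain d where d: "0 < d" "\<forall>p\<in>X \<times> X. \<forall>q\<in>X \<times> X. dist q p < d \<longrightarrow> dist (\<rho> q) (\<rho> p) < e"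
    using assms(3) unfolding uniformly_continuous_on_def by blast
  show thesis
  proof
    show "0 < d" by (rule d)
    fix t t' assume t: "t \<in> X" "t' \<in> X" "\<bar>t - t'\<bar> < d"
    have "dist (t, t') (t, t) < d" using t by (simp add: dist_Pair_Pair dist_real_def)
    with d(2) t have "dist (\<rho> (t, t')) (\<rho> (t, t)) < e" by blast
    then show "sobolev_norm s (u t - u t') < e" by (simp add: \<rho>_def dist_real_def)
  qed
qed

section \<open>Integrals of dominated families\<close>

lemma norm_integral_lebesgue_on_le:
  fixes f :: "real \<Rightarrow> complex"
  assumes "0 \<le> t" "integrable (lebesgue_on {0..t}) f" "\<And>x. x \<in> {0..t} \<Longrightarrow> cmod (f x) \<le> B"
  shows "cmod (LINT x|lebesgue_on {0..t}. f x) \<le> B * t"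
proof -
  have "cmod (LINT x|lebesgue_on {0..t}. f x) \<le> (LINT x|lebesgue_on {0..t}. cmod (f x))"
    by (rule integral_norm_bound)
  also have "\<dots> \<le> (LINT x|lebesgue_on {0..t}. B)"
    using assms continuous_imp_integrable_real[of 0 t "\<lambda>_. B"] by (intro integral_mono) auto
  also have "\<dots> = B * t"
    using assms(1) lebesgue_integral_eq_integral[OF continuous_imp_integrable_real[of 0 t "\<lambda>_. B"]] by (simp add: mult.commute)
  finally show ?thesis .
qed

text \<open>Minkowski's integral inequality, by duality.\<close>

lemma L2_set_integral_le:
  assumes t: "0 \<le> t" and F: "finite F"
    and v: "\<And>k. fourier_coeff v k = (LINT x|lebesgue_on {0..t}. fourier_coeff (\<phi> x) k)"
    and int: "\<And>k. integrable (lebesgue_on {0..t}) (\<lambda>x. fourier_coeff (\<phi> x) k)"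
    and \<phi>: "\<And>x. x \<in> {0..t} \<Longrightarrow> \<phi> x \<in> sobolev s" "\<And>x. x \<in> {0..t} \<Longrightarrow> sobolev_norm s (\<phi> x) \<le> B"
  shows "L2_set (sob_comp s v) F \<le> B * t"
proof -
  define w where "w k = (sqrt (2 * pi) * (1 + \<bar>real_of_int k\<bar>) powr s)" for k
  define L where "L = L2_set (sob_comp s v) F"
  have w: "sob_comp s u k = w k * cmod (fourier_coeff u k)" "0 \<le> w k" for u k
    by (simp_all add: sob_comp_def w_def)
  have B: "0 \<le> B" using order_trans[OF sobolev_norm_nonneg \<phi>(2)[of 0]] t by simp
  have L: "0 \<le> L" by (simp add: L_def)
  \<comment> \<open>The dual vector is \<open>v\<close> itself on the modes in \<open>F\<close>: the
    integral of \<Phi> is L^2, while |\<Phi>| is at most L B, and one factor L cancels.\<close>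
  define \<Phi> where "\<Phi> x = (\<Sum>k\<in>F. of_real ((w k)\<^sup>2) * cnj (fourier_coeff v k) * fourier_coeff (\<phi> x) k)" for x
  have "complex_of_real (L\<^sup>2) = (\<Sum>k\<in>F. of_real ((w k)\<^sup>2) * cnj (fourier_coeff v k) * fourier_coeff v k)"
    by (simp add: L_def L2_set_def sum_nonneg w(1) power_mult_distrib complex_norm_square mult_ac del: of_real_power)
  also have "\<dots> = (LINT x|lebesgue_on {0..t}. \<Phi> x)"
    unfolding \<Phi>_def v[symmetric] using int by (subst Bochner_Integration.integral_sum) (simp_all add: v)
  finally have "L\<^sup>2 = cmod (LINT x|lebesgue_on {0..t}. \<Phi> x)"
    using L by (metis abs_of_nonneg norm_of_real zero_le_power)
  also have "\<dots> \<le> (L * B) * t"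
  proof (rule norm_integral_lebesgue_on_le[OF t])
    show "integrable (lebesgue_on {0..t}) \<Phi>"
      unfolding \<Phi>_def using int by (intro Bochner_Integration.integrable_sum integrable_mult_right) auto
    fix x assume x: "x \<in> {0..t}"
    have "cmod (\<Phi> x) \<le> (\<Sum>k\<in>F. sob_comp s v k * sob_comp s (\<phi> x) k)"
      unfolding \<Phi>_def by (rule order_trans[OF norm_sum]) (simp add: norm_mult w power2_eq_square mult_ac)
    also have "\<dots> \<le> L * L2_set (sob_comp s (\<phi> x)) F"
      unfolding L_def using L2_set_mult_ineq[of "sob_comp s v" "sob_comp s (\<phi> x)" F] by simp
    also have "\<dots> \<le> L * B"
      using L2_set_le_sobolev_norm[OF \<phi>(1)[OF x] F] \<phi>(2)[OF x] L by (intro mult_left_mono) auto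
    finally show "cmod (\<Phi> x) \<le> L * B" .
  qed
  finally have "L * L \<le> L * (B * t)" by (simp add: power2_eq_square mult_ac)
  then show ?thesis
    using L B t by (cases "L = 0") (auto simp: L_def[symmetric])
qed

lemma linear_fourier_coeff: "linear (\<lambda>v. fourier_coeff v k)"
  by (rule linearI) simp_all

lemma simple_function_step:
  "simple_function (lebesgue_on {0..t}) (\<lambda>x::real. f \<lfloor>(real n + 1) * x / t\<rfloor>)"
proof -
  let ?g = "\<lambda>x::real. \<lfloor>(real n + 1) * x / t\<rfloor>"
  have "(\<lambda>x::real. (real n + 1) * x / t) \<in> borel_measurable (lebesgue_on {0..t})"
  proof (rule continuous_imp_measurable_on_sets_lebesgue)
    show "continuous_on {0..t} (\<lambda>x. (real n + 1) * x / t)"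
      by (cases "t = 0") (auto intro!: continuous_intros)
  qed simp
  then have m: "?g \<in> measurable (lebesgue_on {0..t}) (count_space UNIV)"
    by (rule measurable_compose) (rule measurable_real_floor)
  have "?g ` {0..t} \<subseteq> {0..int n + 1}"
  proof clarify
    fix x assume x: "x \<in> {0..t}"
    then have "0 \<le> (real n + 1) * x / t" "(real n + 1) * x / t \<le> real n + 1"
      by (auto simp: divide_le_eq mult_left_mono)
    then show "?g x \<in> {0..int n + 1}" by (auto simp: floor_le_iff)
  qed
  then have "finite (?g ` {0..t})" by (rule finite_subset) simp
  then have "simple_function (lebesgue_on {0..t}) ?g"
    using measurable_sets[OF m] by (auto simp: simple_function_def)
  then show ?thesis by (rule simple_function_compose1)
qed

lemma fourier_coeff_simple_bochner_integral:
  assumes "Bochner_Integration.simple_bochner_integrable M F"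
  shows "fourier_coeff (Bochner_Integration.simple_bochner_integral M F) k = (LINT x|M. fourier_coeff (F x) k)"
    and "integrable M (\<lambda>x. fourier_coeff (F x) k)"
proof -
  have "Bochner_Integration.simple_bochner_integrable M (\<lambda>x. fourier_coeff (F x) k)"
    using simple_bochner_integrable_compose2[of "\<lambda>v _. fourier_coeff v k", OF _ assms assms] by simp
  then show "fourier_coeff (Bochner_Integration.simple_bochner_integral M F) k = (LINT x|M. fourier_coeff (F x) k)"
    "integrable M (\<lambda>x. fourier_coeff (F x) k)"
    using simple_bochner_integral_linear[OF linear_fourier_coeff[of k] assms]
    by (simp_all add: simple_bochner_integrable_eq_integral integrableI_simple_bochner_integrable)
qed

text \<open>Step functions sampling \<open>u\<close> at left grid points converge uniformly. Both
  limits required of the Sobolev integral follow, the second through Minkowski's inequality, so that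
  the integral is identified by its coefficients alone.\<close>

lemma dominated_family_has_integral:
  assumes u: "dominated_family s {0..t} u" and t: "0 \<le> t"
    and w: "\<And>k. fourier_coeff w k = integral {0..t} (\<lambda>x. fourier_coeff (u x) k)"
  shows "sobolev_measurable s (lebesgue_on {0..t}) u"
    and "has_sobolev_integral s (lebesgue_on {0..t}) u w"
proof -
  let ?M = "lebesgue_on {0..t}"
  have cont: "continuous_on {0..t} (\<lambda>x. fourier_coeff (u x) k)" for k
    using u by (simp add: dominated_family_def)
  have int: "integrable ?M (\<lambda>x. fourier_coeff (u x) k)" for k
    using cont by (rule continuous_imp_integrable_real)
  have w': "fourier_coeff w k = (LINT x|?M. fourier_coeff (u x) k)" for k
    using int by (simp add: w lebesgue_integral_eq_integral)
  note mem = dominated_family_sobolev[OF u]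
  obtain B where B: "0 \<le> B" "\<And>x. x \<in> {0..t} \<Longrightarrow> sobolev_norm s (u x) \<le> B"
    using dominated_family_bounded[OF u] by blast
  have w_mem: "w \<in> sobolev s"
    by (rule sobolev_normI(1)[OF L2_set_integral_le[OF t _ w' int mem B(2)]])
  \<comment> \<open>\<open>x\<close> rounded down to a multiple of t/(n + 1). For t = 0 the division
    by zero yields 0, the only point of the interval.\<close>
  define grid where "grid n x = t * of_int \<lfloor>(real n + 1) * x / t\<rfloor> / (real n + 1)" for n :: nat and x :: real
  define F where "F n x = u (grid n x)" for n :: nat and x :: real
  have grid: "grid n x \<in> {0..t}" "\<bar>x - grid n x\<bar> \<le> t / (real n + 1)" if "x \<in> {0..t}" for n x
  proof -
    define y where "y = (real n + 1) * x / t"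
    have y: "x = t * y / (real n + 1)" "0 \<le> y"
      using that by (auto simp: y_def)
    have fl: "0 \<le> real_of_int \<lfloor>y\<rfloor>" "real_of_int \<lfloor>y\<rfloor> \<le> y" "y < real_of_int \<lfloor>y\<rfloor> + 1"
      using y(2) by auto
    have gy: "grid n x = t * of_int \<lfloor>y\<rfloor> / (real n + 1)" by (simp add: grid_def y_def)
    have "grid n x \<le> x"
      unfolding gy by (subst y(1)) (use t fl in \<open>auto intro!: divide_right_mono mult_left_mono\<close>)
    moreover have "0 \<le> grid n x" unfolding gy using t fl by simp
    ultimately show "grid n x \<in> {0..t}" using that by auto
    have "x - grid n x = t * (y - of_int \<lfloor>y\<rfloor>) / (real n + 1)"
      unfolding gy by (subst y(1)) (simp add: right_diff_distrib diff_divide_distrib)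
    also have "y - of_int \<lfloor>y\<rfloor> \<le> 1" using fl by linarith
    then have "t * (y - of_int \<lfloor>y\<rfloor>) / (real n + 1) \<le> t * 1 / (real n + 1)"
      using t by (intro divide_right_mono mult_left_mono) auto
    finally show "\<bar>x - grid n x\<bar> \<le> t / (real n + 1)"
      using \<open>grid n x \<le> x\<close> by simp
  qed
  have sb: "Bochner_Integration.simple_bochner_integrable ?M (F n)" for n
  proof (rule simple_bochner_integrable.intros)
    show "simple_function ?M (F n)"
      unfolding F_def grid_def by (rule simple_function_step[of t "\<lambda>j. u (t * of_int j / (real n + 1))" n])
    have "emeasure ?M {y \<in> space ?M. F n y \<noteq> 0} \<le> emeasure ?M (space ?M)"
      by (rule emeasure_space)
    also have "emeasure ?M (space ?M) < \<infinity>"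
      using t by (simp add: emeasure_restrict_space)
    finally show "emeasure ?M {y \<in> space ?M. F n y \<noteq> 0} \<noteq> \<infinity>" by simp
  qed
  have simple: "sobolev_simple s ?M (F n)" for n
    using sb mem grid by (auto simp: sobolev_simple_def F_def)
  have unif: "\<forall>\<^sub>F n in sequentially. \<forall>x\<in>{0..t}. sobolev_norm s (u x - F n x) < e" if e0: "0 < e" for e
  proof -
    obtain d where d: "0 < d" "\<And>x y. x \<in> {0..t} \<Longrightarrow> y \<in> {0..t} \<Longrightarrow> \<bar>x - y\<bar> < d \<Longrightarrow> sobolev_norm s (u x - u y) < e"
      using dominated_family_uniform[OF u compact_Icc e0] by blast
    obtain N where N: "t / d < real N" using reals_Archimedean2 by blast
    have "\<forall>n\<ge>N. \<forall>x\<in>{0..t}. sobolev_norm s (u x - F n x) < e"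
    proof (intro allI impI ballI)
      fix n x assume n: "N \<le> n" and x: "x \<in> {0..t}"
      have "t / d < real n + 1" using N n by linarith
      then have "t / (real n + 1) < d" using d(1) by (simp add: field_simps)
      with grid(2)[OF x, of n] have "\<bar>x - grid n x\<bar> < d" by linarith
      then show "sobolev_norm s (u x - F n x) < e"
        unfolding F_def using x grid(1)[OF x] by (intro d(2))
    qed
    then show ?thesis unfolding eventually_sequentially by blast
  qed
  show meas: "sobolev_measurable s ?M u"
    unfolding sobolev_measurable_def
  proof (intro conjI exI[of _ F] allI simple)
    show "\<forall>x\<in>space ?M. u x \<in> sobolev s" using mem by simp
    have "(\<lambda>n. sobolev_norm s (u x - F n x)) \<longlonglongrightarrow> 0" if "x \<in> {0..t}" for x
    proof (rule tendstoI)
      fix e :: real assume "0 < e"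
      from unif[OF this] show "\<forall>\<^sub>F n in sequentially. dist (sobolev_norm s (u x - F n x)) 0 < e"
        by (rule eventually_mono) (use that in auto)
    qed
    then show "AE x in ?M. (\<lambda>n. sobolev_norm s (u x - F n x)) \<longlonglongrightarrow> 0"
      by (intro AE_I2) simp
  qed
  have lim1: "(\<lambda>n. \<integral>\<^sup>+x. ennreal (sobolev_norm s (u x - F n x)) \<partial>?M) \<longlonglongrightarrow> 0"
  proof (rule order_tendstoI)
    fix a :: ennreal assume a: "0 < a"
    \<comment> \<open>\<open>a\<close> may be infinite; an intermediate \<open>b\<close> is finite
      and supplies a real tolerance.\<close>
    obtain b where b: "0 < b" "b < a" using dense[OF a] by blast
    then have "b < top" by (meson less_le_trans top_greatest)
    then have r: "0 < enn2real b" "ennreal (enn2real b) < a"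
      using b by (simp_all add: enn2real_positive_iff)
    define r where "r = enn2real b"
    note r = r[folded r_def]
    define e where "e = r / (t + 1)"
    have e: "0 < e" "e * t \<le> r" using r t by (auto simp: e_def field_simps)
    show "\<forall>\<^sub>F n in sequentially. (\<integral>\<^sup>+x. ennreal (sobolev_norm s (u x - F n x)) \<partial>?M) < a"
      using unif[OF e(1)]
    proof eventually_elim
      case (elim n)
      have "(\<integral>\<^sup>+x. ennreal (sobolev_norm s (u x - F n x)) \<partial>?M) \<le> (\<integral>\<^sup>+x. ennreal e \<partial>?M)"
        using elim by (intro nn_integral_mono) (auto intro!: ennreal_leI simp: less_imp_le)
      also have "\<dots> = ennreal (e * t)"
        using e t by (simp add: emeasure_restrict_space ennreal_mult)
      also have "\<dots> \<le> ennreal r" using e by (intro ennreal_leI)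
      finally show ?case using r(2) by (rule le_less_trans)
    qed
  qed simp
  have lim2: "(\<lambda>n. sobolev_norm s (Bochner_Integration.simple_bochner_integral ?M (F n) - w)) \<longlonglongrightarrow> 0"
  proof (rule tendstoI)
    fix r :: real assume r: "0 < r"
    define e where "e = r / (t + 1)"
    have e: "0 < e" "e * t < r" using r t by (auto simp: e_def field_simps)
    show "\<forall>\<^sub>F n in sequentially. dist (sobolev_norm s (Bochner_Integration.simple_bochner_integral ?M (F n) - w)) 0 < r"
      using unif[OF e(1)]
    proof eventually_elim
      case (elim n)
      let ?v = "Bochner_Integration.simple_bochner_integral ?M (F n) - w"
      note fc = fourier_coeff_simple_bochner_integral[OF sb[of n]]
      have "L2_set (sob_comp s ?v) K \<le> e * t" if "finite K" for K
      proof (rule L2_set_integral_le[OF t that, where \<phi> = "\<lambda>x. F n x - u x"])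
        show "integrable ?M (\<lambda>x. fourier_coeff (F n x - u x) k)" for k
          using fc(2) int by simp
        show "fourier_coeff ?v k = (LINT x|?M. fourier_coeff (F n x - u x) k)" for k
          using fc int by (simp add: w')
        show "F n x - u x \<in> sobolev s" if "x \<in> {0..t}" for x
          unfolding F_def using that grid(1)[OF that] by (intro sobolev_diff mem)
        show "sobolev_norm s (F n x - u x) \<le> e" if "x \<in> {0..t}" for x
          using elim that by (subst sobolev_norm_minus_commute) (auto intro: less_imp_le)
      qed
      then have "sobolev_norm s ?v \<le> e * t" by (rule sobolev_normI(2))
      with e show ?case by simp
    qed
  qed
  show "has_sobolev_integral s ?M u w"
    unfolding has_sobolev_integral_def using meas w_mem simple lim1 lim2 by blast
qed

lemma dominated_family_measurable:
  assumes u: "dominated_family s {0..t} u" and t: "0 \<le> t"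
  shows "sobolev_measurable s (lebesgue_on {0..t}) u"
proof -
  obtain m where m: "l2_weighted s m" "\<forall>x\<in>{0..t}. \<forall>k. cmod (fourier_coeff (u x) k) \<le> cmod (m k)"
    using u by (auto simp: dominated_family_def)
  have c: "continuous_on {0..t} (\<lambda>x. fourier_coeff (u x) k)" for k
    using u by (simp add: dominated_family_def)
  have "cmod (integral {0..t} (\<lambda>x. fourier_coeff (u x) k)) \<le> cmod (m k) * (t - 0)" for k
    using t c m(2) by (intro integral_bound) auto
  then have "l2_weighted s (\<lambda>k. integral {0..t} (\<lambda>x. fourier_coeff (u x) k))"
    by (intro l2_weighted_comparison[OF m(1), of _ t]) (simp add: mult.commute)
  then show ?thesis
    by (intro dominated_family_has_integral(1)[OF u t, where w = "of_coeff (\<lambda>k. integral {0..t} (\<lambda>x. fourier_coeff (u x) k))"])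
      (simp add: fourier_coeff_of_coeff)
qed

section \<open>Coefficients of an abstract Sobolev integral\<close>

text \<open>Argued on the simple functions below the integrand, since the inequality is wanted for
  the distances to an arbitrary integrand, which come without measurability.\<close>

lemma nn_integral_cmult_le:
  assumes "0 < C"
  shows "(\<integral>\<^sup>+x. ennreal C * f x \<partial>M) \<le> ennreal C * (\<integral>\<^sup>+x. f x \<partial>M)"
  unfolding nn_integral_def[of M "\<lambda>x. ennreal C * f x"]
proof (rule SUP_least)
  fix g assume g: "g \<in> {g. simple_function M g \<and> g \<le> (\<lambda>x. ennreal C * f x)}"
  define g' where "g' x = ennreal (1 / C) * g x" for x
  have inv: "ennreal C * ennreal (1 / C) = 1" "ennreal (1 / C) * ennreal C = 1"
    using assms by (simp_all flip: ennreal_mult)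
  have sg: "simple_function M g" and le: "\<And>x. g x \<le> ennreal C * f x"
    using g by (auto simp: le_fun_def)
  have sg': "simple_function M g'"
    unfolding g'_def using sg by (rule simple_function_compose1)
  have "g' x \<le> f x" for x
  proof -
    have "g' x \<le> ennreal (1 / C) * (ennreal C * f x)"
      unfolding g'_def by (intro mult_left_mono le) simp
    also have "\<dots> = f x" by (simp add: inv flip: mult.assoc)
    finally show ?thesis .
  qed
  then have "integral\<^sup>N M g' \<le> integral\<^sup>N M f"
    by (intro nn_integral_mono)
  then have 1: "integral\<^sup>S M g' \<le> integral\<^sup>N M f"
    using sg' by (simp add: nn_integral_eq_simple_integral)
  have "g = (\<lambda>x. ennreal C * g' x)"
    by (simp add: g'_def inv fun_eq_iff flip: mult.assoc)
  then have "integral\<^sup>S M g = ennreal C * integral\<^sup>S M g'"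
    using simple_integral_mult[OF sg', of "ennreal C"] by simp
  also have "\<dots> \<le> ennreal C * (\<integral>\<^sup>+x. f x \<partial>M)"
    using 1 by (intro mult_left_mono) auto
  finally show "integral\<^sup>S M g \<le> ennreal C * (\<integral>\<^sup>+x. f x \<partial>M)" .
qed

lemma sobolev_0: "0 \<in> sobolev s"
  by (simp add: sobolev_def)

lemma sobolev_scaleR: "v \<in> sobolev s \<Longrightarrow> c *\<^sub>R v \<in> sobolev s"
  by (rule sobolev_norm_le_mult(1)[where B = "\<bar>c\<bar>"]) auto

lemma sobolev_sum: "(\<And>i. i \<in> I \<Longrightarrow> f i \<in> sobolev s) \<Longrightarrow> (\<Sum>i\<in>I. f i) \<in> sobolev s"
  by (induction I rule: infinite_finite_induct) (auto simp: sobolev_0 sobolev_add)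

text \<open>A coefficient is a bounded functional on H^s and so passes through the approximating
  simple functions. Uniqueness of mild solutions thereby becomes uniqueness of scalar
  integrals.\<close>

lemma has_sobolev_integral_fourier_coeff:
  assumes "has_sobolev_integral s M u w" "(\<lambda>x. fourier_coeff (u x) k) \<in> borel_measurable M"
  shows "has_bochner_integral M (\<lambda>x. fourier_coeff (u x) k) (fourier_coeff w k)"
proof -
  obtain F where F: "\<And>n. sobolev_simple s M (F n)"
    "(\<lambda>n. \<integral>\<^sup>+x. ennreal (sobolev_norm s (u x - F n x)) \<partial>M) \<longlonglongrightarrow> 0"
    "(\<lambda>n. sobolev_norm s (Bochner_Integration.simple_bochner_integral M (F n) - w)) \<longlonglongrightarrow> 0"
    and w: "w \<in> sobolev s" and u: "\<And>x. x \<in> space M \<Longrightarrow> u x \<in> sobolev s"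
    using assms(1) by (auto simp: has_sobolev_integral_def sobolev_measurable_def)
  obtain C where C: "0 < C" "\<And>v. v \<in> sobolev s \<Longrightarrow> cmod (fourier_coeff v k) \<le> C * sobolev_norm s v"
    using fourier_coeff_le_sobolev_norm[of s k] by blast
  have sb: "Bochner_Integration.simple_bochner_integrable M (F n)" and Fm: "\<And>x. x \<in> space M \<Longrightarrow> F n x \<in> sobolev s" for n
    using F(1) by (auto simp: sobolev_simple_def)
  show ?thesis
  proof (rule has_bochner_integral.intros[of _ _ "\<lambda>n x. fourier_coeff (F n x) k"])
    show "Bochner_Integration.simple_bochner_integrable M (\<lambda>x. fourier_coeff (F n x) k)" for n
      using simple_bochner_integrable_compose2[of "\<lambda>v _. fourier_coeff v k", OF _ sb sb] by simp
    show "(\<lambda>n. \<integral>\<^sup>+x. ennreal (cmod (fourier_coeff (u x) k - fourier_coeff (F n x) k)) \<partial>M) \<longlonglongrightarrow> 0"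
    proof (rule tendsto_sandwich[OF _ _ tendsto_const])
      show "\<forall>\<^sub>F n in sequentially. (\<integral>\<^sup>+x. ennreal (cmod (fourier_coeff (u x) k - fourier_coeff (F n x) k)) \<partial>M) \<le>
          (\<integral>\<^sup>+x. ennreal C * ennreal (sobolev_norm s (u x - F n x)) \<partial>M)"
      proof (intro always_eventually allI nn_integral_mono)
        fix n x assume x: "x \<in> space M"
        have "cmod (fourier_coeff (u x) k - fourier_coeff (F n x) k) \<le> C * sobolev_norm s (u x - F n x)"
          using C(2)[OF sobolev_diff[OF u[OF x] Fm[OF x]]] by simp
        then show "ennreal (cmod (fourier_coeff (u x) k - fourier_coeff (F n x) k)) \<le> ennreal C * ennreal (sobolev_norm s (u x - F n x))"
          using C(1) by (simp add: ennreal_leI flip: ennreal_mult)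
      qed
      have lim: "(\<lambda>n. ennreal C * (\<integral>\<^sup>+x. ennreal (sobolev_norm s (u x - F n x)) \<partial>M)) \<longlonglongrightarrow> ennreal C * 0"
        by (rule ennreal_tendsto_cmult[OF _ F(2)]) simp
      have le: "(\<integral>\<^sup>+x. ennreal C * ennreal (sobolev_norm s (u x - F n x)) \<partial>M) \<le>
          ennreal C * (\<integral>\<^sup>+x. ennreal (sobolev_norm s (u x - F n x)) \<partial>M)" for n
        using C(1) by (rule nn_integral_cmult_le)
      show "(\<lambda>n. \<integral>\<^sup>+x. ennreal C * ennreal (sobolev_norm s (u x - F n x)) \<partial>M) \<longlonglongrightarrow> 0"
        by (rule tendsto_sandwich[OF _ always_eventually[OF allI[OF le]] tendsto_const lim[unfolded mult_zero_right]]) simp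
    qed simp
    show "(\<lambda>n. Bochner_Integration.simple_bochner_integral M (\<lambda>x. fourier_coeff (F n x) k)) \<longlonglongrightarrow> fourier_coeff w k"
    proof (rule LIM_zero_cancel, rule Lim_null_comparison)
      have "Bochner_Integration.simple_bochner_integral M (F n) \<in> sobolev s" for n
        unfolding simple_bochner_integral_def by (intro sobolev_sum sobolev_scaleR) (use Fm in auto)
      then show "\<forall>\<^sub>F n in sequentially. cmod (Bochner_Integration.simple_bochner_integral M (\<lambda>x. fourier_coeff (F n x) k) - fourier_coeff w k) \<le>
          C * sobolev_norm s (Bochner_Integration.simple_bochner_integral M (F n) - w)"
        using C(2)[OF sobolev_diff[OF _ w]] simple_bochner_integral_linear[OF linear_fourier_coeff[of k] sb]
        by (intro always_eventually) simp
      show "(\<lambda>n. C * sobolev_norm s (Bochner_Integration.simple_bochner_integral M (F n) - w)) \<longlonglongrightarrow> 0"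
        using tendsto_mult_left[OF F(3), of C] by simp
    qed
  qed (rule assms(2))
qed

section \<open>Solvability on the eigenspaces\<close>

text \<open>Elimination of one index at a time. The hypothesis covers all principal submatrices so
  that it descends to the smaller block and also excludes a zero pivot.\<close>

lemma solvable_if_principal_injective:
  fixes M :: "'i \<Rightarrow> 'i \<Rightarrow> complex"
  assumes "finite I"
    and "\<And>I' x. I' \<subseteq> I \<Longrightarrow> (\<And>k. k \<in> I' \<Longrightarrow> (\<Sum>n\<in>I'. M k n * x n) = 0) \<Longrightarrow> \<forall>n\<in>I'. x n = 0"
  shows "\<exists>h. \<forall>k\<in>I. (\<Sum>n\<in>I. M k n * h n) = c k"
  using assms
proof (induction I arbitrary: c rule: finite_induct)
  case (insert p I)
  have IH: "\<exists>h. \<forall>k\<in>I. (\<Sum>n\<in>I. M k n * h n) = c k" for c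
  proof (rule insert.IH)
    show "\<forall>n\<in>I'. x n = 0" if "I' \<subseteq> I" "\<And>k. k \<in> I' \<Longrightarrow> (\<Sum>n\<in>I'. M k n * x n) = 0" for I' x
      using that by (intro insert.prems) auto
  qed
  obtain z where z: "\<forall>k\<in>I. (\<Sum>n\<in>I. M k n * z n) = M k p" using IH[of "\<lambda>k. M k p"] by blast
  obtain x where x: "\<forall>k\<in>I. (\<Sum>n\<in>I. M k n * x n) = c k" using IH[of c] by blast
  \<comment> \<open>The elimination vector for \<open>p\<close>: its entry at \<open>p\<close> is 1
    and all rows in \<open>I\<close> annihilate it.\<close>
  define y where "y n = (if n = p then 1 else - z n)" for n
  have split: "(\<Sum>n\<in>insert p I. M k n * f n) = M k p * f p + (\<Sum>n\<in>I. M k n * f n)" for k f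
    using insert.hyps by simp
  have yI: "(\<Sum>n\<in>I. M k n * y n) = - (\<Sum>n\<in>I. M k n * z n)" for k
    unfolding sum_negf[symmetric] using insert.hyps by (intro sum.cong) (auto simp: y_def)
  have My: "(\<Sum>n\<in>insert p I. M k n * y n) = 0" if "k \<in> I" for k
    using z that by (simp only: split yI) (simp add: y_def)
  \<comment> \<open>The Schur complement of the block on \<open>I\<close>. If it were 0,
    \<open>y\<close> would be a nonzero kernel vector of the enlarged block.\<close>
  define d where "d = (\<Sum>n\<in>insert p I. M p n * y n)"
  have d: "d \<noteq> 0"
  proof
    assume "d = 0"
    then have "\<forall>n\<in>insert p I. y n = 0"
      using My by (intro insert.prems) (auto simp: d_def simp del: sum.insert)
    then show False by (simp add: y_def)
  qed
  define x' where "x' n = (if n = p then 0 else x n)" for n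
  have x'I: "(\<Sum>n\<in>insert p I. M k n * x' n) = (\<Sum>n\<in>I. M k n * x n)" for k
    using insert.hyps by (simp add: x'_def) (intro sum.cong; auto simp: x'_def)
  define r where "r = (c p - (\<Sum>n\<in>I. M p n * x n)) / d"
  have "(\<Sum>n\<in>insert p I. M k n * (x' n + r * y n)) = (\<Sum>n\<in>I. M k n * x n) + r * (\<Sum>n\<in>insert p I. M k n * y n)" for k
    unfolding x'I[symmetric] by (simp add: distrib_left sum.distrib sum_distrib_left mult.left_commute del: sum.insert)
  then have "\<forall>k\<in>insert p I. (\<Sum>n\<in>insert p I. M k n * (x' n + r * y n)) = c k"
    using x My d by (auto simp: d_def[symmetric] r_def simp del: sum.insert)
  then show ?case by (rule exI[of _ "\<lambda>n. x' n + r * y n"])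
qed simp

text \<open>After division by exp(ipx), differentiation removes the mode \<open>p\<close> and
  multiplies every other coefficient by \<i>(n - p), which is nonzero.\<close>

lemma trig_poly_zero:
  assumes "finite I" "\<alpha> < \<beta>" "\<And>x. x \<in> {\<alpha><..<\<beta>} \<Longrightarrow> (\<Sum>n\<in>I. y n * cexpi n x) = 0"
  shows "\<forall>n\<in>I. y n = 0"
  using assms(1,3)
proof (induction I arbitrary: y rule: finite_induct)
  case (insert p I)
  have ne: "cexpi m x \<noteq> 0" for m x
    using norm_cexpi[of m x] by fastforce
  define f where "f x = (\<Sum>n\<in>insert p I. y n * cexpi (n - p) x)" for x
  have f0: "f x = 0" if "x \<in> {\<alpha><..<\<beta>}" for x
  proof -
    have "cexpi p x * f x = (\<Sum>n\<in>insert p I. y n * cexpi n x)"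
      unfolding f_def sum_distrib_left by (rule sum.cong) (simp_all add: mult.left_commute cexpi_mult)
    with insert.prems[OF that] ne show ?thesis by simp
  qed
  have "(\<Sum>n\<in>I. (y n * of_int (n - p)) * cexpi n x) = 0" if x: "x \<in> {\<alpha><..<\<beta>}" for x
  proof -
    have "(f has_vector_derivative (\<Sum>n\<in>insert p I. y n * (\<i> * of_int (n - p) * cexpi (n - p) x))) (at x)"
      unfolding f_def by (intro has_vector_derivative_sum has_vector_derivative_mult_right cexpi_has_vector_derivative)
    moreover have "(f has_vector_derivative 0) (at x)"
      by (rule has_vector_derivative_transform_within_open[OF has_vector_derivative_const[of 0] open_greaterThanLessThan x])
        (simp add: f0)
    ultimately have "(\<Sum>n\<in>insert p I. y n * (\<i> * of_int (n - p) * cexpi (n - p) x)) = 0"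
      by (rule vector_derivative_unique_at)
    then have "(\<Sum>n\<in>I. y n * (\<i> * of_int (n - p) * cexpi (n - p) x)) = 0"
      using insert.hyps by simp
    then have "cexpi p x / \<i> * (\<Sum>n\<in>I. y n * (\<i> * of_int (n - p) * cexpi (n - p) x)) = 0"
      by simp
    moreover have "cexpi p x / \<i> * (y n * (\<i> * of_int (n - p) * cexpi (n - p) x)) = (y n * of_int (n - p)) * cexpi n x" for n
      using cexpi_mult[of p x "n - p"] by (simp add: mult_ac)
    ultimately show ?thesis
      unfolding sum_distrib_left by simp
  qed
  then have "\<forall>n\<in>I. y n * of_int (n - p) = 0"
    by (rule insert.IH)
  then have yI: "\<forall>n\<in>I. y n = 0"
    using insert.hyps by (metis eq_iff_diff_eq_0 mult_eq_0_iff of_int_eq_0_iff)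
  obtain x where x: "x \<in> {\<alpha><..<\<beta>}" using dense[OF assms(2)] by auto
  have "y p * cexpi p x = 0"
    using insert.prems[OF x] insert.hyps yI by simp
  with ne yI show ?case by simp
qed simp

lemma periodic_test_zero:
  assumes "\<phi> \<in> periodic_test" "\<And>x. x \<in> {0..2 * pi} \<Longrightarrow> \<phi> x = 0"
  shows "\<phi> x = 0"
proof -
  define m where "m = \<lfloor>x / (2 * pi)\<rfloor>"
  define y where "y = x - of_int m * (2 * pi)"
  have "of_int m \<le> x / (2 * pi)" "x / (2 * pi) \<le> of_int m + 1"
    unfolding m_def by linarith+
  then have "y \<in> {0..2 * pi}"
    by (simp add: y_def field_simps)
  then have "\<phi> y = 0" by (rule assms(2))
  then show ?thesis
    using periodic_test_shift_int[OF assms(1), of y m] by (simp add: y_def)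
qed

locale profile =
  fixes g :: "real \<Rightarrow> real"
  assumes profile: "control_profile g"
begin

abbreviation "G \<equiv> complexify g"
abbreviation "\<gamma> \<equiv> fcoef G"

lemma G_test: "G \<in> periodic_test" and g_nonneg: "0 \<le> g x" and g_integral: "integral {0..2 * pi} g = 1"
  and g_interval: "periodic_open_interval {x. 0 < g x}"
  using profile by (auto simp: control_profile_def)

lemma G_continuous: "continuous_on X G"
  by (rule periodic_test_continuous[OF G_test])

lemma g_continuous: "continuous_on X g"
  using continuous_on_Re[OF G_continuous[of X]] by simp

lemma \<gamma>_0 [simp]: "\<gamma> 0 = 1"
  using integral_complex_of_real_continuous[OF g_continuous, of 0 "2 * pi"] by (simp add: fcoef_def g_integral)

lemma cnj_\<gamma>: "cnj (\<gamma> k) = \<gamma> (- k)"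
  unfolding fcoef_def Henstock_Kurzweil_Integration.integral_cnj by (simp add: cnj_cexpi)

lemma ctrl_matrix_0: "ctrl_matrix g 0 n = 0"
  by (simp add: ctrl_matrix_def)

text \<open>The Hermitian form of the matrix is the variance of the trigonometric polynomial
  \<open>p\<close> under the density \<open>g\<close>; that \<open>g\<close> has total mass 1 makes
  \<open>m\<close> its mean.\<close>

lemma ctrl_matrix_form:
  fixes x :: "int \<Rightarrow> complex"
  assumes "finite I"
  defines "p \<equiv> \<lambda>y. \<Sum>n\<in>I. x n * cexpi n y" and "m \<equiv> \<Sum>n\<in>I. x n * \<gamma> n"
  shows "2 * pi * (\<Sum>k\<in>I. cnj (x k) * (\<Sum>n\<in>I. ctrl_matrix g k n * x n)) =
    of_real (integral {0..2 * pi} (\<lambda>y. g y * (cmod (p y - m))\<^sup>2))"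
proof -
  note int = integrable_continuous_real continuous_intros G_continuous
  have p: "continuous_on X p" for X
    unfolding p_def by (intro continuous_intros)
  have fp: "integral {0..2 * pi} (\<lambda>y. G y * p y) = m"
  proof -
    have "integral {0..2 * pi} (\<lambda>y. G y * p y) = integral {0..2 * pi} (\<lambda>y. \<Sum>n\<in>I. x n * (G y * cexpi n y))"
      by (simp add: p_def sum_distrib_left mult.left_commute)
    also have "\<dots> = m"
      using assms(1) by (subst integral_sum) (auto intro!: int simp: m_def fcoef_def)
    finally show ?thesis .
  qed
  have fcp: "integral {0..2 * pi} (\<lambda>y. G y * cnj (p y)) = cnj m"
    unfolding fp[symmetric] Henstock_Kurzweil_Integration.integral_cnj by simp
  have fpp: "integral {0..2 * pi} (\<lambda>y. G y * (cnj (p y) * p y)) = (\<Sum>k\<in>I. \<Sum>n\<in>I. cnj (x k) * x n * \<gamma> (n - k))"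
  proof -
    have "G y * (cnj (p y) * p y) = (\<Sum>k\<in>I. \<Sum>n\<in>I. cnj (x k) * x n * (G y * cexpi (n - k) y))" for y
    proof -
      have "cnj (x k) * x n * (G y * cexpi (n - k) y) = G y * ((cnj (x k) * cexpi (- k) y) * (x n * cexpi n y))" for k n
        using cexpi_mult[of n y "- k"] by (simp add: mult_ac)
      moreover have cp: "cnj (p y) = (\<Sum>k\<in>I. cnj (x k) * cexpi (- k) y)"
        by (simp add: p_def cnj_cexpi)
      have "cnj (p y) * p y = (\<Sum>k\<in>I. \<Sum>n\<in>I. (cnj (x k) * cexpi (- k) y) * (x n * cexpi n y))"
        by (subst cp) (simp only: p_def sum_product)
      ultimately show ?thesis by (simp only: sum_distrib_left)
    qed
    then have "integral {0..2 * pi} (\<lambda>y. G y * (cnj (p y) * p y)) =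
        integral {0..2 * pi} (\<lambda>y. \<Sum>k\<in>I. \<Sum>n\<in>I. cnj (x k) * x n * (G y * cexpi (n - k) y))"
      by simp
    also have "\<dots> = (\<Sum>k\<in>I. integral {0..2 * pi} (\<lambda>y. \<Sum>n\<in>I. cnj (x k) * x n * (G y * cexpi (n - k) y)))"
      using assms(1) by (intro integral_sum) (auto intro!: int)
    also have "\<dots> = (\<Sum>k\<in>I. \<Sum>n\<in>I. integral {0..2 * pi} (\<lambda>y. cnj (x k) * x n * (G y * cexpi (n - k) y)))"
      using assms(1) by (intro sum.cong refl integral_sum) (auto intro!: int)
    finally show ?thesis by (simp add: fcoef_def)
  qed
  have "complex_of_real (integral {0..2 * pi} (\<lambda>y. g y * (cmod (p y - m))\<^sup>2)) =
      integral {0..2 * pi} (\<lambda>y. of_real (g y * (cmod (p y - m))\<^sup>2))"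
    by (intro integral_complex_of_real_continuous[symmetric] continuous_intros g_continuous p)
  also have "\<dots> = integral {0..2 * pi} (\<lambda>y. (G y * (cnj (p y) * p y) - m * (G y * cnj (p y))) - (cnj m * (G y * p y) - cnj m * m * G y))"
  proof (rule integral_cong)
    fix y
    have "complex_of_real (g y * (cmod (p y - m))\<^sup>2) = G y * ((p y - m) * cnj (p y - m))"
      by (simp only: of_real_mult complex_norm_square)
    then show "complex_of_real (g y * (cmod (p y - m))\<^sup>2) = (G y * (cnj (p y) * p y) - m * (G y * cnj (p y))) - (cnj m * (G y * p y) - cnj m * m * G y)"
      by (simp add: algebra_simps)
  qed
  also have "\<dots> = (integral {0..2 * pi} (\<lambda>y. G y * (cnj (p y) * p y)) - m * cnj m) - (cnj m * m - cnj m * m * \<gamma> 0)"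
  proof (intro integral_unique has_integral_diff has_integral_mult_right)
    show "((\<lambda>y. G y * (cnj (p y) * p y)) has_integral integral {0..2 * pi} (\<lambda>y. G y * (cnj (p y) * p y))) {0..2 * pi}"
      by (intro integrable_integral int p)
    show "((\<lambda>y. G y * cnj (p y)) has_integral cnj m) {0..2 * pi}"
      unfolding fcp[symmetric] by (intro integrable_integral int p)
    show "((\<lambda>y. G y * p y) has_integral m) {0..2 * pi}"
      unfolding fp[symmetric] by (intro integrable_integral int p)
    have "\<gamma> 0 = integral {0..2 * pi} G" by (simp add: fcoef_def)
    then show "(G has_integral \<gamma> 0) {0..2 * pi}"
      using integrable_integral[OF integrable_continuous_real[OF G_continuous, of 0 "2 * pi"]] by (simp only:)
  qed
  also have "\<dots> = (\<Sum>k\<in>I. \<Sum>n\<in>I. cnj (x k) * x n * \<gamma> (n - k)) - cnj m * m"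
    by (simp add: fpp)
  also have "cnj m * m = (\<Sum>k\<in>I. \<Sum>n\<in>I. cnj (x k) * x n * (\<gamma> (- k) * \<gamma> n))"
  proof -
    have "cnj m = (\<Sum>k\<in>I. cnj (x k) * \<gamma> (- k))"
      by (simp add: m_def cnj_\<gamma>)
    then have "cnj m * m = (\<Sum>k\<in>I. \<Sum>n\<in>I. (cnj (x k) * \<gamma> (- k)) * (x n * \<gamma> n))"
      by (simp only: m_def sum_product)
    then show ?thesis by (simp add: mult_ac)
  qed
  also have "(\<Sum>k\<in>I. \<Sum>n\<in>I. cnj (x k) * x n * \<gamma> (n - k)) - (\<Sum>k\<in>I. \<Sum>n\<in>I. cnj (x k) * x n * (\<gamma> (- k) * \<gamma> n)) =
      2 * pi * (\<Sum>k\<in>I. cnj (x k) * (\<Sum>n\<in>I. ctrl_matrix g k n * x n))"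
    unfolding sum_subtractf[symmetric] sum_distrib_left
    by (intro sum.cong refl) (simp add: ctrl_matrix_def field_simps)
  finally show ?thesis by simp
qed

text \<open>A kernel vector gives a polynomial of variance zero in \<open>ctrl_matrix_form\<close>,
  which therefore equals its mean wherever \<open>g\<close> is positive.\<close>

lemma ctrl_matrix_injective:
  assumes I: "finite I" "0 \<notin> I" and x: "\<And>k. k \<in> I \<Longrightarrow> (\<Sum>n\<in>I. ctrl_matrix g k n * x n) = 0"
  shows "\<forall>n\<in>I. x n = 0"
proof -
  define p where "p y = (\<Sum>n\<in>I. x n * cexpi n y)" for y
  define m where "m = (\<Sum>n\<in>I. x n * \<gamma> n)"
  have p: "p \<in> periodic_test"
    unfolding p_def by (intro periodic_test_sum periodic_test_cmult periodic_test_cexpi)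
  have "integral {0..2 * pi} (\<lambda>y. g y * (cmod (p y - m))\<^sup>2) = 0"
    using ctrl_matrix_form[OF I(1), of x] x by (simp add: p_def m_def)
  moreover have "continuous_on {0..2 * pi} (\<lambda>y. g y * (cmod (p y - m))\<^sup>2)"
    by (intro continuous_intros g_continuous periodic_test_continuous p)
  ultimately have z: "\<forall>y\<in>{0..2 * pi}. g y * (cmod (p y - m))\<^sup>2 = 0"
    using g_nonneg by (subst (asm) integral_eq_0_iff) auto
  \<comment> \<open>The lifted arc may reach outside [0, 2 pi], so the vanishing is carried to the
    whole line by periodicity.\<close>
  have Z: "G y * (p y - m) = 0" for y
  proof (rule periodic_test_zero)
    show "(\<lambda>y. G y * (p y - m)) \<in> periodic_test"
      by (intro periodic_test_mult periodic_test_diff periodic_test_const p G_test)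
    show "G y * (p y - m) = 0" if "y \<in> {0..2 * pi}" for y
      using z that by fastforce
  qed
  have pm: "p y = m" if "0 < g y" for y
    using Z[of y] that by simp
  obtain \<alpha> \<beta> where ab: "\<alpha> < \<beta>" "{x. 0 < g x} = (\<Union>n::int. {\<alpha> + 2 * pi * of_int n <..< \<beta> + 2 * pi * of_int n})"
    using g_interval unfolding periodic_open_interval_def by blast
  have sub: "0 < g y" if "y \<in> {\<alpha><..<\<beta>}" for y
  proof -
    have "y \<in> (\<Union>n::int. {\<alpha> + 2 * pi * of_int n <..< \<beta> + 2 * pi * of_int n})"
      using that by (intro UN_I[of 0]) auto
    then show ?thesis unfolding ab(2)[symmetric] by simp
  qed
  \<comment> \<open>The mean is subtracted as a coefficient at mode 0. As 0 is not in
    \<open>I\<close>, it stays apart from the others, so all of them must vanish.\<close>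
  define x' where "x' n = (if n = 0 then - m else x n)" for n
  have "(\<Sum>n\<in>insert 0 I. x' n * cexpi n y) = p y - m" for y
  proof -
    have "(\<Sum>n\<in>I. x' n * cexpi n y) = p y"
      unfolding p_def using I by (intro sum.cong) (auto simp: x'_def)
    then show ?thesis using I by (simp add: x'_def)
  qed
  then have "\<forall>n\<in>insert 0 I. x' n = 0"
    using pm sub I by (intro trig_poly_zero[OF _ ab(1)]) auto
  then have "x' n = 0" if "n \<in> I" for n
    using that by blast
  then show ?thesis
    using I(2) by (metis x'_def)
qed

lemma ctrl_matrix_solvable:
  assumes I: "finite I" "0 \<notin> I"
  shows "\<exists>D\<ge>0. \<forall>c. \<exists>h. (\<forall>k\<in>I. (\<Sum>n\<in>I. ctrl_matrix g k n * h n) = c k) \<and> (\<forall>n\<in>I. cmod (h n) \<le> D * (\<Sum>k\<in>I. cmod (c k)))"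
proof -
  have ex: "\<exists>h. \<forall>k\<in>I. (\<Sum>n\<in>I. ctrl_matrix g k n * h n) = c k" for c
  proof (rule solvable_if_principal_injective[OF I(1)])
    show "\<forall>n\<in>I'. x n = 0" if "I' \<subseteq> I" "\<And>k. k \<in> I' \<Longrightarrow> (\<Sum>n\<in>I'. ctrl_matrix g k n * x n) = 0" for I' x
      using that I finite_subset by (intro ctrl_matrix_injective) auto
  qed
  \<comment> \<open>\<open>H\<close> holds the solutions for unit right-hand sides, the columns of
    an inverse matrix; the sum of the moduli of its entries is the constant
    \<open>D\<close>.\<close>
  have "\<exists>H. \<forall>m. \<forall>k\<in>I. (\<Sum>n\<in>I. ctrl_matrix g k n * H m n) = (if k = m then 1 else 0)"
    using ex by (intro choice allI)
  then obtain H where H: "\<And>m k. k \<in> I \<Longrightarrow> (\<Sum>n\<in>I. ctrl_matrix g k n * H m n) = (if k = m then 1 else 0)"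
    by blast
  define D where "D = (\<Sum>m\<in>I. \<Sum>n\<in>I. cmod (H m n))"
  have HD: "cmod (H m n) \<le> D" if "m \<in> I" "n \<in> I" for m n
  proof -
    have "cmod (H m n) \<le> (\<Sum>n\<in>I. cmod (H m n))"
      using I that by (intro member_le_sum) auto
    also have "\<dots> \<le> D"
      unfolding D_def using I that by (intro member_le_sum[of m I "\<lambda>m. \<Sum>n\<in>I. cmod (H m n)"]) (auto intro: sum_nonneg)
    finally show ?thesis .
  qed
  show ?thesis
  proof (intro exI[of _ D] conjI allI)
    show "0 \<le> D" unfolding D_def by (intro sum_nonneg) auto
    fix c :: "int \<Rightarrow> complex"
    define h where "h n = (\<Sum>m\<in>I. c m * H m n)" for n
    have "(\<Sum>n\<in>I. ctrl_matrix g k n * h n) = c k" if "k \<in> I" for k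
    proof -
      have "(\<Sum>n\<in>I. ctrl_matrix g k n * h n) = (\<Sum>n\<in>I. \<Sum>m\<in>I. c m * (ctrl_matrix g k n * H m n))"
        by (simp add: h_def sum_distrib_left mult.left_commute)
      also have "\<dots> = (\<Sum>m\<in>I. c m * (\<Sum>n\<in>I. ctrl_matrix g k n * H m n))"
        by (subst sum.swap) (simp add: sum_distrib_left)
      also have "\<dots> = c k"
        using that I by (simp add: H if_distrib cong: if_cong)
      finally show ?thesis .
    qed
    moreover have "cmod (h n) \<le> D * (\<Sum>k\<in>I. cmod (c k))" if "n \<in> I" for n
    proof -
      have "cmod (h n) \<le> (\<Sum>m\<in>I. cmod (c m * H m n))"
        unfolding h_def by (rule norm_sum)
      also have "\<dots> \<le> (\<Sum>m\<in>I. D * cmod (c m))"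
        using that HD by (intro sum_mono) (auto simp: norm_mult mult.commute[of D] intro!: mult_left_mono)
      finally show ?thesis by (simp add: sum_distrib_left)
    qed
    ultimately show "\<exists>h. (\<forall>k\<in>I. (\<Sum>n\<in>I. ctrl_matrix g k n * h n) = c k) \<and> (\<forall>n\<in>I. cmod (h n) \<le> D * (\<Sum>k\<in>I. cmod (c k)))"
      by blast
  qed
qed

text \<open>For large \<open>k\<close> the \<open>2 \<times> 2\<close> system is close to a multiple of the identity, since \<open>\<gamma>\<close> vanishes at infinity.\<close>

lemma ctrl_matrix_diagonally_dominant:
  "\<exists>K::nat. 0 < K \<and> (\<forall>k c h. int K \<le> \<bar>k\<bar> \<longrightarrow> (\<forall>l\<in>{k, - k}. (\<Sum>n\<in>{k, - k}. ctrl_matrix g l n * h n) = c l) \<longrightarrow>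
      cmod (h k) \<le> 4 * pi * (\<Sum>l\<in>{k, - k}. cmod (c l)))"
proof -
  obtain C where C: "0 \<le> C" "\<And>k. cmod (\<gamma> k) * (1 + \<bar>real_of_int k\<bar>) ^ 1 \<le> C"
    using fcoef_decay_ex[OF G_test] by blast
  obtain K :: nat where K: "4 * (C + 1) \<le> real K" using real_arch_simple by blast
  have small: "cmod (\<gamma> k) \<le> 1 / 4" if "int K \<le> \<bar>k\<bar>" for k
  proof -
    have "4 * (C + 1) \<le> 1 + \<bar>real_of_int k\<bar>" using K that by linarith
    then have "cmod (\<gamma> k) * (4 * (C + 1)) \<le> cmod (\<gamma> k) * (1 + \<bar>real_of_int k\<bar>)"
      by (intro mult_left_mono) auto
    also have "\<dots> \<le> C" using C(2)[of k] by simp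
    also have "\<dots> \<le> 1 / 4 * (4 * (C + 1))" by simp
    finally show ?thesis
      by (rule mult_right_le_imp_le) (use C(1) in simp)
  qed
  have K0: "0 < K" using K C(1) by (cases K) auto
  show ?thesis
  proof (intro exI[of _ K] conjI allI impI K0)
    fix k :: int and c h :: "int \<Rightarrow> complex"
    assume k: "int K \<le> \<bar>k\<bar>" and eqs': "\<forall>l\<in>{k, - k}. (\<Sum>n\<in>{k, - k}. ctrl_matrix g l n * h n) = c l"
    have eqs: "(\<Sum>n\<in>{k, - k}. ctrl_matrix g l n * h n) = c l" if "l \<in> {k, - k}" for l
      using eqs' that by blast
    have k0: "k \<noteq> - k" using k K0 by auto
    \<comment> \<open>With |\<gamma>| at most 1/4 from \<open>K\<close> on, products of two
      coefficients are at most 1/16: 15/16 is 1 - 1/16, from \<gamma> 0 = 1 on the diagonal, and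
      5/16 is 1/4 + 1/16.\<close>
    have diag: "15 / 16 \<le> 2 * pi * cmod (ctrl_matrix g l l)" and off: "2 * pi * cmod (ctrl_matrix g l (- l)) \<le> 5 / 16"
      if l: "int K \<le> \<bar>l\<bar>" for l
    proof -
      have s: "cmod (\<gamma> l) \<le> 1 / 4" "cmod (\<gamma> (- l)) \<le> 1 / 4" "cmod (\<gamma> (- l - l)) \<le> 1 / 4"
        by (rule small, use l in arith)+
      have q: "cmod (\<gamma> (- l) * \<gamma> n) \<le> 1 / 16" if "cmod (\<gamma> n) \<le> 1 / 4" for n
        using mult_mono[OF s(2) that] by (simp add: norm_mult)
      have "2 * pi * cmod (ctrl_matrix g l l) = cmod (1 - \<gamma> (- l) * \<gamma> l)"
        by (simp add: ctrl_matrix_def norm_divide)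
      moreover have "cmod 1 - cmod (\<gamma> (- l) * \<gamma> l) \<le> cmod (1 - \<gamma> (- l) * \<gamma> l)"
        by (rule norm_triangle_ineq2)
      ultimately show "15 / 16 \<le> 2 * pi * cmod (ctrl_matrix g l l)"
        using q[OF s(1)] by simp
      have "2 * pi * cmod (ctrl_matrix g l (- l)) = cmod (\<gamma> (- l - l) - \<gamma> (- l) * \<gamma> (- l))"
        by (simp add: ctrl_matrix_def norm_divide)
      also have "\<dots> \<le> cmod (\<gamma> (- l - l)) + cmod (\<gamma> (- l) * \<gamma> (- l))"
        by (rule norm_triangle_ineq4)
      finally show "2 * pi * cmod (ctrl_matrix g l (- l)) \<le> 5 / 16"
        using q[OF s(2)] s(3) by simp
    qed
    have row: "15 / 16 * cmod (h l) \<le> 2 * pi * cmod (c l) + 5 / 16 * cmod (h (- l))" if l: "l \<in> {k, - k}" for l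
    proof -
      have lK: "int K \<le> \<bar>l\<bar>" using l k by auto
      have "(\<Sum>n\<in>{k, - k}. ctrl_matrix g l n * h n) = ctrl_matrix g l l * h l + ctrl_matrix g l (- l) * h (- l)"
        using l k0 by auto
      then have "ctrl_matrix g l l * h l = c l - ctrl_matrix g l (- l) * h (- l)"
        using eqs[OF l] by (simp add: algebra_simps)
      then have "cmod (ctrl_matrix g l l) * cmod (h l) \<le> cmod (c l) + cmod (ctrl_matrix g l (- l)) * cmod (h (- l))"
        using norm_triangle_ineq4[of "c l" "ctrl_matrix g l (- l) * h (- l)"] by (metis norm_mult)
      then have "2 * pi * (cmod (ctrl_matrix g l l) * cmod (h l)) \<le> 2 * pi * (cmod (c l) + cmod (ctrl_matrix g l (- l)) * cmod (h (- l)))"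
        by (intro mult_left_mono) auto
      then have "(2 * pi * cmod (ctrl_matrix g l l)) * cmod (h l) \<le> 2 * pi * cmod (c l) + (2 * pi * cmod (ctrl_matrix g l (- l))) * cmod (h (- l))"
        by (simp add: algebra_simps)
      moreover have "15 / 16 * cmod (h l) \<le> (2 * pi * cmod (ctrl_matrix g l l)) * cmod (h l)"
        using diag[OF lK] by (intro mult_right_mono) auto
      moreover have "(2 * pi * cmod (ctrl_matrix g l (- l))) * cmod (h (- l)) \<le> 5 / 16 * cmod (h (- l))"
        using off[OF lK] by (intro mult_right_mono) auto
      ultimately show ?thesis by linarith
    qed
    have S: "(\<Sum>l\<in>{k, - k}. cmod (c l)) = cmod (c k) + cmod (c (- k))"
      using k0 by simp
    have r: "15 / 16 * cmod (h k) \<le> 2 * (pi * cmod (c k)) + 5 / 16 * cmod (h (- k))"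
      "15 / 16 * cmod (h (- k)) \<le> 2 * (pi * cmod (c (- k))) + 5 / 16 * cmod (h k)"
      using row[of k] row[of "- k"] by simp_all
    \<comment> \<open>Adding the two rows leaves 10/16 in front of the sum of both unknowns, hence
      the factor 16/5, rounded up to 4 below.\<close>
    have "cmod (h k) \<le> 16 / 5 * (pi * cmod (c k)) + 16 / 5 * (pi * cmod (c (- k)))"
      using r mult_nonneg_nonneg[OF pi_ge_zero norm_ge_zero[of "c k"]]
        mult_nonneg_nonneg[OF pi_ge_zero norm_ge_zero[of "c (- k)"]] by linarith
    also have "\<dots> \<le> 4 * pi * (cmod (c k) + cmod (c (- k)))"
      by (simp add: distrib_left mult_right_mono add_mono)
    finally show "cmod (h k) \<le> 4 * pi * (\<Sum>l\<in>{k, - k}. cmod (c l))" unfolding S .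
  qed
qed

text \<open>Injectivity alone gives a constant for each class; diagonal dominance makes the
  constants uniform beyond a threshold, and finitely many classes remain.\<close>

lemma ctrl_matrix_solvable_uniformly:
  fixes cl :: "int \<Rightarrow> int set"
  assumes fin: "\<And>k. finite (cl k)" and high: "\<And>k. int k\<^sub>1 \<le> \<bar>k\<bar> \<Longrightarrow> cl k = {k, - k}"
  obtains D where "0 \<le> D"
    "\<And>k c. \<exists>h. (\<forall>l\<in>cl k - {0}. (\<Sum>n\<in>cl k - {0}. ctrl_matrix g l n * h n) = c l) \<and>
      (\<forall>n\<in>cl k - {0}. cmod (h n) \<le> D * (\<Sum>l\<in>cl k - {0}. cmod (c l)))"
proof -
  obtain K where K: "0 < K" "\<And>k c h. int K \<le> \<bar>k\<bar> \<Longrightarrow> \<forall>l\<in>{k, - k}. (\<Sum>n\<in>{k, - k}. ctrl_matrix g l n * h n) = c l \<Longrightarrow>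
      cmod (h k) \<le> 4 * pi * (\<Sum>l\<in>{k, - k}. cmod (c l))"
    using ctrl_matrix_diagonally_dominant by blast
  have "\<forall>k. \<exists>D. 0 \<le> D \<and> (\<forall>c. \<exists>h. (\<forall>l\<in>cl k - {0}. (\<Sum>n\<in>cl k - {0}. ctrl_matrix g l n * h n) = c l) \<and>
      (\<forall>n\<in>cl k - {0}. cmod (h n) \<le> D * (\<Sum>l\<in>cl k - {0}. cmod (c l))))"
  proof
    fix k
    show "\<exists>D. 0 \<le> D \<and> (\<forall>c. \<exists>h. (\<forall>l\<in>cl k - {0}. (\<Sum>n\<in>cl k - {0}. ctrl_matrix g l n * h n) = c l) \<and>
      (\<forall>n\<in>cl k - {0}. cmod (h n) \<le> D * (\<Sum>l\<in>cl k - {0}. cmod (c l))))"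
      by (rule ctrl_matrix_solvable) (use fin in auto)
  qed
  then have "\<exists>D. \<forall>k. 0 \<le> D k \<and> (\<forall>c. \<exists>h. (\<forall>l\<in>cl k - {0}. (\<Sum>n\<in>cl k - {0}. ctrl_matrix g l n * h n) = c l) \<and>
      (\<forall>n\<in>cl k - {0}. cmod (h n) \<le> D k * (\<Sum>l\<in>cl k - {0}. cmod (c l))))"
    by (rule choice)
  then obtain D where D': "\<forall>k. 0 \<le> D k \<and> (\<forall>c. \<exists>h. (\<forall>l\<in>cl k - {0}. (\<Sum>n\<in>cl k - {0}. ctrl_matrix g l n * h n) = c l) \<and>
      (\<forall>n\<in>cl k - {0}. cmod (h n) \<le> D k * (\<Sum>l\<in>cl k - {0}. cmod (c l))))" ..
  then have D: "0 \<le> D k" "\<exists>h. (\<forall>l\<in>cl k - {0}. (\<Sum>n\<in>cl k - {0}. ctrl_matrix g l n * h n) = c l) \<and>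
      (\<forall>n\<in>cl k - {0}. cmod (h n) \<le> D k * (\<Sum>l\<in>cl k - {0}. cmod (c l)))" for k c
    by auto
  define low where "low = {- int (max K k\<^sub>1)..int (max K k\<^sub>1)}"
  \<comment> \<open>The sum dominates each constant of the low range, and 4 pi covers the modes
    beyond both thresholds.\<close>
  define D' where "D' = 4 * pi + (\<Sum>k\<in>low. D k)"
  have D': "4 * pi \<le> D'" "D k \<le> D'" if "k \<in> low" for k
  proof -
    have "D k \<le> (\<Sum>k\<in>low. D k)" using that D(1) by (intro member_le_sum) (auto simp: low_def)
    then show "D k \<le> D'" by (simp add: D'_def add_increasing)
  qed (simp add: D'_def sum_nonneg D(1))
  show thesis
  proof
    show D0: "0 \<le> D'" unfolding D'_def by (intro add_nonneg_nonneg sum_nonneg D(1)) simp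
    fix k c
    obtain h where h: "\<forall>l\<in>cl k - {0}. (\<Sum>n\<in>cl k - {0}. ctrl_matrix g l n * h n) = c l"
      "\<forall>n\<in>cl k - {0}. cmod (h n) \<le> D k * (\<Sum>l\<in>cl k - {0}. cmod (c l))"
      using D(2) by blast
    have hb: "cmod (h n) \<le> D' * (\<Sum>l\<in>cl k - {0}. cmod (c l))" if n: "n \<in> cl k - {0}" for n
    proof (cases "k \<in> low")
      case True
      have "D k * (\<Sum>l\<in>cl k - {0}. cmod (c l)) \<le> D' * (\<Sum>l\<in>cl k - {0}. cmod (c l))"
        using D'(2)[OF True] by (intro mult_right_mono sum_nonneg) auto
      with bspec[OF h(2) n] show ?thesis by linarith
    next
      case False
      then have k: "int K \<le> \<bar>k\<bar>" "int k\<^sub>1 \<le> \<bar>k\<bar>" by (auto simp: low_def)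
      then have k0: "k \<noteq> 0" using K(1) by auto
      have e: "cl k - {0} = {k, - k}"
        unfolding high[OF k(2)] using k0 by auto
      have nk: "n = k \<or> n = - k"
        using n unfolding e by simp
      then have cl: "cl k - {0} = {n, - n}"
        unfolding e by auto
      have "cmod (h n) \<le> 4 * pi * (\<Sum>l\<in>{n, - n}. cmod (c l))"
        using h(1) k nk unfolding cl by (intro K(2)) auto
      also have "\<dots> \<le> D' * (\<Sum>l\<in>{n, - n}. cmod (c l))"
        by (intro mult_right_mono sum_nonneg) (auto simp: D'_def sum_nonneg D(1))
      finally show ?thesis unfolding cl .
    qed
    show "\<exists>h. (\<forall>l\<in>cl k - {0}. (\<Sum>n\<in>cl k - {0}. ctrl_matrix g l n * h n) = c l) \<and>
      (\<forall>n\<in>cl k - {0}. cmod (h n) \<le> D' * (\<Sum>l\<in>cl k - {0}. cmod (c l)))"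
    proof (intro exI[of _ h] conjI ballI)
      show "(\<Sum>n\<in>cl k - {0}. ctrl_matrix g l n * h n) = c l" if "l \<in> cl k - {0}" for l
        using h(1) that by (rule bspec)
      show "cmod (h n) \<le> D' * (\<Sum>l\<in>cl k - {0}. cmod (c l))" if "n \<in> cl k - {0}" for n
        using that by (rule hb)
    qed
  qed
qed

end

section \<open>Exact controllability\<close>

lemma dominated_familyI:
  assumes "\<And>k. continuous_on X (\<lambda>t. fourier_coeff (u t) k)" "v \<in> sobolev s"
    and "\<And>t k. t \<in> X \<Longrightarrow> cmod (fourier_coeff (u t) k) \<le> cmod (fourier_coeff v k)"
  shows "dominated_family s X u"
  unfolding dominated_family_def using assms by (auto simp: sobolev_iff_l2 intro!: exI[of _ "fourier_coeff v"])

lemma of_coeff_norm: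
  assumes "v \<in> sobolev s" "\<And>k. cmod (c k) \<le> B * cmod (fourier_coeff v k)" "0 \<le> B"
  shows "fourier_coeff (of_coeff c) k = c k" "of_coeff c \<in> sobolev s" "sobolev_norm s (of_coeff c) \<le> B * sobolev_norm s v"
proof -
  have "l2_weighted s (fourier_coeff v)"
    using assms(1) by (simp add: sobolev_iff_l2)
  then have "l2_weighted s c"
    using assms(2) by (rule l2_weighted_comparison)
  then have fc: "fourier_coeff (of_coeff c) = c"
    by (rule fourier_coeff_of_coeff)
  then show "fourier_coeff (of_coeff c) k = c k" by simp
  show "of_coeff c \<in> sobolev s"
    by (rule sobolev_norm_le_mult(1)[OF assms(1)]) (use assms fc in auto)
  show "sobolev_norm s (of_coeff c) \<le> B * sobolev_norm s v"
    by (rule sobolev_norm_le_mult(2)[OF assms(1)]) (use assms fc in auto)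
qed

text \<open>The system on {k, -k} bounds an unknown by the data at both indices, so the reflected
  data must be measured in the same norm.\<close>

lemma sobolev_reflect:
  assumes "v \<in> sobolev s"
  obtains w where "w \<in> sobolev s" "\<And>k. fourier_coeff w k = fourier_coeff v (- k)" "sobolev_norm s w = sobolev_norm s v"
proof -
  define f where "f k = sobolev_weight s k * (cmod (fourier_coeff v k))\<^sup>2" for k
  have bij: "bij_betw uminus (UNIV :: int set) UNIV"
    by (rule bij_betwI[of _ _ _ uminus]) auto
  have fm: "sobolev_weight s k * (cmod (fourier_coeff v (- k)))\<^sup>2 = f (- k)" for k
    by (simp add: f_def sobolev_weight_def)
  have "f summable_on UNIV" using assms by (simp add: sobolev_def f_def[abs_def])
  then have "(\<lambda>k. f (- k)) summable_on UNIV"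
    using summable_on_reindex_bij_betw[OF bij, of f] by simp
  then have l2: "l2_weighted s (\<lambda>k. fourier_coeff v (- k))"
    by (simp add: l2_weighted_def fm)
  have "sobolev_norm s (of_coeff (\<lambda>k. fourier_coeff v (- k))) = sqrt (2 * pi * (\<Sum>\<^sub>\<infinity>k. f (- k)))"
    by (simp add: sobolev_norm_def fourier_coeff_of_coeff[OF l2] fm)
  also have "(\<Sum>\<^sub>\<infinity>k. f (- k)) = infsum f UNIV"
    using infsum_reindex_bij_betw[OF bij, of f] by simp
  also have "sqrt (2 * pi * infsum f UNIV) = sobolev_norm s v"
    by (simp add: sobolev_norm_def f_def[abs_def])
  finally have N: "sobolev_norm s (of_coeff (\<lambda>k. fourier_coeff v (- k))) = sobolev_norm s v" .
  show thesis
    by (rule that[of "of_coeff (\<lambda>k. fourier_coeff v (- k))"]) (simp_all add: l2 N of_coeff_in_sobolev fourier_coeff_of_coeff[OF l2])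
qed

context profile
begin

text \<open>The block solutions form one sequence, and the point is its H^s bound. On a high class
  the unknown is controlled by the data at n and -n, which carry the same weight; the low modes are
  finitely many, and there the norm of \<open>v\<close> bounds every coefficient.\<close>

lemma gram_system_solvable:
  fixes cl :: "int \<Rightarrow> int set"
  assumes fin: "\<And>k. finite (cl k)" and high: "\<And>k. int k\<^sub>1 \<le> \<bar>k\<bar> \<Longrightarrow> cl k = {k, - k}"
    and cl_refl: "\<And>k. k \<in> cl k" and cl_eq: "\<And>k l. l \<in> cl k \<Longrightarrow> cl l = cl k"
  obtains K where "0 \<le> K" "\<And>v. v \<in> sobolev s \<Longrightarrow> fourier_coeff v 0 = 0 \<Longrightarrow>
    \<exists>w\<in>sobolev s. sobolev_norm s w \<le> K * sobolev_norm s v \<and>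
      (\<forall>l. (\<Sum>n\<in>cl l. ctrl_matrix g l n * fourier_coeff w n) = fourier_coeff v l)"
proof -
  obtain D where D: "0 \<le> D"
    "\<And>k c. \<exists>h. (\<forall>l\<in>cl k - {0}. (\<Sum>n\<in>cl k - {0}. ctrl_matrix g l n * h n) = c l) \<and>
      (\<forall>n\<in>cl k - {0}. cmod (h n) \<le> D * (\<Sum>l\<in>cl k - {0}. cmod (c l)))"
    by (rule ctrl_matrix_solvable_uniformly[of cl k\<^sub>1, OF fin high]) (assumption, rule that)
  define low where "low = {- int k\<^sub>1..int k\<^sub>1}"
  have "\<exists>C. \<forall>k. 0 < C k \<and> (\<forall>v\<in>sobolev s. cmod (fourier_coeff v k) \<le> C k * sobolev_norm s v)"
    by (intro choice allI) (metis fourier_coeff_le_sobolev_norm)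
  then obtain C where C: "\<And>k. 0 < C k" "\<And>k v. v \<in> sobolev s \<Longrightarrow> cmod (fourier_coeff v k) \<le> C k * sobolev_norm s v"
    by blast
  define CL where "CL = (\<Sum>k\<in>low. C k)"
  have CL: "0 \<le> CL" unfolding CL_def using C(1) by (intro sum_nonneg) (auto intro: less_imp_le)
  define e where "e k = (if k \<in> low then 1 else 0 :: complex)" for k
  have "l2_weighted s e"
    unfolding l2_weighted_def by (rule finite_nonzero_values_imp_summable_on, rule finite_subset[of _ low]) (auto simp: e_def low_def)
  then have e: "of_coeff e \<in> sobolev s" "fourier_coeff (of_coeff e) = e"
    by (simp_all add: of_coeff_in_sobolev fourier_coeff_of_coeff)
  define K where "K = D * (2 + CL * sobolev_norm s (of_coeff e))"
  show thesis
  proof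
    show "0 \<le> K" using D(1) CL by (simp add: K_def)
    fix v assume v: "v \<in> sobolev s" "fourier_coeff v 0 = 0"
    define c where "c = fourier_coeff v"
    \<comment> \<open>The choice is made per class and not per index, so that all members of a class
      take their values from the same solution.\<close>
    have "\<forall>I\<in>range cl. \<exists>h. (\<forall>l\<in>I - {0}. (\<Sum>n\<in>I - {0}. ctrl_matrix g l n * h n) = c l) \<and>
      (\<forall>n\<in>I - {0}. cmod (h n) \<le> D * (\<Sum>l\<in>I - {0}. cmod (c l)))"
    proof
      fix I assume "I \<in> range cl"
      then obtain k where "I = cl k" by blast
      with D(2)[of k c] show "\<exists>h. (\<forall>l\<in>I - {0}. (\<Sum>n\<in>I - {0}. ctrl_matrix g l n * h n) = c l) \<and>
        (\<forall>n\<in>I - {0}. cmod (h n) \<le> D * (\<Sum>l\<in>I - {0}. cmod (c l)))" by (simp only:)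
    qed
    then have "\<exists>h. \<forall>I\<in>range cl. (\<forall>l\<in>I - {0}. (\<Sum>n\<in>I - {0}. ctrl_matrix g l n * h I n) = c l) \<and>
      (\<forall>n\<in>I - {0}. cmod (h I n) \<le> D * (\<Sum>l\<in>I - {0}. cmod (c l)))"
      by (rule bchoice)
    then obtain h where h': "\<forall>I\<in>range cl. (\<forall>l\<in>I - {0}. (\<Sum>n\<in>I - {0}. ctrl_matrix g l n * h I n) = c l) \<and>
      (\<forall>n\<in>I - {0}. cmod (h I n) \<le> D * (\<Sum>l\<in>I - {0}. cmod (c l)))" ..
    note hk = bspec[OF h' rangeI]
    have h: "l \<in> cl k - {0} \<Longrightarrow> (\<Sum>n\<in>cl k - {0}. ctrl_matrix g l n * h (cl k) n) = c l"
      "n \<in> cl k - {0} \<Longrightarrow> cmod (h (cl k) n) \<le> D * (\<Sum>l\<in>cl k - {0}. cmod (c l))" for k l n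
      by (rule bspec[OF conjunct1[OF hk]], assumption) (rule bspec[OF conjunct2[OF hk]], assumption)
    define w where "w n = (if n = 0 then 0 else h (cl n) n)" for n
    have w_sum: "(\<Sum>n\<in>cl l. ctrl_matrix g l n * w n) = c l" for l
    proof (cases "l = 0")
      case True
      then show ?thesis using v(2) by (simp add: ctrl_matrix_0 c_def)
    next
      case False
      have "(\<Sum>n\<in>cl l. ctrl_matrix g l n * w n) = (\<Sum>n\<in>cl l - {0}. ctrl_matrix g l n * w n)"
        using fin by (intro sum.mono_neutral_right) (auto simp: w_def)
      also have "\<dots> = (\<Sum>n\<in>cl l - {0}. ctrl_matrix g l n * h (cl l) n)"
        using cl_eq by (intro sum.cong) (auto simp: w_def)
      also have "\<dots> = c l" using False cl_refl by (intro h(1)) auto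
      finally show ?thesis .
    qed
    have L: "(\<Sum>l\<in>cl n - {0}. cmod (c l)) \<le> cmod (c n) + cmod (c (- n)) + CL * sobolev_norm s v * cmod (e n)" for n
    proof (cases "int k\<^sub>1 \<le> \<bar>n\<bar>")
      case True
      have "(\<Sum>l\<in>cl n - {0}. cmod (c l)) \<le> (\<Sum>l\<in>{n, - n}. cmod (c l))"
        using high[OF True] by (intro sum_mono2) auto
      also have "\<dots> \<le> cmod (c n) + cmod (c (- n))"
        by (cases "n = - n") auto
      finally show ?thesis using CL by (simp add: add_increasing2)
    next
      case False
      \<comment> \<open>A high member would make the class {m, -m}, which contains no low
        index.\<close>
      have sub: "cl n - {0} \<subseteq> low"
      proof
        fix m assume m: "m \<in> cl n - {0}"
        have "\<not> int k\<^sub>1 \<le> \<bar>m\<bar>"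
        proof
          assume m1: "int k\<^sub>1 \<le> \<bar>m\<bar>"
          have "n \<in> cl m" using cl_eq[of m n] cl_refl[of n] m by auto
          then show False using high[OF m1] m1 False by auto
        qed
        then show "m \<in> low" by (auto simp: low_def)
      qed
      have "(\<Sum>l\<in>cl n - {0}. cmod (c l)) \<le> (\<Sum>l\<in>low. cmod (c l))"
        using sub by (intro sum_mono2) (auto simp: low_def)
      also have "\<dots> \<le> (\<Sum>l\<in>low. C l * sobolev_norm s v)"
        unfolding c_def by (intro sum_mono C(2) v)
      also have "\<dots> = CL * sobolev_norm s v * cmod (e n)"
      proof -
        have "n \<in> low" using False by (auto simp: low_def)
        then show ?thesis by (simp add: CL_def sum_distrib_right e_def)
      qed
      finally show ?thesis by (simp add: add_increasing)
    qed
    obtain v' where v': "v' \<in> sobolev s" "\<And>k. fourier_coeff v' k = fourier_coeff v (- k)" "sobolev_norm s v' = sobolev_norm s v"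
      using sobolev_reflect[OF v(1)] by blast
    have "cmod (complex_of_real (cmod (c k))) \<le> 1 * cmod (fourier_coeff v k)" for k
      by (simp add: c_def)
    note A1 = of_coeff_norm[OF v(1) this zero_le_one]
    note abs1 = A1(2) A1(1) A1(3)
    have "cmod (complex_of_real (cmod (c (- k)))) \<le> 1 * cmod (fourier_coeff v' k)" for k
      by (simp add: c_def v')
    note A2 = of_coeff_norm[OF v'(1) this zero_le_one]
    note abs2 = A2(2) A2(1) A2(3)
    define a where "a = CL * sobolev_norm s v"
    have a0: "0 \<le> a" using CL by (simp add: a_def)
    have abs3: "a *\<^sub>R of_coeff e \<in> sobolev s" "sobolev_norm s (a *\<^sub>R of_coeff e) \<le> a * sobolev_norm s (of_coeff e)"
      using sobolev_norm_le_mult[OF e(1), of "a *\<^sub>R of_coeff e" a] a0 by auto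
    \<comment> \<open>All three summands have non-negative real coefficients, so moduli add exactly
      and \<open>z\<close> is a majorant in H^s for the block estimates.\<close>
    define z where "z = of_coeff (\<lambda>k. of_real (cmod (c k))) + of_coeff (\<lambda>k. of_real (cmod (c (- k)))) + a *\<^sub>R of_coeff e"
    have z: "z \<in> sobolev s" unfolding z_def by (intro sobolev_add abs1 abs2 abs3)
    have z_norm: "sobolev_norm s z \<le> (2 + CL * sobolev_norm s (of_coeff e)) * sobolev_norm s v"
    proof -
      have "sobolev_norm s z \<le> (sobolev_norm s (of_coeff (\<lambda>k. of_real (cmod (c k)))) + sobolev_norm s (of_coeff (\<lambda>k. of_real (cmod (c (- k)))))) +
          sobolev_norm s (a *\<^sub>R of_coeff e)"
        unfolding z_def
        by (rule order_trans[OF sobolev_norm_triangle add_right_mono[OF sobolev_norm_triangle]]) (intro sobolev_add abs1 abs2 abs3)+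
      also have "\<dots> \<le> (1 * sobolev_norm s v + 1 * sobolev_norm s v') + a * sobolev_norm s (of_coeff e)"
        by (intro add_mono abs1 abs2 abs3)
      finally show ?thesis by (simp add: v' a_def algebra_simps)
    qed
    have z_coeff: "cmod (fourier_coeff z n) = cmod (c n) + cmod (c (- n)) + a * cmod (e n)" for n
    proof -
      have "fourier_coeff z n = of_real (cmod (c n) + cmod (c (- n)) + a * cmod (e n))"
        by (simp add: z_def abs1 abs2 e(2) scaleR_conv_of_real) (simp add: e_def)
      then show ?thesis using a0 by (simp only: norm_of_real) simp
    qed
    have wz: "cmod (w n) \<le> D * cmod (fourier_coeff z n)" for n
    proof (cases "n = 0")
      case False
      then have "cmod (w n) \<le> D * (\<Sum>l\<in>cl n - {0}. cmod (c l))"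
        using h(2)[of n n] cl_refl by (simp add: w_def)
      also have "\<dots> \<le> D * cmod (fourier_coeff z n)"
        unfolding z_coeff a_def using D(1) L by (intro mult_left_mono)
      finally show ?thesis .
    qed (use D in \<open>simp add: w_def\<close>)
    note wc = of_coeff_norm[OF z wz D(1)]
    show "\<exists>w\<in>sobolev s. sobolev_norm s w \<le> K * sobolev_norm s v \<and>
      (\<forall>l. (\<Sum>n\<in>cl l. ctrl_matrix g l n * fourier_coeff w n) = fourier_coeff v l)"
    proof (intro bexI[of _ "of_coeff w"] conjI allI wc(2))
      have "sobolev_norm s (of_coeff w) \<le> D * ((2 + CL * sobolev_norm s (of_coeff e)) * sobolev_norm s v)"
        by (rule order_trans[OF wc(3) mult_left_mono[OF z_norm D(1)]])
      then show "sobolev_norm s (of_coeff w) \<le> K * sobolev_norm s v"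
        by (simp add: K_def mult.assoc)
      show "(\<Sum>n\<in>cl l. ctrl_matrix g l n * fourier_coeff (of_coeff w) n) = fourier_coeff v l" for l
        using w_sum[of l] by (simp add: wc(1) c_def)
    qed
  qed
qed

text \<open>\<open>w\<close> carries the spatial coefficients of the control, \<open>Q n\<close> the temporal profile of mode \<open>n\<close>.\<close>

lemma control_family:
  assumes w: "w \<in> sobolev s" and Q: "\<And>n. continuous_on UNIV (Q n)" "\<And>n t. cmod (Q n t) \<le> B"
  defines "h \<equiv> \<lambda>t. of_coeff (\<lambda>n. fourier_coeff w n * Q n t)"
  shows "\<And>t n. fourier_coeff (h t) n = fourier_coeff w n * Q n t"
    and "dominated_family s UNIV h"
    and "\<And>t. sobolev_norm s (h t) \<le> B * sobolev_norm s w"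
    and "dominated_family s UNIV (\<lambda>t. control_op g (h t))"
    and "\<And>k T \<mu>. ((\<lambda>n. ctrl_matrix g k n * fourier_coeff w n * integral {0..T} (\<lambda>t. Q n t * cis (- (\<mu> * t)))) has_sum
      integral {0..T} (\<lambda>t. fourier_coeff (control_op g (h t)) k * cis (- (\<mu> * t)))) UNIV"
proof -
  have B: "0 \<le> B" using order_trans[OF norm_ge_zero Q(2)] .
  have le: "cmod (fourier_coeff w n * Q n t) \<le> B * cmod (fourier_coeff w n)" for n t
    using mult_left_mono[OF Q(2)[of n t], of "cmod (fourier_coeff w n)"] by (simp add: norm_mult mult.commute)
  note oc = of_coeff_norm[OF w le B]
  show fc: "fourier_coeff (h t) n = fourier_coeff w n * Q n t" for t n
    unfolding h_def by (rule oc(1))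
  show "sobolev_norm s (h t) \<le> B * sobolev_norm s w" for t
    unfolding h_def by (rule oc(3))
  have h_mem: "h t \<in> sobolev s" for t
    unfolding h_def by (rule oc(2))
  \<comment> \<open>One majorant for the coefficients of the control at all times.\<close>
  define x where "x n = of_real B * fourier_coeff w n" for n
  have x: "l2_weighted s x"
  proof (rule l2_weighted_comparison)
    show "l2_weighted s (fourier_coeff w)" using w by (simp add: sobolev_iff_l2)
    show "cmod (x k) \<le> B * cmod (fourier_coeff w k)" for k using B by (simp add: x_def norm_mult)
  qed
  have hx: "cmod (fourier_coeff (h t) n) \<le> cmod (x n)" for t n
    using le[of n t] B by (simp add: fc x_def norm_mult)
  have coeff_cont: "continuous_on X (\<lambda>t. fourier_coeff (h t) n)" for X n
    using Q(1)[of n] unfolding fc by (intro continuous_intros) (auto intro: continuous_on_subset)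
  show "dominated_family s UNIV h"
    unfolding dominated_family_def using coeff_cont x hx by blast
  define N where "N = nat \<lceil>\<bar>s\<bar> + 2\<rceil>"
  have N: "\<bar>s\<bar> + 2 \<le> real N" unfolding N_def by linarith
  obtain \<kappa> where \<kappa>: "0 \<le> \<kappa>" "\<And>k n. cmod (ctrl_matrix g k n) * (1 + \<bar>real_of_int (k - n)\<bar>) ^ N \<le> \<kappa>"
    using ctrl_matrix_decay[OF G_test] by blast
  have Mx: "(\<lambda>n. cmod (ctrl_matrix g k n * x n)) summable_on UNIV" for k
  proof -
    have "(\<lambda>n. ctrl_matrix g k n * fourier_coeff (of_coeff x) n) abs_summable_on UNIV"
      using x by (intro ctrl_matrix_has_sum(1) G_test) (simp add: fourier_coeff_of_coeff l2_weighted_imp_tempered)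
    then show ?thesis using x by (simp add: fourier_coeff_of_coeff)
  qed
  \<comment> \<open>The rows are summed with absolute values, so that this majorant of the
    controlled term is independent of time; Schur's test puts it in weighted l2.\<close>
  define y where "y k = complex_of_real (\<Sum>\<^sub>\<infinity>n. cmod (ctrl_matrix g k n * x n))" for k
  have "cmod (y k) \<le> (\<Sum>\<^sub>\<infinity>n. cmod (ctrl_matrix g k n * x n))" for k
    by (simp add: y_def infsum_nonneg)
  then have y: "l2_weighted s y"
    by (rule weighted_schur_test(1)[OF \<kappa> N x])
  have sum: "((\<lambda>n. ctrl_matrix g k n * fourier_coeff (h t) n) has_sum fourier_coeff (control_op g (h t)) k) UNIV" for t k
    using h_mem[of t] by (intro ctrl_matrix_has_sum(2) G_test) (auto simp: sobolev_iff_l2 intro: l2_weighted_imp_tempered)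
  have Gh: "fourier_coeff (control_op g (h t)) k = (\<Sum>\<^sub>\<infinity>n. ctrl_matrix g k n * fourier_coeff (h t) n)" for t k
    using sum by (rule infsumI[symmetric])
  have term_le: "cmod (ctrl_matrix g k n * fourier_coeff (h t) n) \<le> cmod (ctrl_matrix g k n * x n)" for k n t
    using hx[of t n] by (simp add: norm_mult mult_left_mono)
  show "dominated_family s UNIV (\<lambda>t. control_op g (h t))"
    unfolding dominated_family_def
  proof (intro conjI exI[of _ y] ballI allI y)
    show "continuous_on UNIV (\<lambda>t. fourier_coeff (control_op g (h t)) k)" for k
      unfolding Gh
    proof (rule continuous_on_infsum[OF _ term_le Mx])
      show "continuous_on UNIV (\<lambda>t. ctrl_matrix g k n * fourier_coeff (h t) n)" for n
        by (intro continuous_intros coeff_cont)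
    qed
    show "cmod (fourier_coeff (control_op g (h t)) k) \<le> cmod (y k)" for t k
    proof -
      have s: "(\<lambda>n. ctrl_matrix g k n * fourier_coeff (h t) n) abs_summable_on UNIV"
        using term_le by (intro Infinite_Sum.abs_summable_on_comparison_test'[OF Mx]) auto
      have "cmod (fourier_coeff (control_op g (h t)) k) \<le> (\<Sum>\<^sub>\<infinity>n. cmod (ctrl_matrix g k n * fourier_coeff (h t) n))"
        unfolding Gh using s by (rule norm_infsum_bound)
      also have "\<dots> \<le> (\<Sum>\<^sub>\<infinity>n. cmod (ctrl_matrix g k n * x n))"
        using s Mx term_le by (rule infsum_mono)
      also have "\<dots> = cmod (y k)"
        by (simp add: y_def infsum_nonneg)
      finally show ?thesis .
    qed
  qed
  show "((\<lambda>n. ctrl_matrix g k n * fourier_coeff w n * integral {0..T} (\<lambda>t. Q n t * cis (- (\<mu> * t)))) has_sum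
      integral {0..T} (\<lambda>t. fourier_coeff (control_op g (h t)) k * cis (- (\<mu> * t)))) UNIV" for k T \<mu>
  proof -
    have "((\<lambda>n. integral {0..T} (\<lambda>t. ctrl_matrix g k n * fourier_coeff (h t) n * cis (- (\<mu> * t)))) has_sum
        integral {0..T} (\<lambda>t. \<Sum>\<^sub>\<infinity>n. ctrl_matrix g k n * fourier_coeff (h t) n * cis (- (\<mu> * t)))) UNIV"
    proof (rule has_sum_integral[OF _ _ Mx])
      show "continuous_on {0..T} (\<lambda>t. ctrl_matrix g k n * fourier_coeff (h t) n * cis (- (\<mu> * t)))" for n
        by (intro continuous_intros coeff_cont)
      show "cmod (ctrl_matrix g k n * fourier_coeff (h t) n * cis (- (\<mu> * t))) \<le> cmod (ctrl_matrix g k n * x n)" for n t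
        using term_le[of k n t] by (simp add: norm_mult)
    qed
    moreover have "(\<Sum>\<^sub>\<infinity>n. ctrl_matrix g k n * fourier_coeff (h t) n * cis (- (\<mu> * t))) = fourier_coeff (control_op g (h t)) k * cis (- (\<mu> * t))" for t
      unfolding Gh by (rule infsum_cmult_left')
    moreover have "integral {0..T} (\<lambda>t. ctrl_matrix g k n * fourier_coeff (h t) n * cis (- (\<mu> * t))) =
        ctrl_matrix g k n * fourier_coeff w n * integral {0..T} (\<lambda>t. Q n t * cis (- (\<mu> * t)))" for n
      by (simp add: fc mult.assoc)
    ultimately show ?thesis by simp
  qed
qed

end

section \<open>Mild solutions and the norm of the control\<close>

text \<open>The symbol accounts for r - 1 of the lost derivatives and the spatial derivative for
  one. The constant \<open>C'\<close> absorbs the finitely many modes below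
  \<open>k\<^sub>0\<close>, where no growth bound is given.\<close>

lemma sobolev_multiplier_derivative:
  assumes A: "fourier_multiplier A (\<lambda>k. of_real (a k))"
    and growth: "\<And>k. \<bar>k\<bar> \<ge> int k\<^sub>0 \<Longrightarrow> \<bar>a k\<bar> \<le> C * \<bar>of_int k\<bar> powr (r - 1)" and "0 \<le> r" "0 < C"
    and v: "v \<in> sobolev s"
  shows "distr_deriv (A v) \<in> sobolev (s - r)"
proof -
  define C' where "C' = C + (\<Sum>k\<in>{- int k\<^sub>0..int k\<^sub>0}. \<bar>real_of_int k * a k\<bar>)"
  have fc: "fourier_coeff (distr_deriv (A v)) k = \<i> * of_int k * (of_real (a k) * fourier_coeff v k)" for k
    using A by (simp add: fourier_multiplier_def)
  have C': "\<bar>real_of_int k * a k\<bar> \<le> C' * (1 + \<bar>real_of_int k\<bar>) powr r" for k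
  proof (cases "\<bar>k\<bar> \<ge> int k\<^sub>0 \<and> k \<noteq> 0")
    case True
    then have k: "0 < \<bar>real_of_int k\<bar>" by simp
    have "\<bar>real_of_int k * a k\<bar> \<le> \<bar>real_of_int k\<bar> * (C * \<bar>real_of_int k\<bar> powr (r - 1))"
      unfolding abs_mult using True by (intro mult_left_mono growth) auto
    also have "\<dots> = C * \<bar>real_of_int k\<bar> powr r"
      using powr_mult_base[of "\<bar>real_of_int k\<bar>" "r - 1"] by simp
    also have "\<dots> \<le> C' * (1 + \<bar>real_of_int k\<bar>) powr r"
      using assms(3,4) by (intro mult_mono powr_mono2) (auto simp: C'_def sum_nonneg)
    finally show ?thesis .
  next
    case False
    then have "k \<in> {- int k\<^sub>0..int k\<^sub>0}" by auto
    then have "\<bar>real_of_int k * a k\<bar> \<le> (\<Sum>k\<in>{- int k\<^sub>0..int k\<^sub>0}. \<bar>real_of_int k * a k\<bar>)"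
      by (intro member_le_sum) auto
    then have "\<bar>real_of_int k * a k\<bar> \<le> C' * 1" using assms(4) by (simp add: C'_def)
    also have "\<dots> \<le> C' * (1 + \<bar>real_of_int k\<bar>) powr r"
      using assms(3,4) by (intro mult_left_mono ge_one_powr_ge_zero) (auto simp: C'_def sum_nonneg)
    finally show ?thesis .
  qed
  have "(\<lambda>k. sobolev_weight (s - r) k * (cmod (fourier_coeff (distr_deriv (A v)) k))\<^sup>2) summable_on UNIV"
  proof (rule summable_on_comparison_test)
    show "(\<lambda>k. C'\<^sup>2 * (sobolev_weight s k * (cmod (fourier_coeff v k))\<^sup>2)) summable_on UNIV"
      using v unfolding sobolev_def by (intro summable_on_cmult_right) simp
    fix k
    define b where "b = 1 + \<bar>real_of_int k\<bar>"
    have b: "0 < b" by (simp add: b_def)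
    have "b powr (s - r) * cmod (fourier_coeff (distr_deriv (A v)) k) = b powr (s - r) * (\<bar>real_of_int k * a k\<bar> * cmod (fourier_coeff v k))"
      unfolding fc by (simp add: norm_mult abs_mult)
    also have "\<dots> \<le> b powr (s - r) * ((C' * b powr r) * cmod (fourier_coeff v k))"
      unfolding b_def by (intro mult_left_mono mult_right_mono C') auto
    also have "\<dots> = C' * (b powr (s - r) * b powr r) * cmod (fourier_coeff v k)"
      by simp
    also have "b powr (s - r) * b powr r = b powr s"
      by (simp add: powr_add[symmetric])
    finally have "(b powr (s - r) * cmod (fourier_coeff (distr_deriv (A v)) k))\<^sup>2 \<le> (C' * b powr s * cmod (fourier_coeff v k))\<^sup>2"
      by (intro power_mono) auto
    then show "sobolev_weight (s - r) k * (cmod (fourier_coeff (distr_deriv (A v)) k))\<^sup>2 \<le> C'\<^sup>2 * (sobolev_weight s k * (cmod (fourier_coeff v k))\<^sup>2)"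
      by (simp add: sobolev_weight_eq_square power_mult_distrib b_def mult.assoc)
  qed auto
  then show ?thesis by (simp add: sobolev_def)
qed

lemma sobolev_mono:
  assumes "v \<in> sobolev s" "s' \<le> s" shows "v \<in> sobolev s'"
  unfolding sobolev_def
proof (rule CollectI, rule summable_on_comparison_test)
  show "(\<lambda>k. sobolev_weight s k * (cmod (fourier_coeff v k))\<^sup>2) summable_on UNIV"
    using assms(1) by (simp add: sobolev_def)
  show "sobolev_weight s' k * (cmod (fourier_coeff v k))\<^sup>2 \<le> sobolev_weight s k * (cmod (fourier_coeff v k))\<^sup>2" for k
    using assms(2) unfolding sobolev_weight_def by (intro mult_right_mono powr_mono) auto
qed auto

text \<open>For every solution the coefficients of the Duhamel term are the integral of one and the
  same scalar function, determined by \<open>h\<close>. Domination supplies the continuity, hence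
  measurability, of that function.\<close>

lemma mild_solution_unique:
  assumes "dominated_family s {0..T} (\<lambda>t. control_op g (h t))"
    and u: "mild_solution A a r g s T u0 h u" and v: "mild_solution A a r g s T u0 h v" and t: "t \<in> {0..T}"
  shows "v t = u t"
proof (rule pdistr_eqI)
  fix k
  let ?f = "\<lambda>t'. propagator a (t - t') (control_op g (h t'))"
  have "continuous_on {0..t} (\<lambda>t'. fourier_coeff (control_op g (h t')) k)"
    using assms(1) t unfolding dominated_family_def by (auto intro: continuous_on_subset)
  then have c: "continuous_on {0..t} (\<lambda>t'. cis (eigval a k * (t - t')) * fourier_coeff (control_op g (h t')) k)"
    by (intro continuous_intros)
  have "fourier_coeff (?f t') k = cis (eigval a k * (t - t')) * fourier_coeff (control_op g (h t')) k" if "t' \<in> {0..t}" for t'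
    using that t by (intro fourier_coeff_propagator[where s = s] dominated_family_sobolev[OF assms(1)]) auto
  with c have "continuous_on {0..t} (\<lambda>t'. fourier_coeff (?f t') k)"
    by (subst continuous_on_cong[OF refl]) auto
  then have m: "(\<lambda>t'. fourier_coeff (?f t') k) \<in> borel_measurable (lebesgue_on {0..t})"
    by (rule continuous_imp_measurable_on_sets_lebesgue) simp
  have "has_bochner_integral (lebesgue_on {0..t}) (\<lambda>t'. fourier_coeff (?f t') k) (fourier_coeff (x t - propagator a t u0) k)"
    if "mild_solution A a r g s T u0 h x" for x
    using that t by (intro has_sobolev_integral_fourier_coeff[OF _ m]) (auto simp: mild_solution_def)
  from has_bochner_integral_eq[OF this[OF v] this[OF u]]
  show "fourier_coeff (v t) k = fourier_coeff (u t) k" by simp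
qed

text \<open>Each coefficient solves a scalar linear equation, and the explicit solutions are
  assembled under one majorant. The coefficient formula is part of the conclusion because the state
  at the final time is computed from it.\<close>

lemma mild_solution_exists:
  assumes A: "fourier_multiplier A (\<lambda>k. of_real (a k))"
    and growth: "\<And>k. \<bar>k\<bar> \<ge> int k\<^sub>0 \<Longrightarrow> \<bar>a k\<bar> \<le> C * \<bar>of_int k\<bar> powr (r - 1)" and r: "0 \<le> r" "0 < C"
    and T: "0 \<le> T" and u0: "u0 \<in> sobolev s"
    and h: "dominated_family s {0..T} (\<lambda>t. control_op g (h t))"
  obtains u where "mild_solution A a r g s T u0 h u"
    "\<And>t k. t \<in> {0..T} \<Longrightarrow> fourier_coeff (u t) k = cis (eigval a k * t) *
      (fourier_coeff u0 k + integral {0..t} (\<lambda>t'. fourier_coeff (control_op g (h t')) k * cis (- (eigval a k * t'))))"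
proof -
  define y where "y k t = fourier_coeff (control_op g (h t)) k" for k t
  define z where "z k t = integral {0..t} (\<lambda>t'. y k t' * cis (- (eigval a k * t')))" for k t
  define c where "c t k = cis (eigval a k * t) * (fourier_coeff u0 k + z k t)" for t k
  obtain b where b: "b \<in> sobolev s" "\<And>t k. t \<in> {0..T} \<Longrightarrow> cmod (y k t) \<le> cmod (fourier_coeff b k)"
    using dominated_familyE[OF h] unfolding y_def by blast
  have y_cont: "continuous_on {0..T} (y k)" for k
    using h by (simp add: dominated_family_def y_def[abs_def])
  have f_cont: "continuous_on {0..T} (\<lambda>t'. y k t' * cis (- (eigval a k * t')))" for k
    by (intro continuous_intros y_cont)
  have z_cont: "continuous_on {0..T} (z k)" for k
    unfolding z_def by (intro indefinite_integral_continuous_1 integrable_continuous_real f_cont)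
  have z_bd: "cmod (z k t) \<le> T * cmod (fourier_coeff b k)" if t: "t \<in> {0..T}" for k t
  proof -
    have "cmod (z k t) \<le> cmod (fourier_coeff b k) * (t - 0)"
      unfolding z_def using t b(2) by (intro integral_bound continuous_on_subset[OF f_cont]) (auto simp: norm_mult)
    also have "\<dots> \<le> cmod (fourier_coeff b k) * T" using t by (intro mult_left_mono) auto
    finally show ?thesis by (simp add: mult.commute)
  qed
  \<comment> \<open>Both majorants get non-negative coefficients, so that those of their sum add
    without cancellation.\<close>
  define m1 where "m1 = of_coeff (\<lambda>k. of_real (cmod (fourier_coeff u0 k)))"
  define m2 where "m2 = of_coeff (\<lambda>k. of_real (T * cmod (fourier_coeff b k)))"
  have m1: "fourier_coeff m1 k = of_real (cmod (fourier_coeff u0 k))" "m1 \<in> sobolev s" for k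
    unfolding m1_def by (rule of_coeff_norm[OF u0, where B = 1]; simp)+
  have m2: "fourier_coeff m2 k = of_real (T * cmod (fourier_coeff b k))" "m2 \<in> sobolev s" for k
    unfolding m2_def by (rule of_coeff_norm[OF b(1), where B = T]; use T in \<open>simp add: norm_mult\<close>)+
  define m where "m = m1 + m2"
  have m: "m \<in> sobolev s" unfolding m_def by (intro sobolev_add m1 m2)
  have m_coeff: "cmod (fourier_coeff m k) = cmod (fourier_coeff u0 k) + T * cmod (fourier_coeff b k)" for k
  proof -
    have "fourier_coeff m k = of_real (cmod (fourier_coeff u0 k) + T * cmod (fourier_coeff b k))"
      by (simp add: m_def m1 m2)
    then show ?thesis using T by (simp only: norm_of_real) simp
  qed
  have c_bd: "cmod (c t k) \<le> cmod (fourier_coeff m k)" if "t \<in> {0..T}" for t k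
    unfolding m_coeff c_def norm_mult norm_cis
    using norm_triangle_ineq[of "fourier_coeff u0 k" "z k t"] z_bd[OF that, of k] by simp
  define u where "u t = of_coeff (c t)" for t
  have uc: "fourier_coeff (u t) k = c t k" if "t \<in> {0..T}" for t k
    unfolding u_def using c_bd[OF that] by (intro of_coeff_norm(1)[OF m, of _ 1]) auto
  have u_dom: "dominated_family s {0..T} u"
  proof (rule dominated_familyI[OF _ m])
    show "cmod (fourier_coeff (u t) k) \<le> cmod (fourier_coeff m k)" if "t \<in> {0..T}" for t k
      using c_bd[OF that] uc[OF that] by simp
    have "continuous_on {0..T} (\<lambda>t. c t k)" for k
      unfolding c_def by (intro continuous_intros z_cont)
    then show "continuous_on {0..T} (\<lambda>t. fourier_coeff (u t) k)" for k
      by (rule continuous_on_eq) (simp add: uc)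
  qed
  have u_mem: "u t \<in> sobolev s" if "t \<in> {0..T}" for t
    using u_dom that by (rule dominated_family_sobolev)
  note Gh_mem = dominated_family_sobolev[OF h]
  have "mild_solution A a r g s T u0 h u"
    unfolding mild_solution_def
  proof (intro conjI ballI)
    show "sobolev_continuous_on s {0..T} u" using u_dom by (rule dominated_family_continuous)
    show "u 0 = u0"
      using T by (intro pdistr_eqI) (simp add: uc c_def z_def)
    show "distr_deriv (A (u t)) + control_op g (h t) \<in> sobolev (s - r)" if "t \<in> {0<..<T}" for t
    proof (rule sobolev_add)
      show "distr_deriv (A (u t)) \<in> sobolev (s - r)"
        using that by (intro sobolev_multiplier_derivative[OF A growth r] u_mem) auto
      show "control_op g (h t) \<in> sobolev (s - r)"
        using that r by (intro sobolev_mono[OF Gh_mem]) auto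
    qed
    fix t assume t: "t \<in> {0..T}"
    let ?f = "\<lambda>t'. propagator a (t - t') (control_op g (h t'))"
    have fc: "fourier_coeff (?f t') k = cis (eigval a k * (t - t')) * y k t'" if "t' \<in> {0..t}" for t' k
      unfolding y_def using that t by (intro fourier_coeff_propagator[where s = s] Gh_mem) auto
    show "has_sobolev_integral s (lebesgue_on {0..t}) ?f (u t - propagator a t u0)"
    proof (rule dominated_family_has_integral(2))
      show "dominated_family s {0..t} ?f"
      proof (rule dominated_familyI[OF _ b(1)])
        have "continuous_on {0..t} (\<lambda>t'. cis (eigval a k * (t - t')) * y k t')" for k
          using t by (intro continuous_intros continuous_on_subset[OF y_cont]) auto
        then show "continuous_on {0..t} (\<lambda>t'. fourier_coeff (?f t') k)" for k
          by (rule continuous_on_eq) (simp add: fc)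
        show "cmod (fourier_coeff (?f t') k) \<le> cmod (fourier_coeff b k)" if "t' \<in> {0..t}" for t' k
          using fc[OF that, of k] b(2)[of t' k] that t by (simp add: norm_mult)
      qed
      show "0 \<le> t" using t by simp
      fix k
      have "integral {0..t} (\<lambda>t'. fourier_coeff (?f t') k) = integral {0..t} (\<lambda>t'. cis (eigval a k * t) * (y k t' * cis (- (eigval a k * t'))))"
      proof (rule integral_cong)
        fix t' assume "t' \<in> {0..t}"
        have "cis (eigval a k * (t - t')) = cis (eigval a k * t) * cis (- (eigval a k * t'))"
          by (simp add: cis_mult algebra_simps)
        then show "fourier_coeff (?f t') k = cis (eigval a k * t) * (y k t' * cis (- (eigval a k * t')))"
          using fc[OF \<open>t' \<in> {0..t}\<close>, of k] by simp
      qed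
      also have "\<dots> = cis (eigval a k * t) * z k t"
        by (simp add: z_def)
      finally show "fourier_coeff (u t - propagator a t u0) k = integral {0..t} (\<lambda>t'. fourier_coeff (?f t') k)"
        using t by (simp add: uc c_def fourier_coeff_propagator[OF u0] distrib_left)
    qed
  qed
  moreover have "fourier_coeff (u t) k = cis (eigval a k * t) *
      (fourier_coeff u0 k + integral {0..t} (\<lambda>t'. fourier_coeff (control_op g (h t')) k * cis (- (eigval a k * t'))))"
    if "t \<in> {0..T}" for t k
    using uc[OF that] by (simp add: c_def z_def y_def)
  ultimately show thesis using that by blast
qed

lemma L2_sobolev_dominated:
  assumes h: "dominated_family s {0..T} h" and T: "0 \<le> T"
    and bd: "\<And>t. t \<in> {0..T} \<Longrightarrow> sobolev_norm s (h t) \<le> B"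
  shows "h \<in> L2_sobolev T s" and "L2_sobolev_norm T s h \<le> sqrt T * B"
proof -
  have int: "integrable (lebesgue_on {0..T}) (\<lambda>t. (sobolev_norm s (h t))\<^sup>2)"
    by (intro continuous_imp_integrable_real continuous_intros dominated_family_norm h)
  with dominated_family_measurable[OF h T] show "h \<in> L2_sobolev T s"
    by (simp add: L2_sobolev_def)
  have B: "0 \<le> B" using order_trans[OF sobolev_norm_nonneg bd[of 0]] T by simp
  have c: "integrable (lebesgue_on {0..T}) (\<lambda>_. B\<^sup>2)"
    by (intro continuous_imp_integrable_real continuous_intros)
  have "(LINT t|lebesgue_on {0..T}. (sobolev_norm s (h t))\<^sup>2) \<le> (LINT t|lebesgue_on {0..T}. B\<^sup>2)"
    using int c bd by (intro integral_mono) (auto intro!: power_mono)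
  also have "\<dots> = T * B\<^sup>2"
    using T lebesgue_integral_eq_integral[OF c] by simp
  finally have "L2_sobolev_norm T s h \<le> sqrt (T * B\<^sup>2)"
    unfolding L2_sobolev_norm_def by (rule real_sqrt_le_mono)
  then show "L2_sobolev_norm T s h \<le> sqrt T * B"
    using B by (simp add: real_sqrt_mult)
qed

section \<open>From the gap conditions to controllability\<close>

lemma spectral_gap_le:
  "k \<in> K \<Longrightarrow> n \<in> K \<Longrightarrow> k \<noteq> n \<Longrightarrow> spectral_gap a K \<le> ereal \<bar>eigval a k - eigval a n\<bar>"
  unfolding spectral_gap_def by (rule INF_lower2[of "(k, n)"]) auto

lemma real_between_ereal:
  assumes "ereal x < y" obtains z where "x < z" "ereal z \<le> y"
proof (cases y)
  case (real r)
  with assms that[of r] show thesis by simp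
next
  case PInf
  with that[of "x + 1"] show thesis by simp
next
  case MInf
  with assms show thesis by simp
qed

theorem theorem1p5:
  fixes s r C T :: real
    and k\<^sub>0 n\<^sub>0 k\<^sub>1 :: nat
    and a :: "int \<Rightarrow> real"
    and A :: "pdistr \<Rightarrow> pdistr"
    and g :: "real \<Rightarrow> real"
    and J :: "int set"
  assumes multiplier: "fourier_multiplier A (\<lambda>k. of_real (a k))"
    and growth: "r \<ge> 1" "C > 0" "\<And>k. \<bar>k\<bar> \<ge> int k\<^sub>0 \<Longrightarrow> \<bar>a k\<bar> \<le> C * \<bar>of_int k\<bar> powr (r - 1)"
    and profile: "control_profile g"
    and eigen: "\<And>k. distr_deriv (A (fourier_mode k)) = cscale (\<i> * of_real (eigval a k)) (fourier_mode k)"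
    and mult_low: "\<And>k. \<bar>k\<bar> < int k\<^sub>1 \<Longrightarrow> eigval_mult a k \<le> enat n\<^sub>0"
    and mult_high: "\<And>k. \<bar>k\<bar> \<ge> int k\<^sub>1 \<Longrightarrow> eigval_mult a k = 2"
    and odd: "\<And>k. \<bar>k\<bar> \<ge> int k\<^sub>1 \<Longrightarrow> a (- k) = - a k"
    and J_subset: "J \<subseteq> {- int k\<^sub>1 + 1..}"
    and J_representatives: "\<And>k. \<exists>!j. j \<in> J \<and> j \<in> eigval_class a k"
    and gap: "spectral_gap a J > 0"
    and asym_gap: "asymptotic_gap a J > 0"
    and time: "ereal T > ereal (2 * pi) / asymptotic_gap a J"
  shows "\<exists>\<nu>>0. \<forall>u0\<in>sobolev s. \<forall>u1\<in>sobolev s.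
    fourier_coeff u0 0 = fourier_coeff u1 0 \<longrightarrow>
    (\<exists>h\<in>L2_sobolev T s.
      (\<exists>u. mild_solution A a r g s T u0 h u \<and>
           (\<forall>v. mild_solution A a r g s T u0 h v \<longrightarrow> (\<forall>t\<in>{0..T}. v t = u t)) \<and>
           u T = u1) \<and>
      L2_sobolev_norm T s h \<le> \<nu> * (sobolev_norm s u0 + sobolev_norm s u1))"
proof -
  interpret profile g by unfold_locales (rule profile)
  let ?ev = "eigval a"
  let ?cl = "eigval_class a"
  have cl_refl: "k \<in> ?cl k" and cl_eq: "l \<in> ?cl k \<Longrightarrow> ?cl l = ?cl k" for k l
    by (auto simp: eigval_class_def)
  have fin: "finite (?cl k)" for k
    using mult_low[of k] mult_high[of k] by (cases "\<bar>k\<bar> < int k\<^sub>1") (auto simp: eigval_mult_def split: if_splits)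
  have neg: "?ev (- k) = ?ev k" if "\<bar>k\<bar> \<ge> int k\<^sub>1" for k
    using odd[OF that] by (simp add: eigval_def)
  have two: "card (?cl k) = 2" if "\<bar>k\<bar> \<ge> int k\<^sub>1" for k
    using mult_high[OF that] fin[of k] by (simp add: eigval_mult_def numeral_eq_enat)
  have high: "?cl k = {k, - k}" if k: "\<bar>k\<bar> \<ge> int k\<^sub>1" for k
  proof -
    have pair: "?cl l = {l, - l}" if "\<bar>l\<bar> \<ge> int k\<^sub>1" "l \<noteq> 0" for l
    proof (rule card_subset_eq[symmetric])
      show "{l, - l} \<subseteq> ?cl l" using neg[OF that(1)] by (auto simp: eigval_class_def)
      show "card {l, - l} = card (?cl l)" using two[OF that(1)] that(2) by auto
    qed (rule fin)
    \<comment> \<open>If mode 0 counted as high, \<open>k\<^sub>1\<close> would be 0 and its class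
      would have a second member l. Then l is high too and its class is {l, -l}, which omits
      0.\<close>
    have "k \<noteq> 0"
    proof
      assume "k = 0"
      have "\<not> ?cl 0 \<subseteq> {0}"
      proof
        assume "?cl 0 \<subseteq> {0}"
        then have "card (?cl 0) \<le> card {0 :: int}" by (intro card_mono) auto
        with two[OF k] \<open>k = 0\<close> show False by simp
      qed
      then obtain l where l: "l \<in> ?cl 0" "l \<noteq> 0" by auto
      have "?cl l = {l, - l}" using k \<open>k = 0\<close> l by (intro pair) auto
      moreover have "0 \<in> ?cl l" using l(1) by (simp add: eigval_class_def)
      ultimately show False using l(2) by auto
    qed
    with pair k show ?thesis by blast
  qed
  have rep: "\<exists>j\<in>J. ?ev j = ?ev k" for k
    using J_representatives[of k] by (auto simp: eigval_class_def)
  obtain \<delta> where \<delta>: "0 < \<delta>" "ereal \<delta> \<le> spectral_gap a J"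
    using real_between_ereal[of 0 "spectral_gap a J"] gap by (auto simp: zero_ereal_def)
  \<comment> \<open>The time condition is inverted to 2 pi / T < gap, a form that also covers an
    infinite asymptotic gap, where it amounts to T > 0.\<close>
  have T: "0 < T" and TG: "ereal (2 * pi / T) < asymptotic_gap a J"
  proof -
    have "0 \<le> ereal (2 * pi) / asymptotic_gap a J"
      using asym_gap by (intro zero_le_divide_ereal) auto
    then have "0 < ereal T" using time by (rule le_less_trans)
    then show T: "0 < T" by simp
    show "ereal (2 * pi / T) < asymptotic_gap a J"
    proof (cases "asymptotic_gap a J")
      case (real x)
      then have "0 < x" "2 * pi / x < T" using asym_gap time by auto
      with T show ?thesis by (simp add: real field_simps)
    qed (use asym_gap in auto)
  qed
  obtain S where S: "S \<subseteq> J" "finite S" "ereal (2 * pi / T) < spectral_gap a (J - S)"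
    using TG unfolding asymptotic_gap_def less_SUP_iff by auto
  \<comment> \<open>A real value is needed, and the gap of \<open>J - S\<close> is infinite if at
    most one index is left.\<close>
  obtain \<gamma>' where \<gamma>': "2 * pi / T < \<gamma>'" "ereal \<gamma>' \<le> spectral_gap a (J - S)"
    using real_between_ereal[OF S(3)] by blast
  have "0 < 2 * pi / T" using T by simp
  then have \<gamma>'0: "0 < \<gamma>'" using \<gamma>'(1) by linarith
  have T\<gamma>: "2 * pi / \<gamma>' < T" using \<gamma>'(1) \<gamma>'0 T by (simp add: field_simps)
  have sep: "\<delta> \<le> \<bar>x - y\<bar>" if xy: "x \<in> ?ev ` J" "y \<in> ?ev ` J" "x \<noteq> y" for x y
  proof -
    obtain j j' where j: "j \<in> J" "j' \<in> J" "x = ?ev j" "y = ?ev j'" using xy by auto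
    then have "j \<noteq> j'" using xy(3) by auto
    from order_trans[OF \<delta>(2) spectral_gap_le[OF j(1,2) this]] j(3,4) show ?thesis by simp
  qed
  have sep': "\<gamma>' \<le> \<bar>x - y\<bar>" if xy: "x \<in> ?ev ` J - ?ev ` S" "y \<in> ?ev ` J - ?ev ` S" "x \<noteq> y" for x y
  proof -
    obtain j j' where j: "j \<in> J - S" "j' \<in> J - S" "x = ?ev j" "y = ?ev j'" using xy by auto
    then have "j \<noteq> j'" using xy(3) by auto
    from order_trans[OF \<gamma>'(2) spectral_gap_le[OF j(1,2) this]] j(3,4) show ?thesis by simp
  qed
  obtain B q where q: "\<And>x. x \<in> ?ev ` J \<Longrightarrow> pulse T (q x)" "\<And>x t. x \<in> ?ev ` J \<Longrightarrow> cmod (q x t) \<le> B"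
    "\<And>x y. x \<in> ?ev ` J \<Longrightarrow> y \<in> ?ev ` J \<Longrightarrow> ft (q x) y = (if y = x then 1 else 0)"
    by (rule biorthogonal_exponentials[OF \<delta>(1) sep \<gamma>'0 finite_imageI[OF S(2)] sep' T\<gamma>]) (assumption+, rule that)
  have ev_mem: "?ev k \<in> ?ev ` J" for k using rep[of k] by (metis image_eqI)
  define Q where "Q n = q (?ev n)" for n
  have Q: "continuous_on UNIV (Q n)" "cmod (Q n t) \<le> B" for n t
    using q(1)[OF ev_mem] q(2)[OF ev_mem] by (auto simp: Q_def pulse_def)
  have Q_int: "integral {0..T} (\<lambda>t. Q n t * cis (- (?ev k * t))) = (if n \<in> ?cl k then 1 else 0)" for n k
    using integral_unique[OF has_integral_ft[OF q(1)[OF ev_mem]], of n "?ev k"] q(3)[OF ev_mem ev_mem, of n k]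
    by (auto simp: Q_def eigval_class_def)
  have B: "0 \<le> B" using order_trans[OF norm_ge_zero Q(2)] .
  obtain K where K: "0 \<le> K" "\<And>v. v \<in> sobolev s \<Longrightarrow> fourier_coeff v 0 = 0 \<Longrightarrow>
    \<exists>w\<in>sobolev s. sobolev_norm s w \<le> K * sobolev_norm s v \<and>
      (\<forall>l. (\<Sum>n\<in>?cl l. ctrl_matrix g l n * fourier_coeff w n) = fourier_coeff v l)"
    by (rule gram_system_solvable[of ?cl k\<^sub>1, OF fin high cl_refl cl_eq]) (assumption+, rule that)
  \<comment> \<open>The summand 1 only secures positivity, as \<open>B\<close> and \<open>K\<close>
    may be 0.\<close>
  define \<nu> where "\<nu> = sqrt T * (B * K) + 1"
  have \<nu>: "0 < \<nu>" using T B K(1) by (simp add: \<nu>_def add_nonneg_pos)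
  show ?thesis
  proof (intro exI[of _ \<nu>] conjI \<nu> ballI impI)
    fix u0 u1 assume u0: "u0 \<in> sobolev s" and u1: "u1 \<in> sobolev s" and mean: "fourier_coeff u0 0 = fourier_coeff u1 0"
    \<comment> \<open>The moments to be produced: rotating the coefficients of \<open>u T\<close>
      back by exp(-i \<lambda>_k T) turns \<open>u T = u1\<close> into this condition on the Duhamel
      integral. At mode 0 the eigenvalue is 0, so equal means give a zero moment.\<close>
    define v where "v = of_coeff (\<lambda>k. cis (- (?ev k * T)) * fourier_coeff u1 k) - u0"
    note rot = of_coeff_norm[OF u1, of "\<lambda>k. cis (- (?ev k * T)) * fourier_coeff u1 k" 1]
    have v: "v \<in> sobolev s" "fourier_coeff v k = cis (- (?ev k * T)) * fourier_coeff u1 k - fourier_coeff u0 k"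
      "sobolev_norm s v \<le> sobolev_norm s u0 + sobolev_norm s u1" for k
    proof -
      show "v \<in> sobolev s" unfolding v_def using u0 by (intro sobolev_diff rot(2)) (auto simp: norm_mult)
      show "fourier_coeff v k = cis (- (?ev k * T)) * fourier_coeff u1 k - fourier_coeff u0 k"
        unfolding v_def by (subst fourier_coeff_diff, subst rot(1)) (auto simp: norm_mult)
      have "sobolev_norm s v \<le> sobolev_norm s (of_coeff (\<lambda>k. cis (- (?ev k * T)) * fourier_coeff u1 k)) + sobolev_norm s u0"
        unfolding v_def using u0 by (intro sobolev_norm_triangle_diff rot(2)) (auto simp: norm_mult)
      also have "sobolev_norm s (of_coeff (\<lambda>k. cis (- (?ev k * T)) * fourier_coeff u1 k)) \<le> 1 * sobolev_norm s u1"
        by (rule rot(3)) (auto simp: norm_mult)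
      finally show "sobolev_norm s v \<le> sobolev_norm s u0 + sobolev_norm s u1" by simp
    qed
    have "fourier_coeff v 0 = 0" using v(2)[of 0] mean by (simp add: eigval_def)
    then obtain w where w: "w \<in> sobolev s" "sobolev_norm s w \<le> K * sobolev_norm s v"
      "\<And>l. (\<Sum>n\<in>?cl l. ctrl_matrix g l n * fourier_coeff w n) = fourier_coeff v l"
      using K(2)[OF v(1)] by blast
    define h where "h t = of_coeff (\<lambda>n. fourier_coeff w n * Q n t)" for t
    note ctrl = control_family[where Q = Q, OF w(1) Q, folded h_def]
    have h_dom: "dominated_family s {0..T} h" and Gh_dom: "dominated_family s {0..T} (\<lambda>t. control_op g (h t))"
      using ctrl(2,4) by (auto intro: dominated_family_subset)
    \<comment> \<open>The time integral of the profile of n is the indicator of the class of k, so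
      the infinite row sum collapses to the block system solved by \<open>w\<close>.\<close>
    have moment: "integral {0..T} (\<lambda>t. fourier_coeff (control_op g (h t)) k * cis (- (?ev k * t))) = fourier_coeff v k" for k
    proof -
      have "((\<lambda>n. ctrl_matrix g k n * fourier_coeff w n * (if n \<in> ?cl k then 1 else 0)) has_sum
          (\<Sum>n\<in>?cl k. ctrl_matrix g k n * fourier_coeff w n)) UNIV"
        by (rule has_sum_finite_neutralI[OF fin[of k]]) auto
      from has_sum_unique[OF this ctrl(5)[where k = k and T = T and \<mu> = "?ev k", unfolded Q_int]] show ?thesis
        using w(3)[of k] by simp
    qed
    obtain u where u: "mild_solution A a r g s T u0 h u"
      "\<And>t k. t \<in> {0..T} \<Longrightarrow> fourier_coeff (u t) k = cis (?ev k * t) *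
        (fourier_coeff u0 k + integral {0..t} (\<lambda>t'. fourier_coeff (control_op g (h t')) k * cis (- (?ev k * t'))))"
      by (rule mild_solution_exists[OF multiplier growth(3) _ growth(2) _ u0 Gh_dom]) (assumption | use growth T in simp | rule that)+
    have uT: "u T = u1"
    proof (rule pdistr_eqI)
      fix k
      have "fourier_coeff (u T) k = cis (?ev k * T) * (fourier_coeff u0 k + fourier_coeff v k)"
        using u(2)[of T k] T by (simp add: moment)
      also have "\<dots> = (cis (?ev k * T) * cis (- (?ev k * T))) * fourier_coeff u1 k"
        by (simp add: v(2))
      also have "\<dots> = fourier_coeff u1 k" by (simp add: cis_mult)
      finally show "fourier_coeff (u T) k = fourier_coeff u1 k" .
    qed
    have "0 \<le> T" using T by simp
    note L2 = L2_sobolev_dominated[OF h_dom \<open>0 \<le> T\<close> ctrl(3)]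
    show "\<exists>h\<in>L2_sobolev T s.
      (\<exists>u. mild_solution A a r g s T u0 h u \<and>
           (\<forall>v. mild_solution A a r g s T u0 h v \<longrightarrow> (\<forall>t\<in>{0..T}. v t = u t)) \<and>
           u T = u1) \<and>
      L2_sobolev_norm T s h \<le> \<nu> * (sobolev_norm s u0 + sobolev_norm s u1)"
    proof (intro bexI[of _ h] conjI exI[of _ u] allI impI ballI u(1) uT L2(1))
      show "v' t = u t" if "mild_solution A a r g s T u0 h v'" "t \<in> {0..T}" for v' t
        using Gh_dom u(1) that by (rule mild_solution_unique)
      have "L2_sobolev_norm T s h \<le> sqrt T * (B * sobolev_norm s w)" by (rule L2(2))
      also have "\<dots> \<le> sqrt T * (B * (K * (sobolev_norm s u0 + sobolev_norm s u1)))"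
        using T B K(1) order_trans[OF w(2) mult_left_mono[OF v(3) K(1)]] by (intro mult_left_mono) auto
      also have "\<dots> = (sqrt T * (B * K)) * (sobolev_norm s u0 + sobolev_norm s u1)"
        by (simp add: mult_ac)
      also have "\<dots> \<le> \<nu> * (sobolev_norm s u0 + sobolev_norm s u1)"
        by (intro mult_right_mono) (auto simp: \<nu>_def)
      finally show "L2_sobolev_norm T s h \<le> \<nu> * (sobolev_norm s u0 + sobolev_norm s u1)" .
    qed
  qed
qed

end
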